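(* Consider the class of third-order ODEs $y'''=f(x,y,y',y'')$ with $f_{4,4,4}\neq 0$ (and on the domain where $f_{4,4}\ne 0$, so that the expressions below are defined), where, with $p=y'$, $q=y''$, the subscripts $1,2,3,4$ on $f$ denote partial derivatives with respect to $x,y,p,q$. With $\lambda_4,\dots,\lambda_{19}$ the expressions in $f$ and its derivatives listed in the context, define $$\begin{aligned} \gamma_4={}&\lambda_4,\qquad \gamma_5=\lambda_6,\\ \gamma_6={}&-\frac{2\lambda_4^2\lambda_7+3\lambda_7^2-3\lambda_6\lambda_8}{3\lambda_6},\\ \gamma_7={}&-\frac{2\lambda_4^3\lambda_7+3\lambda_7^2\lambda_4-3\lambda_6^2\lambda_5-6\lambda_6\lambda_4\lambda_9}{6\lambda_6\lambda_4},\\ \gamma_8={}&\frac{2\lambda_6\lambda_4\lambda_5+6\lambda_6\lambda_{10}-6\lambda_7\lambda_9+3\lambda_7\lambda_8}{6\lambda_6},\\ \gamma_9={}&\frac{1}{6\lambda_6^2\lambda_4^2}\big(4\lambda_6\lambda_4^3\lambda_7\lambda_5+6\lambda_4^2\lambda_6^2\lambda_{11}+12\lambda_4^2\lambda_6\lambda_7\lambda_{10}-6\lambda_4^2\lambda_7^2\lambda_9+3\lambda_4^2\lambda_7^2\lambda_8\\ &+3\lambda_6^2\lambda_4\lambda_5\lambda_8-12\lambda_6^2\lambda_4\lambda_5\lambda_9+3\lambda_6\lambda_4\lambda_5\lambda_7^2-3\lambda_6^3\lambda_5^2\big),\\ \gamma_{10}={}&\frac{3\lambda_5+\lambda_4\lambda_{12}}{\lambda_4},\qquad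 \gamma_{11}=\lambda_{14},\\ \gamma_{12}={}&-\frac{\lambda_{14}\lambda_7+\lambda_6\lambda_5-\lambda_6\lambda_{15}}{\lambda_6},\\ \gamma_{13}={}&-\frac{-3\lambda_{16}\lambda_6^2+6\lambda_6\lambda_7\lambda_{15}+2\lambda_6\lambda_7\lambda_4\lambda_{12}-3\lambda_{14}\lambda_7^2}{3\lambda_6^2},\\ \gamma_{14}={}&\frac{2\lambda_4\lambda_6^2\lambda_{17}+2\lambda_4\lambda_6\lambda_7\lambda_5-2\lambda_4\lambda_6\lambda_7\lambda_{15}+\lambda_4\lambda_{14}\lambda_7^2+\lambda_6^2\lambda_5\lambda_{14}}{2\lambda_6^2\lambda_4},\\ \gamma_{15}={}&\frac{1}{6\lambda_4\lambda_6^3}\big(2\lambda_6^3\lambda_4\lambda_5\lambda_{12}+6\lambda_6^3\lambda_4\lambda_{18}+3\lambda_6^3\lambda_5^2+3\lambda_6^3\lambda_5\lambda_{15}-6\lambda_7\lambda_6^2\lambda_4\lambda_{17}-6\lambda_7\lambda_6^2\lambda_4\lambda_{16}\\ &-3\lambda_7\lambda_6^2\lambda_5\lambda_{14}-3\lambda_6\lambda_4\lambda_5\lambda_7^2+9\lambda_7^2\lambda_4\lambda_6\lambda_{15}+2\lambda_7^2\lambda_4^2\lambda_6\lambda_{12}-3\lambda_{14}\lambda_7^3\lambda_4\big),\\ \gamma_{16}={}&-3\lambda_{13}+\lambda_{19}. \end{aligned}$$ Then all the third-order differential invariants of the class under the pseudo-group of fiber preserving transformations $\bar x=\phi(x),\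 \bar y=\psi(x,y)$ are functions of the following eleven differential invariants: $$\beta_1=\frac{\gamma_6\gamma_5}{\gamma_4^4},\quad \beta_2=\frac{\gamma_7\gamma_5}{\gamma_4^4},\quad \beta_3=\frac{\gamma_8\gamma_5^2}{\gamma_4^6},\quad \beta_4=\frac{\gamma_9\gamma_5^3}{\gamma_4^8},\quad \beta_5=\frac{\gamma_5^2\gamma_{10}}{\gamma_4^4},\quad \beta_6=\frac{\gamma_5\gamma_{11}}{\gamma_4^3},$$ $$\beta_7=\frac{\gamma_{12}\gamma_5^2}{\gamma_4^5},\quad \beta_8=\frac{\gamma_{13}\gamma_5^3}{\gamma_4^7},\quad \beta_9=\frac{\gamma_{14}\gamma_5^3}{\gamma_4^7},\quad \beta_{10}=\frac{\gamma_{15}\gamma_5^4}{\gamma_4^9},\quad \beta_{11}=\frac{\gamma_{16}\gamma_5^3}{\gamma_4^6},$$ where the $\gamma_i$, $4\le i\le 16$, are relative invariants. Moreover, the invariant differentiation operators are $$\begin{aligned} \mathcal D_1={}&\frac{f_{4,4}}{f_{4,4,4}}\tilde D_q,\qquad \mathcal D_2=\frac{1}{f_{4,4}f_{4,4,4}}\left(f_{4,4,4}\tilde D_p-f_{3,4,4}\tilde D_q\right),\\ \mathcal D_3={}&\frac{1}{f_{4,4}^4f_{4,4,4}}\Big(6f_{4,4}f_{4,4,4}^2\tilde D_y-2f_{4,4}f_{4,4,4}\left(f_4f_{4,4,4}+3f_{3,4,4}\right)\tilde D_p\\ &+\left(3f_{4,4}f_{3,4,4}^2+f_{4,4,4}^2\left(3f_{3,3}+2f_{3,4}f_4-6f_{2,4}\right)\right)\tilde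 D_q\Big),\\ \mathcal D_4={}&\frac{f_{4,4,4}}{f_{4,4}^2}\left(\tilde D_x+p\tilde D_y+q\tilde D_p+f\tilde D_q\right). \end{aligned}$$
   Context: Notation: $p=y'$, $q=y''$; $f=f(x,y,p,q)$; $f_i$, $f_{i,j}$, $f_{i,j,k}$ with indices in $\{1,2,3,4\}$ are partial derivatives of $f$ with respect to $x,y,p,q$ (in this order). $\dot D_x=\partial_x+p\partial_y+q\partial_p+f\partial_q$ acts on functions of $(x,y,p,q)$, and $\dot D_x^2$ is its twofold iteration. The expressions $\lambda_i$ are: $$\begin{aligned} \lambda_4={}&f_{4,4},\\ \lambda_5={}&\tfrac13\left(2f_{3,4}f_4-2f_3f_{4,4}-6f_{2,4}+3f_{3,3}\right),\\ \lambda_6={}&f_{4,4,4},\\ \lambda_7={}&\tfrac13\left(2f_4f_{4,4,4}+3f_{3,4,4}\right),\\ \lambda_8={}&\tfrac19\left(4f_{4,4,4}f_4^2+12f_4f_{3,4,4}+4f_4f_{4,4}^2+9f_{3,3,4}+6f_{3,4}f_{4,4}\right),\\ \lambda_9={}&\tfrac19\left(2f_{4,4,4}f_4^2+2f_4f_{4,4}^2+3f_4f_{3,4,4}+3f_{4,4,4}f_3+9f_{2,4,4}+3f_{3,4}f_{4,4}\right),\\ \lambda_{10}={}&\tfrac1{18}\big(-4f_4^2f_{3,4,4}+4f_4f_{4,4,4}f_3+12f_4f_{2,4,4}-12f_{3,3,4}f_4-4f_4f_{3,4}f_{4,4}-6f_{3,4}^2-9f_{3,3,3}\\ &+4f_{4,4}^2f_3+6f_3f_{3,4,4}+12f_{2,4}f_{4,4}+18f_{2,3,4}\big),\\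 \lambda_{11}={}&\tfrac1{27}\big(-4f_4f_3f_{4,4}^2-6f_{4,4}f_{3,4}f_3-18f_{4,4}f_{2,3}-12f_{4,4}f_{2,4}f_4+4f_{4,4}f_{3,4}f_4^2-6f_{4,4,4}f_3^2-36f_3f_{2,4,4}\\ &-4f_3f_{4,4,4}f_4^2+9f_3f_{3,3,4}+12f_{3,4}^2f_4+9f_{3,4}f_{3,3}+4f_4^3f_{3,4,4}-12f_4^2f_{2,4,4}+12f_{3,3,4}f_4^2\\ &+9f_4f_{3,3,3}-54f_{2,2,4}+27f_{2,3,3}\big),\\ \lambda_{12}={}&\tfrac13\left(-f_4^2-3f_3+3\dot D_xf_4\right),\\ \lambda_{13}={}&\tfrac19\left(-2f_4^3-9f_4f_3+6f_4\dot D_xf_4-27f_2+9\dot D_xf_3\right),\\ \lambda_{14}={}&\tfrac13\left(3\dot D_xf_{4,4}+f_{4,4}f_4\right),\\ \lambda_{15}={}&\tfrac19\left(2f_{4,4}f_4^2+3f_3f_{4,4}+6f_4\dot D_xf_{4,4}-9f_{2,4}+9\dot D_xf_{3,4}\right),\\ \lambda_{16}={}&\tfrac19\big(4f_4^2\dot D_xf_{4,4}-2f_4^2f_{3,4}-3f_4f_{3,3}+12f_4\dot D_xf_{3,4}+4f_4f_{4,4}\dot D_xf_4-12f_{2,4}f_4+6f_{3,4}\dot D_xf_4\\ &-18f_{2,3}+9\dot D_xf_{3,3}\big),\\ \lambda_{17}={}&\tfrac1{27}\big(2f_{4,4}f_4^3-6f_4^2f_{3,4}+6f_4^2\dot D_xf_{4,4}-9f_4f_{3,3}+12f_4f_3f_{4,4}+9f_4\dot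 D_xf_{3,4}-9f_{2,4}f_4+9f_3\dot D_xf_{4,4}\\ &-27f_{2,3}+27f_2f_{4,4}+27\dot D_xf_{2,4}\big),\\ \lambda_{18}={}&\tfrac1{27}\big(-9f_3^2f_{4,4}+9f_3\dot D_xf_{3,4}+6f_3f_4\dot D_xf_{4,4}+6f_3f_{4,4}\dot D_xf_4+6f_3f_{3,4}f_4-54f_3f_{2,4}+9f_3f_{3,3}\\ &+4f_{4,4}f_4^2\dot D_xf_4+6f_{3,4}f_4\dot D_xf_4+18f_{2,4}\dot D_xf_4+27f_2f_{3,4}-2f_{3,4}f_4^3-30f_4^2f_{2,4}+18f_4f_{4,4}f_2\\ &+4f_4^3\dot D_xf_{4,4}+12f_4^2\dot D_xf_{3,4}-3f_4^2f_{3,3}+9f_4\dot D_xf_{3,3}+18f_4\dot D_xf_{2,4}-45f_4f_{2,3}-81f_{2,2}+27\dot D_xf_{2,3}\big),\\ \lambda_{19}={}&\tfrac19\left(-2f_4^3-9f_4f_3-27f_2+9\dot D_x^2f_4\right). \end{aligned}$$ Equivalence transformations: an invertible (local) point transformation $\bar x=\phi$, $\bar y=\psi$ maps each equation $y'''=f(x,y,y',y'')$ to an equation $\bar y'''=\bar f(\bar x,\bar y,\bar y',\bar y'')$ of the same class; it thereby acts (by prolongation) on the variables $x,y,p,q$, on $f$ and on all partial derivatives of $f$. Here the pseudo-group is that of fiber preserving transformations $\bar x=\phi(x)$, $\bar y=\psi(x,y)$, with $\phi,\psi$ arbitrary. Its infinitesimal generators are, for arbitrary $\xi(x)$ and $\eta(x,y)$,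 $$Y=\xi\,\partial_x+\eta\,\partial_y+\zeta_1\,\partial_p+\zeta_2\,\partial_q+\mu\,\partial_f,\qquad \zeta_1=\dot D_x\eta-p\,\xi',\quad \zeta_2=\dot D_x\zeta_1-q\,\xi',\quad \mu=\dot D_x\zeta_2-f\,\xi',$$ and $Y^{(s)}$ denotes the prolongation of $Y$ to the partial derivatives of $f$ up to order $s$, where $f$ is regarded as a dependent variable and $x,y,p,q$ as independent variables. A differential invariant of order $s$ is a function $J(x,y,p,q,f,f_{(1)},\dots,f_{(s)})$, with $f_{(k)}$ the collection of all $k$-th order partial derivatives of $f$, which is invariant under the equivalence transformations considered; these functions are determined by the infinitesimal criterion $Y^{(s)}J=0$ for all generators $Y$. "Third-order differential invariants" are those with $s=3$ (they may depend on derivatives of order up to 3). "Are functions of" refers to (local) functional dependence: the listed invariants form a complete set of functionally independent solutions. A relative invariant is a function $\gamma$ of the same variables whose vanishing is preserved, i.e. $Y^{(s)}\gamma$ is a multiple of $\gamma$. For $k\in\{x,y,p,q\}$, $\tilde D_k=\partial_k+f_k\partial_f+\sum_i f_{ki}\partial_{f_i}+\cdots$ is the operator of total differentiation with respect to the independent variable $k$, with $f$ the dependent variable. An invariant differentiation operator is an operator $\mathcal D=K\tilde D_x+L\tilde D_y+M\tilde D_p+N\tilde D_q$, with coefficients $K,L,M,N$ depending on $x,y,p,q,f$ and derivatives of $f$ up to order 3, such that $\mathcal D I$ is a differential invariant whenever $I$ is a differential invariant. The number of independent such operators equals the number of independent variables $x,y,p,q$, i.e. four; the assertion is that $\mathcal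 D_1,\dots,\mathcal D_4$ are four independent invariant differentiation operators. *)

theory Defs
  imports "HOL-Analysis.Analysis" "HOL-Library.Multiset"
begin

section \<open>Jet space\<close>

text \<open>
  The index type \<open>4\<close> has the elements \<open>1, 2, 3, 4\<close> (with \<open>4 = 0\<close>); they stand for the
  independent variables \<open>x, y, p, q\<close>.  \<open>Base k\<close> is the coordinate of the \<open>k\<close>-th independent
  variable and \<open>Der \<alpha>\<close> that of the partial derivative \<open>f\<^sub>\<alpha>\<close>, so that \<open>Der {#}\<close> is \<open>f\<close>
  itself.  Using multisets as multi-indices identifies the mixed partial derivatives.
  Jets of infinite order are used so that invariants of all orders live on one space; the topology
  is the product topology.
\<close>

datatype coord = Base 4 | Der "4 multiset"

type_synonym jet = "coord \<Rightarrow> real"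

definition fd :: "4 list \<Rightarrow> jet \<Rightarrow> real" where
  "fd ks z = z (Der (mset ks))"

fun jet_order :: "coord \<Rightarrow> nat" where
  "jet_order (Base k) = 0"
| "jet_order (Der \<alpha>) = size \<alpha>"

text \<open>
  \<open>J\<close> is a function on the part \<open>U\<close> of the space of jets of order \<open>s\<close>: both membership in \<open>U\<close>
  and the value of \<open>J\<close> are determined by the coordinates of order at most \<open>s\<close>.
\<close>

definition order_le :: "nat \<Rightarrow> jet set \<Rightarrow> (jet \<Rightarrow> real) \<Rightarrow> bool" where
  "order_le s U J \<longleftrightarrow>
     (\<forall>z\<in>U. \<forall>z'. (\<forall>c. jet_order c \<le> s \<longrightarrow> z' c = z c) \<longrightarrow> z' \<in> U \<and> J z' = J z)"


section \<open>Smooth functions\<close>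

definition pd :: "'c \<Rightarrow> (('c \<Rightarrow> real) \<Rightarrow> real) \<Rightarrow> ('c \<Rightarrow> real) \<Rightarrow> real" where
  "pd c J z = deriv (\<lambda>t. J (z(c := t))) (z c)"

text \<open>
  For functions of finitely many coordinates this is the usual class of infinitely differentiable
  functions: all iterated partial derivatives exist and are continuous.
\<close>

definition smooth_on :: "('c \<Rightarrow> real) set \<Rightarrow> (('c \<Rightarrow> real) \<Rightarrow> real) \<Rightarrow> bool" where
  "smooth_on U J \<longleftrightarrow> open U \<and>
     (\<forall>cs. continuous_on U (foldr pd cs J) \<and>
       (\<forall>c. \<forall>z\<in>U. (\<lambda>t. foldr pd cs J (z(c := t))) differentiable (at (z c))))"


section \<open>Total differentiation\<close>

text \<open>
  The sum is finite for functions of finite order, since only finitely many partial derivatives of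
  such a function are nonzero.
\<close>

definition Dtot :: "4 \<Rightarrow> (jet \<Rightarrow> real) \<Rightarrow> jet \<Rightarrow> real" where
  "Dtot k J z = pd (Base k) J z +
     (\<Sum>\<alpha> | pd (Der \<alpha>) J z \<noteq> 0. z (Der (add_mset k \<alpha>)) * pd (Der \<alpha>) J z)"

text \<open>
  The operator \<open>\<partial>\<^sub>x + p \<partial>\<^sub>y + q \<partial>\<^sub>p + f \<partial>\<^sub>q\<close> acts on functions of \<open>(x, y, p, q)\<close>, among them \<open>f\<close>
  and its partial derivatives.  On jets, where these are coordinates, it is therefore given by
  total derivatives; on functions of the independent variables alone the latter are the partial
  derivatives.
\<close>

definition Ddot :: "(jet \<Rightarrow> real) \<Rightarrow> jet \<Rightarrow> real" where
  "Ddot J z = Dtot 1 J z + z (Base 3) * Dtot 2 J z + z (Base 4) * Dtot 3 J z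
     + fd [] z * Dtot 4 J z"


section \<open>Infinitesimal fiber preserving transformations and their prolongations\<close>

text \<open>
  Globally defined \<open>\<xi>\<close> and \<open>\<eta>\<close> suffice: the prolonged generator at a point involves only finitely
  many derivatives of \<open>\<xi>\<close> and \<open>\<eta>\<close> there, and these are attained by polynomials.
\<close>

definition generator :: "(jet \<Rightarrow> real) \<Rightarrow> (jet \<Rightarrow> real) \<Rightarrow> bool" where
  "generator \<xi> \<eta> \<longleftrightarrow> smooth_on UNIV \<xi> \<and> smooth_on UNIV \<eta> \<and>
     (\<exists>g. \<xi> = (\<lambda>z. g (z (Base 1)))) \<and> (\<exists>h. \<eta> = (\<lambda>z. h (z (Base 1)) (z (Base 2))))"

definition zeta1 :: "(jet \<Rightarrow> real) \<Rightarrow> (jet \<Rightarrow> real) \<Rightarrow> jet \<Rightarrow> real" where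
  "zeta1 \<xi> \<eta> z = Ddot \<eta> z - z (Base 3) * pd (Base 1) \<xi> z"

definition zeta2 :: "(jet \<Rightarrow> real) \<Rightarrow> (jet \<Rightarrow> real) \<Rightarrow> jet \<Rightarrow> real" where
  "zeta2 \<xi> \<eta> z = Ddot (zeta1 \<xi> \<eta>) z - z (Base 4) * pd (Base 1) \<xi> z"

definition mu :: "(jet \<Rightarrow> real) \<Rightarrow> (jet \<Rightarrow> real) \<Rightarrow> jet \<Rightarrow> real" where
  "mu \<xi> \<eta> z = Ddot (zeta2 \<xi> \<eta>) z - fd [] z * pd (Base 1) \<xi> z"

definition Ybase :: "(jet \<Rightarrow> real) \<Rightarrow> (jet \<Rightarrow> real) \<Rightarrow> jet \<Rightarrow> real^4" where
  "Ybase \<xi> \<eta> z = vector [\<xi> z, \<eta> z, zeta1 \<xi> \<eta> z, zeta2 \<xi> \<eta> z]"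

text \<open>
  \<open>Yder \<xi> \<eta> ks\<close> is the coefficient of \<open>\<partial>/\<partial>f\<^sub>\<alpha>\<close> in the prolongation, where \<open>\<alpha> = mset ks\<close>, by the
  usual recursion
  \<open>\<mu>\<^sub>\<alpha>\<^sub>k = D\<^sub>k \<mu>\<^sub>\<alpha> - (\<Sum>j. f\<^sub>\<alpha>\<^sub>j D\<^sub>k \<xi>\<^sub>j)\<close>.
  It does not depend on the order of \<open>ks\<close>, because total differentiations commute.
\<close>

fun Yder :: "(jet \<Rightarrow> real) \<Rightarrow> (jet \<Rightarrow> real) \<Rightarrow> 4 list \<Rightarrow> jet \<Rightarrow> real" where
  "Yder \<xi> \<eta> [] = mu \<xi> \<eta>"
| "Yder \<xi> \<eta> (k # ks) = (\<lambda>z. Dtot k (Yder \<xi> \<eta> ks) z -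
     (\<Sum>j\<in>UNIV. fd (j # ks) z * Dtot k (\<lambda>w. Ybase \<xi> \<eta> w $ j) z))"

definition Yprol :: "nat \<Rightarrow> (jet \<Rightarrow> real) \<Rightarrow> (jet \<Rightarrow> real) \<Rightarrow> (jet \<Rightarrow> real) \<Rightarrow> jet \<Rightarrow> real" where
  "Yprol s \<xi> \<eta> J z = (\<Sum>k\<in>UNIV. Ybase \<xi> \<eta> z $ k * pd (Base k) J z) +
     (\<Sum>\<alpha> | size \<alpha> \<le> s. Yder \<xi> \<eta> (sorted_list_of_multiset \<alpha>) z * pd (Der \<alpha>) J z)"


section \<open>Differential invariants, relative invariants, invariant differentiation\<close>

definition differential_invariant :: "nat \<Rightarrow> jet set \<Rightarrow> (jet \<Rightarrow> real) \<Rightarrow> bool" where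
  "differential_invariant s U J \<longleftrightarrow> smooth_on U J \<and> order_le s U J \<and>
     (\<forall>\<xi> \<eta>. generator \<xi> \<eta> \<longrightarrow> (\<forall>z\<in>U. Yprol s \<xi> \<eta> J z = 0))"

definition relative_invariant :: "nat \<Rightarrow> jet set \<Rightarrow> (jet \<Rightarrow> real) \<Rightarrow> bool" where
  "relative_invariant s U J \<longleftrightarrow> smooth_on U J \<and> order_le s U J \<and>
     (\<forall>\<xi> \<eta>. generator \<xi> \<eta> \<longrightarrow>
       (\<exists>m. smooth_on U m \<and> order_le s U m \<and> (\<forall>z\<in>U. Yprol s \<xi> \<eta> J z = m z * J z)))"

definition functionally_independent :: "jet set \<Rightarrow> (jet \<Rightarrow> real) list \<Rightarrow> bool" where
  "functionally_independent U bs \<longleftrightarrow>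
     (\<forall>z\<in>U. \<forall>a :: nat \<Rightarrow> real.
       (\<forall>c. (\<Sum>i<length bs. a i * pd c (bs ! i) z) = 0) \<longrightarrow> (\<forall>i<length bs. a i = 0))"

text \<open>
  The values of a list of functions as a point of \<open>\<real>\<^sup>n\<close>, which is embedded in \<open>nat \<Rightarrow> real\<close> by
  filling up with zeros.
\<close>

definition vals :: "(jet \<Rightarrow> real) list \<Rightarrow> jet \<Rightarrow> nat \<Rightarrow> real" where
  "vals bs z = (\<lambda>i. if i < length bs then (bs ! i) z else 0)"

definition locally_function_of :: "jet set \<Rightarrow> (jet \<Rightarrow> real) list \<Rightarrow> (jet \<Rightarrow> real) \<Rightarrow> bool" where
  "locally_function_of U bs J \<longleftrightarrow>
     (\<forall>z\<in>U. \<exists>W V F. open W \<and> z \<in> W \<and> W \<subseteq> U \<and> smooth_on V F \<and>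
       (\<forall>w\<in>W. vals bs w \<in> V \<and> J w = F (vals bs w)))"

text \<open>A differentiation operator is represented by its coefficients at \<open>D\<^sub>x, D\<^sub>y, D\<^sub>p, D\<^sub>q\<close>.\<close>

definition apply_op :: "(jet \<Rightarrow> real^4) \<Rightarrow> (jet \<Rightarrow> real) \<Rightarrow> jet \<Rightarrow> real" where
  "apply_op K J z = (\<Sum>k\<in>UNIV. K z $ k * Dtot k J z)"

definition invariant_operator :: "nat \<Rightarrow> jet set \<Rightarrow> (jet \<Rightarrow> real^4) \<Rightarrow> bool" where
  "invariant_operator r \<Omega> K \<longleftrightarrow>
     (\<forall>k. smooth_on \<Omega> (\<lambda>z. K z $ k) \<and> order_le r \<Omega> (\<lambda>z. K z $ k)) \<and>
     (\<forall>U s I. U \<subseteq> \<Omega> \<and> differential_invariant s U I \<longrightarrow>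
       (\<exists>t. differential_invariant t U (apply_op K I)))"

definition independent_operators :: "jet set \<Rightarrow> (jet \<Rightarrow> real^4) list \<Rightarrow> bool" where
  "independent_operators U Ks \<longleftrightarrow>
     (\<forall>z\<in>U. \<forall>a :: nat \<Rightarrow> real.
       (\<Sum>i<length Ks. a i *\<^sub>R (Ks ! i) z) = 0 \<longrightarrow> (\<forall>i<length Ks. a i = 0))"


section \<open>The expressions for third-order equations\<close>

definition Omega :: "jet set" where
  "Omega = {z. fd [4,4] z \<noteq> 0 \<and> fd [4,4,4] z \<noteq> 0}"

definition lam4 :: "jet \<Rightarrow> real" where
  "lam4 z = fd [4,4] z"

definition lam5 :: "jet \<Rightarrow> real" where
  "lam5 z = (let f = (\<lambda>ks. fd ks z) in
     (2 * f [3,4] * f [4] - 2 * f [3] * f [4,4] - 6 * f [2,4] + 3 * f [3,3]) / 3)"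

definition lam6 :: "jet \<Rightarrow> real" where
  "lam6 z = fd [4,4,4] z"

definition lam7 :: "jet \<Rightarrow> real" where
  "lam7 z = (let f = (\<lambda>ks. fd ks z) in
     (2 * f [4] * f [4,4,4] + 3 * f [3,4,4]) / 3)"

definition lam8 :: "jet \<Rightarrow> real" where
  "lam8 z = (let f = (\<lambda>ks. fd ks z) in
     (4 * f [4,4,4] * f [4]^2 + 12 * f [4] * f [3,4,4] + 4 * f [4] * f [4,4]^2 + 9 * f [3,3,4]
     + 6 * f [3,4] * f [4,4]) / 9)"

definition lam9 :: "jet \<Rightarrow> real" where
  "lam9 z = (let f = (\<lambda>ks. fd ks z) in
     (2 * f [4,4,4] * f [4]^2 + 2 * f [4] * f [4,4]^2 + 3 * f [4] * f [3,4,4]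
     + 3 * f [4,4,4] * f [3] + 9 * f [2,4,4] + 3 * f [3,4] * f [4,4]) / 9)"

definition lam10 :: "jet \<Rightarrow> real" where
  "lam10 z = (let f = (\<lambda>ks. fd ks z) in
     (-4 * f [4]^2 * f [3,4,4] + 4 * f [4] * f [4,4,4] * f [3] + 12 * f [4] * f [2,4,4]
     - 12 * f [3,3,4] * f [4] - 4 * f [4] * f [3,4] * f [4,4] - 6 * f [3,4]^2 - 9 * f [3,3,3]
     + 4 * f [4,4]^2 * f [3] + 6 * f [3] * f [3,4,4] + 12 * f [2,4] * f [4,4]
     + 18 * f [2,3,4]) / 18)"

definition lam11 :: "jet \<Rightarrow> real" where
  "lam11 z = (let f = (\<lambda>ks. fd ks z) in
     (-4 * f [4] * f [3] * f [4,4]^2 - 6 * f [4,4] * f [3,4] * f [3] - 18 * f [4,4] * f [2,3]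
     - 12 * f [4,4] * f [2,4] * f [4] + 4 * f [4,4] * f [3,4] * f [4]^2
     - 6 * f [4,4,4] * f [3]^2 - 36 * f [3] * f [2,4,4] - 4 * f [3] * f [4,4,4] * f [4]^2
     + 9 * f [3] * f [3,3,4] + 12 * f [3,4]^2 * f [4] + 9 * f [3,4] * f [3,3]
     + 4 * f [4]^3 * f [3,4,4] - 12 * f [4]^2 * f [2,4,4] + 12 * f [3,3,4] * f [4]^2
     + 9 * f [4] * f [3,3,3] - 54 * f [2,2,4] + 27 * f [2,3,3]) / 27)"

definition lam12 :: "jet \<Rightarrow> real" where
  "lam12 z = (let f = (\<lambda>ks. fd ks z); Df = (\<lambda>ks. Ddot (fd ks) z) in
     (- (f [4]^2) - 3 * f [3] + 3 * Df [4]) / 3)"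

definition lam13 :: "jet \<Rightarrow> real" where
  "lam13 z = (let f = (\<lambda>ks. fd ks z); Df = (\<lambda>ks. Ddot (fd ks) z) in
     (-2 * f [4]^3 - 9 * f [4] * f [3] + 6 * f [4] * Df [4] - 27 * f [2] + 9 * Df [3]) / 9)"

definition lam14 :: "jet \<Rightarrow> real" where
  "lam14 z = (let f = (\<lambda>ks. fd ks z); Df = (\<lambda>ks. Ddot (fd ks) z) in
     (3 * Df [4,4] + f [4,4] * f [4]) / 3)"

definition lam15 :: "jet \<Rightarrow> real" where
  "lam15 z = (let f = (\<lambda>ks. fd ks z); Df = (\<lambda>ks. Ddot (fd ks) z) in
     (2 * f [4,4] * f [4]^2 + 3 * f [3] * f [4,4] + 6 * f [4] * Df [4,4] - 9 * f [2,4]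
     + 9 * Df [3,4]) / 9)"

definition lam16 :: "jet \<Rightarrow> real" where
  "lam16 z = (let f = (\<lambda>ks. fd ks z); Df = (\<lambda>ks. Ddot (fd ks) z) in
     (4 * f [4]^2 * Df [4,4] - 2 * f [4]^2 * f [3,4] - 3 * f [4] * f [3,3]
     + 12 * f [4] * Df [3,4] + 4 * f [4] * f [4,4] * Df [4] - 12 * f [2,4] * f [4]
     + 6 * f [3,4] * Df [4] - 18 * f [2,3] + 9 * Df [3,3]) / 9)"

definition lam17 :: "jet \<Rightarrow> real" where
  "lam17 z = (let f = (\<lambda>ks. fd ks z); Df = (\<lambda>ks. Ddot (fd ks) z) in
     (2 * f [4,4] * f [4]^3 - 6 * f [4]^2 * f [3,4] + 6 * f [4]^2 * Df [4,4]
     - 9 * f [4] * f [3,3] + 12 * f [4] * f [3] * f [4,4] + 9 * f [4] * Df [3,4]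
     - 9 * f [2,4] * f [4] + 9 * f [3] * Df [4,4] - 27 * f [2,3] + 27 * f [2] * f [4,4]
     + 27 * Df [2,4]) / 27)"

definition lam18 :: "jet \<Rightarrow> real" where
  "lam18 z = (let f = (\<lambda>ks. fd ks z); Df = (\<lambda>ks. Ddot (fd ks) z) in
     (-9 * f [3]^2 * f [4,4] + 9 * f [3] * Df [3,4] + 6 * f [3] * f [4] * Df [4,4]
     + 6 * f [3] * f [4,4] * Df [4] + 6 * f [3] * f [3,4] * f [4] - 54 * f [3] * f [2,4]
     + 9 * f [3] * f [3,3] + 4 * f [4,4] * f [4]^2 * Df [4] + 6 * f [3,4] * f [4] * Df [4]
     + 18 * f [2,4] * Df [4] + 27 * f [2] * f [3,4] - 2 * f [3,4] * f [4]^3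
     - 30 * f [4]^2 * f [2,4] + 18 * f [4] * f [4,4] * f [2] + 4 * f [4]^3 * Df [4,4]
     + 12 * f [4]^2 * Df [3,4] - 3 * f [4]^2 * f [3,3] + 9 * f [4] * Df [3,3]
     + 18 * f [4] * Df [2,4] - 45 * f [4] * f [2,3] - 81 * f [2,2] + 27 * Df [2,3]) / 27)"

definition lam19 :: "jet \<Rightarrow> real" where
  "lam19 z = (let f = (\<lambda>ks. fd ks z) in
     (-2 * f [4]^3 - 9 * f [4] * f [3] - 27 * f [2] + 9 * Ddot (Ddot (fd [4])) z) / 9)"

definition gam4 :: "jet \<Rightarrow> real" where
  "gam4 z = lam4 z"

definition gam5 :: "jet \<Rightarrow> real" where
  "gam5 z = lam6 z"

definition gam6 :: "jet \<Rightarrow> real" where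
  "gam6 z = (let l4 = lam4 z; l6 = lam6 z; l7 = lam7 z; l8 = lam8 z in
     -(2 * l4^2 * l7 + 3 * l7^2 - 3 * l6 * l8) / (3 * l6))"

definition gam7 :: "jet \<Rightarrow> real" where
  "gam7 z = (let l4 = lam4 z; l5 = lam5 z; l6 = lam6 z; l7 = lam7 z; l9 = lam9 z in
     -(2 * l4^3 * l7 + 3 * l7^2 * l4 - 3 * l6^2 * l5 - 6 * l6 * l4 * l9) / (6 * l6 * l4))"

definition gam8 :: "jet \<Rightarrow> real" where
  "gam8 z = (let l4 = lam4 z; l5 = lam5 z; l6 = lam6 z; l7 = lam7 z; l8 = lam8 z; l9 = lam9 z;
      l10 = lam10 z in
     (2 * l6 * l4 * l5 + 6 * l6 * l10 - 6 * l7 * l9 + 3 * l7 * l8) / (6 * l6))"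

definition gam9 :: "jet \<Rightarrow> real" where
  "gam9 z = (let l4 = lam4 z; l5 = lam5 z; l6 = lam6 z; l7 = lam7 z; l8 = lam8 z; l9 = lam9 z;
      l10 = lam10 z; l11 = lam11 z in
     (4 * l6 * l4^3 * l7 * l5 + 6 * l4^2 * l6^2 * l11 + 12 * l4^2 * l6 * l7 * l10
     - 6 * l4^2 * l7^2 * l9 + 3 * l4^2 * l7^2 * l8 + 3 * l6^2 * l4 * l5 * l8
     - 12 * l6^2 * l4 * l5 * l9 + 3 * l6 * l4 * l5 * l7^2
     - 3 * l6^3 * l5^2) / (6 * l6^2 * l4^2))"

definition gam10 :: "jet \<Rightarrow> real" where
  "gam10 z = (3 * lam5 z + lam4 z * lam12 z) / lam4 z"

definition gam11 :: "jet \<Rightarrow> real" where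
  "gam11 z = lam14 z"

definition gam12 :: "jet \<Rightarrow> real" where
  "gam12 z = (let l5 = lam5 z; l6 = lam6 z; l7 = lam7 z; l14 = lam14 z; l15 = lam15 z in
     -(l14 * l7 + l6 * l5 - l6 * l15) / l6)"

definition gam13 :: "jet \<Rightarrow> real" where
  "gam13 z = (let l4 = lam4 z; l6 = lam6 z; l7 = lam7 z; l12 = lam12 z; l14 = lam14 z; l15 = lam15 z;
      l16 = lam16 z in
     -(-3 * l16 * l6^2 + 6 * l6 * l7 * l15 + 2 * l6 * l7 * l4 * l12
     - 3 * l14 * l7^2) / (3 * l6^2))"

definition gam14 :: "jet \<Rightarrow> real" where
  "gam14 z = (let l4 = lam4 z; l5 = lam5 z; l6 = lam6 z; l7 = lam7 z; l14 = lam14 z; l15 = lam15 z;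
      l17 = lam17 z in
     (2 * l4 * l6^2 * l17 + 2 * l4 * l6 * l7 * l5 - 2 * l4 * l6 * l7 * l15 + l4 * l14 * l7^2
     + l6^2 * l5 * l14) / (2 * l6^2 * l4))"

definition gam15 :: "jet \<Rightarrow> real" where
  "gam15 z = (let l4 = lam4 z; l5 = lam5 z; l6 = lam6 z; l7 = lam7 z; l12 = lam12 z; l14 = lam14 z;
      l15 = lam15 z; l16 = lam16 z; l17 = lam17 z; l18 = lam18 z in
     (2 * l6^3 * l4 * l5 * l12 + 6 * l6^3 * l4 * l18 + 3 * l6^3 * l5^2 + 3 * l6^3 * l5 * l15
     - 6 * l7 * l6^2 * l4 * l17 - 6 * l7 * l6^2 * l4 * l16 - 3 * l7 * l6^2 * l5 * l14
     - 3 * l6 * l4 * l5 * l7^2 + 9 * l7^2 * l4 * l6 * l15 + 2 * l7^2 * l4^2 * l6 * l12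
     - 3 * l14 * l7^3 * l4) / (6 * l4 * l6^3))"

definition gam16 :: "jet \<Rightarrow> real" where
  "gam16 z = -3 * lam13 z + lam19 z"

definition bet1 :: "jet \<Rightarrow> real" where
  "bet1 z = gam6 z * gam5 z / gam4 z^4"

definition bet2 :: "jet \<Rightarrow> real" where
  "bet2 z = gam7 z * gam5 z / gam4 z^4"

definition bet3 :: "jet \<Rightarrow> real" where
  "bet3 z = gam8 z * gam5 z^2 / gam4 z^6"

definition bet4 :: "jet \<Rightarrow> real" where
  "bet4 z = gam9 z * gam5 z^3 / gam4 z^8"

definition bet5 :: "jet \<Rightarrow> real" where
  "bet5 z = gam5 z^2 * gam10 z / gam4 z^4"

definition bet6 :: "jet \<Rightarrow> real" where
  "bet6 z = gam5 z * gam11 z / gam4 z^3"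

definition bet7 :: "jet \<Rightarrow> real" where
  "bet7 z = gam12 z * gam5 z^2 / gam4 z^5"

definition bet8 :: "jet \<Rightarrow> real" where
  "bet8 z = gam13 z * gam5 z^3 / gam4 z^7"

definition bet9 :: "jet \<Rightarrow> real" where
  "bet9 z = gam14 z * gam5 z^3 / gam4 z^7"

definition bet10 :: "jet \<Rightarrow> real" where
  "bet10 z = gam15 z * gam5 z^4 / gam4 z^9"

definition bet11 :: "jet \<Rightarrow> real" where
  "bet11 z = gam16 z * gam5 z^3 / gam4 z^6"

definition gammas :: "(jet \<Rightarrow> real) list" where
  "gammas = [gam4, gam5, gam6, gam7, gam8, gam9, gam10, gam11, gam12, gam13, gam14, gam15, gam16]"

definition betas :: "(jet \<Rightarrow> real) list" where
  "betas = [bet1, bet2, bet3, bet4, bet5, bet6, bet7, bet8, bet9, bet10, bet11]"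

definition op1 :: "jet \<Rightarrow> real^4" where
  "op1 z = (let f = (\<lambda>ks. fd ks z) in (f [4,4] / f [4,4,4]) *\<^sub>R vector [0, 0, 0, 1])"

definition op2 :: "jet \<Rightarrow> real^4" where
  "op2 z = (let f = (\<lambda>ks. fd ks z) in
     (1 / (f [4,4] * f [4,4,4])) *\<^sub>R vector [0, 0, f [4,4,4], - f [3,4,4]])"

definition op3 :: "jet \<Rightarrow> real^4" where
  "op3 z = (let f = (\<lambda>ks. fd ks z) in
     (1 / (f [4,4]^4 * f [4,4,4])) *\<^sub>R vector
       [0,
        6 * f [4,4] * f [4,4,4]^2,
        - (2 * f [4,4] * f [4,4,4] * (f [4] * f [4,4,4] + 3 * f [3,4,4])),
        3 * f [4,4] * f [3,4,4]^2
          + f [4,4,4]^2 * (3 * f [3,3] + 2 * f [3,4] * f [4] - 6 * f [2,4])])"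

definition op4 :: "jet \<Rightarrow> real^4" where
  "op4 z = (let f = (\<lambda>ks. fd ks z) in
     (f [4,4,4] / f [4,4]^2) *\<^sub>R vector [1, z (Base 3), z (Base 4), f []])"

end

theory Submission
  imports Defs
begin

text \<open>
  Write \<open>D\<close> for the total derivative along solutions.  A prolonged generator \<open>Y\<close> satisfies
  \<open>[Y, D] = - \<xi>' D\<close>, and its commutators with \<open>D\<^sub>y, D\<^sub>p, D\<^sub>q\<close> are just as short.  Hence \<open>Y\<close> of any
  \<open>f\<^sub>\<alpha>\<close> is a short expression in the parameters \<open>X i = D\<^sup>i \<xi>\<close> and \<open>E i j = D\<^sup>i \<partial>\<^sub>y\<^sup>j \<eta>\<close>, and \<open>Y \<lambda>\<^sub>i\<close> turns
  out to be affine in the \<open>\<lambda>\<^sub>j\<close> with coefficients among \<open>X 1, \<dots>, X 4, E 0 1\<close>; the invariance of the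
  \<open>\<gamma>\<^sub>i\<close> and \<open>\<beta>\<^sub>i\<close> becomes a rational identity in the \<open>\<lambda>\<^sub>j\<close>.

  For completeness, \<open>\<beta>\<^sub>1, \<dots>, \<beta>\<^sub>1\<^sub>1\<close> are triangular and affine in
  \<open>f\<^sub>3\<^sub>3\<^sub>4, f\<^sub>2\<^sub>4\<^sub>4, f\<^sub>2\<^sub>3\<^sub>4, f\<^sub>2\<^sub>2\<^sub>4, f\<^sub>1\<^sub>4, f\<^sub>1\<^sub>4\<^sub>4, f\<^sub>1\<^sub>3\<^sub>4, f\<^sub>1\<^sub>3\<^sub>3, f\<^sub>1\<^sub>2\<^sub>4, f\<^sub>1\<^sub>2\<^sub>3, f\<^sub>1\<^sub>1\<^sub>4\<close>, which gives independence and an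
  explicit local section.  The remaining \<open>28 = 39 - 11\<close> coordinates of the jet space of order 3 may be
  replaced by 28 functions on which \<open>Y\<close> takes arbitrary values, since \<open>X i\<close> and \<open>E i j\<close> are arbitrary
  at a point; so the generators span the common kernel of the \<open>d\<beta>\<^sub>i\<close>.
\<close>

text \<open>Two choices shape the proof. The total derivative along solutions is used in place of
  \<open>Dtot 1\<close>, because it is the direction whose bracket with a generator is a multiple of
  itself; derivatives of f with an index 1 therefore enter through \<open>Ddot\<close>, and so do
  the parameters. Completeness is obtained without Frobenius' theorem: the triangular form supplies
  a section, but the domain \<open>U\<close> of an invariant is an arbitrary open set which motion
  inside a level set of the betas may leave, so the comparison of two points is confined to a
  neighbourhood where an explicit path stays in \<open>U\<close>. The passage from the lambdas to
  the gammas and betas normalises group parameters. Apart from scaling, \<open>lam7 / lam6\<close>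
  is shifted by - X 2 and \<open>lam5 / lam4\<close> by (2/3) X 3. The gammas are combinations in
  which these shifts and X 4 cancel; the betas are monomials in them of weight zero. The two
  conditions defining \<open>Omega\<close> let X 1, E 0 1, X 2 and X 3 be recovered from the action
  on f_44, f_444, \<open>lam7\<close> and \<open>lam5\<close>.\<close>

section \<open>Partial derivatives and smoothness on spaces of functions\<close>

text \<open>Membership in \<open>U\<close> is included: \<open>U\<close> is a cylinder over
  \<open>C\<close>, so the coordinates outside \<open>C\<close> can be changed without leaving the
  domain.\<close>

definition dep :: "'c set \<Rightarrow> ('c \<Rightarrow> real) set \<Rightarrow> (('c \<Rightarrow> real) \<Rightarrow> real) \<Rightarrow> bool" where
  "dep C U J \<longleftrightarrow> (\<forall>z\<in>U. \<forall>z'. (\<forall>c\<in>C. z' c = z c) \<longrightarrow> z' \<in> U \<and> J z' = J z)"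

text \<open>Total differentiation raises the jet order. Asking only for some finite set of
  coordinates gives a class closed under it.\<close>

definition tame :: "('c \<Rightarrow> real) set \<Rightarrow> (('c \<Rightarrow> real) \<Rightarrow> real) \<Rightarrow> bool" where
  "tame U J \<longleftrightarrow> smooth_on U J \<and> (\<exists>C. finite C \<and> dep C U J)"

definition pdiff :: "'c \<Rightarrow> (('c \<Rightarrow> real) \<Rightarrow> real) \<Rightarrow> ('c \<Rightarrow> real) \<Rightarrow> bool" where
  "pdiff c J z \<longleftrightarrow> (\<lambda>t. J (z(c := t))) differentiable (at (z c))"

lemma pd_eqI: "((\<lambda>t. J (z(c := t))) has_real_derivative d) (at (z c)) \<Longrightarrow> pd c J z = d"
  unfolding pd_def by (rule DERIV_imp_deriv)

lemma pdiff_iff: "pdiff c J z \<longleftrightarrow> ((\<lambda>t. J (z(c := t))) has_real_derivative pd c J z) (at (z c))"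
  unfolding pd_def pdiff_def
  by (simp add: DERIV_deriv_iff_real_differentiable)

lemma pdiffI: "((\<lambda>t. J (z(c := t))) has_real_derivative d) (at (z c)) \<Longrightarrow> pdiff c J z"
  unfolding pdiff_def real_differentiable_def by blast

lemma continuous_on_fun_upd: "continuous_on S (\<lambda>t. z(c := t :: real))"
proof (rule continuous_on_coordinatewise_then_product)
  show "continuous_on S (\<lambda>t. (z(c := t)) d)" for d by (cases "d = c") auto
qed

lemma open_vimage_fun_upd:
  assumes "open U" shows "open {t :: real. z(c := t) \<in> U}"
  using open_vimage[OF assms continuous_on_fun_upd[of UNIV z c]] by (simp add: vimage_def)

lemma eventually_fun_upd:
  assumes "open U" "z \<in> U" shows "\<forall>\<^sub>F t in nhds (z c). z(c := t :: real) \<in> U"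
  using open_vimage_fun_upd[OF assms(1), of z c] assms(2)
  by (auto simp: eventually_nhds intro!: exI[of _ "{t. z(c := t) \<in> U}"])

lemma pd_cong_on:
  assumes "open U" "z \<in> U" "\<And>w. w \<in> U \<Longrightarrow> J w = K w"
  shows "pd c J z = pd c K z" and "pdiff c J z \<longleftrightarrow> pdiff c K z"
proof -
  have ev: "\<forall>\<^sub>F t in nhds (z c). J (z(c := t)) = K (z(c := t))"
    using eventually_fun_upd[OF assms(1,2)] by eventually_elim (use assms(3) in auto)
  show "pd c J z = pd c K z"
    unfolding pd_def by (rule deriv_cong_ev[OF ev refl])
  show "pdiff c J z \<longleftrightarrow> pdiff c K z"
    unfolding pdiff_def real_differentiable_def using DERIV_cong_ev[OF refl ev refl] by blast
qed

lemma smooth_onD: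
  assumes "smooth_on U J"
  shows "open U" "continuous_on U J" "z \<in> U \<Longrightarrow> pdiff c J z" "smooth_on U (pd c J)"
proof -
  show "open U" using assms by (simp add: smooth_on_def)
  show "continuous_on U J" using assms unfolding smooth_on_def by (metis foldr_Nil id_apply)
  show "z \<in> U \<Longrightarrow> pdiff c J z" using assms unfolding smooth_on_def pdiff_def by (metis foldr_Nil id_apply)
  have "foldr pd cs (pd c J) = foldr pd (cs @ [c]) J" for cs by simp
  then show "smooth_on U (pd c J)" using assms unfolding smooth_on_def by metis
qed

text \<open>Every iterated partial derivative agrees on \<open>U\<close> with a member of the class,
  by induction on the number of derivatives, because \<open>pd\<close> at a point of the open set
  \<open>U\<close> sees only values in \<open>U\<close>. Smoothness proofs thus need first
  derivatives only.\<close>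

lemma smooth_on_coinduct:
  assumes "open U" and "P J"
    and step: "\<And>J. P J \<Longrightarrow> continuous_on U J \<and> (\<forall>c. \<forall>z\<in>U. pdiff c J z) \<and>
      (\<forall>c. \<exists>K. P K \<and> (\<forall>z\<in>U. pd c J z = K z))"
  shows "smooth_on U J"
proof -
  have "\<exists>K. P K \<and> (\<forall>z\<in>U. foldr pd cs J z = K z)" for cs
  proof (induction cs)
    case Nil
    then show ?case using assms(2) by auto
  next
    case (Cons c cs)
    then obtain K where K: "P K" "\<forall>z\<in>U. foldr pd cs J z = K z" by blast
    obtain L where L: "P L" "\<forall>z\<in>U. pd c K z = L z" using step[OF K(1)] by blast
    have "pd c (foldr pd cs J) z = L z" if "z \<in> U" for z
      using pd_cong_on(1)[OF assms(1) that, of "foldr pd cs J" K c] K(2) L(2) that by simp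
    with L(1) show ?case by auto
  qed note ex = this
  have "continuous_on U (foldr pd cs J) \<and> (\<forall>c. \<forall>z\<in>U. pdiff c (foldr pd cs J) z)" for cs
  proof -
    obtain K where K: "P K" "\<forall>z\<in>U. foldr pd cs J z = K z" using ex by blast
    have "continuous_on U (foldr pd cs J)"
      using step[OF K(1)] K(2) by (metis continuous_on_cong)
    moreover have "pdiff c (foldr pd cs J) z" if "z \<in> U" for c z
      using pd_cong_on(2)[OF assms(1) that, of "foldr pd cs J" K c] K step[OF K(1)] that by blast
    ultimately show ?thesis by blast
  qed
  with assms(1) show ?thesis unfolding smooth_on_def pdiff_def by blast
qed

lemma smooth_on_cong:
  assumes "smooth_on U K" "\<And>z. z \<in> U \<Longrightarrow> J z = K z" shows "smooth_on U J"
proof (rule smooth_on_coinduct[where P = "\<lambda>J. \<exists>K. smooth_on U K \<and> (\<forall>z\<in>U. J z = K z)"])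
  show "open U" using assms(1) by (rule smooth_onD)
  show "\<exists>K. smooth_on U K \<and> (\<forall>z\<in>U. J z = K z)" using assms by blast
  fix J assume "\<exists>K. smooth_on U K \<and> (\<forall>z\<in>U. J z = K z)"
  then obtain K where K: "smooth_on U K" "\<forall>z\<in>U. J z = K z" by blast
  have "pdiff c J z" "pd c J z = pd c K z" if "z \<in> U" for c z
    using pd_cong_on[OF smooth_onD(1)[OF K(1)] that, of J K c] K smooth_onD(3)[OF K(1) that] by auto
  moreover have "continuous_on U J" using smooth_onD(2)[OF K(1)] K(2) by (metis continuous_on_cong)
  ultimately show "continuous_on U J \<and> (\<forall>c. \<forall>z\<in>U. pdiff c J z) \<and>
      (\<forall>c. \<exists>K. (\<exists>L. smooth_on U L \<and> (\<forall>z\<in>U. K z = L z)) \<and> (\<forall>z\<in>U. pd c J z = K z))"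
    using smooth_onD(4)[OF K(1)] by metis
qed

lemma smooth_on_const: "open U \<Longrightarrow> smooth_on U (\<lambda>z. k)"
proof (rule smooth_on_coinduct[where P = "\<lambda>J. \<exists>k. J = (\<lambda>z. k)"])
  have *: "pd c (\<lambda>z. k) z = 0" "pdiff c (\<lambda>z. k) z" for c and z :: "'a \<Rightarrow> real" and k :: real
    by (rule pd_eqI pdiffI, rule DERIV_const)+
  fix J :: "('a \<Rightarrow> real) \<Rightarrow> real"
  assume "\<exists>k. J = (\<lambda>z. k)"
  then show "continuous_on U J \<and> (\<forall>c. \<forall>z\<in>U. pdiff c J z) \<and>
      (\<forall>c. \<exists>K. (\<exists>k. K = (\<lambda>z. k)) \<and> (\<forall>z\<in>U. pd c J z = K z))"
    using * by (metis continuous_on_const)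
qed auto

lemma pd_coord: "pd c (\<lambda>z. z d) z = (if c = d then 1 else 0)"
  by (rule pd_eqI) auto

lemma pdiff_coord: "pdiff c (\<lambda>z. z d) z"
  unfolding pdiff_def by (cases "c = d") auto

lemma smooth_on_coord:
  assumes "open U" shows "smooth_on U (\<lambda>z. z d)"
proof (rule smooth_on_coinduct[where P = "\<lambda>J. J = (\<lambda>z. z d) \<or> smooth_on U J"])
  fix J assume "J = (\<lambda>z. z d) \<or> smooth_on U J"
  then show "continuous_on U J \<and> (\<forall>c. \<forall>z\<in>U. pdiff c J z) \<and>
      (\<forall>c. \<exists>K. (K = (\<lambda>z. z d) \<or> smooth_on U K) \<and> (\<forall>z\<in>U. pd c J z = K z))"
  proof
    assume J: "J = (\<lambda>z. z d)"
    have "continuous_on U J" unfolding J by (rule continuous_on_subset[OF continuous_on_product_coordinates]) simp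
    moreover have "\<forall>c. \<forall>z\<in>U. pdiff c J z" unfolding J by (simp add: pdiff_coord)
    moreover have "\<forall>c. \<exists>K. (K = (\<lambda>z. z d) \<or> smooth_on U K) \<and> (\<forall>z\<in>U. pd c J z = K z)"
    proof
      fix c
      show "\<exists>K. (K = (\<lambda>z. z d) \<or> smooth_on U K) \<and> (\<forall>z\<in>U. pd c J z = K z)"
        by (rule exI[of _ "\<lambda>z. if c = d then 1 else 0"]) (simp add: J pd_coord smooth_on_const[OF assms])
    qed
    ultimately show ?thesis by (intro conjI)
  next
    assume "smooth_on U J"
    from smooth_onD[OF this] show ?thesis by (intro conjI allI ballI exI[of _ "pd _ J"] disjI2) auto
  qed
qed (use assms in auto)

lemma pd_add:
  assumes "pdiff c J z" "pdiff c K z"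
  shows "pd c (\<lambda>z. J z + K z) z = pd c J z + pd c K z" "pdiff c (\<lambda>z. J z + K z) z"
proof -
  show "pd c (\<lambda>z. J z + K z) z = pd c J z + pd c K z"
    using assms unfolding pdiff_iff by (intro pd_eqI) (rule DERIV_add)
  show "pdiff c (\<lambda>z. J z + K z) z" using assms unfolding pdiff_def by (rule differentiable_add)
qed

lemma pd_mult:
  assumes "pdiff c J z" "pdiff c K z"
  shows "pd c (\<lambda>z. J z * K z) z = pd c J z * K z + J z * pd c K z" "pdiff c (\<lambda>z. J z * K z) z"
proof -
  show "pd c (\<lambda>z. J z * K z) z = pd c J z * K z + J z * pd c K z"
    using assms unfolding pdiff_iff by (intro pd_eqI) (auto intro!: derivative_eq_intros)
  show "pdiff c (\<lambda>z. J z * K z) z" using assms unfolding pdiff_def by (rule differentiable_mult)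
qed

lemma pd_inverse:
  assumes "pdiff c J z" "J z \<noteq> 0"
  shows "pd c (\<lambda>z. inverse (J z)) z = - (inverse (J z) * pd c J z * inverse (J z))"
    "pdiff c (\<lambda>z. inverse (J z)) z"
proof -
  have *: "((\<lambda>t. inverse (J (z(c := t)))) has_real_derivative
      - (inverse (J z) * pd c J z * inverse (J z))) (at (z c))"
    using DERIV_inverse'[OF assms(1)[unfolded pdiff_iff]] assms(2) by simp
  show "pd c (\<lambda>z. inverse (J z)) z = - (inverse (J z) * pd c J z * inverse (J z))"
    using * by (rule pd_eqI)
  show "pdiff c (\<lambda>z. inverse (J z)) z"
    using * by (rule pdiffI)
qed

text \<open>By the Leibniz rule and \<open>pd_inverse\<close> this closure of the smooth functions
  is stable under partial differentiation, so a single use of \<open>smooth_on_coinduct\<close>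
  covers sums, products and inverses without formulas for higher derivatives.\<close>

inductive smooth_alg :: "('c \<Rightarrow> real) set \<Rightarrow> (('c \<Rightarrow> real) \<Rightarrow> real) \<Rightarrow> bool" for U where
  base: "smooth_on U J \<Longrightarrow> smooth_alg U J"
| add: "smooth_alg U J \<Longrightarrow> smooth_alg U K \<Longrightarrow> smooth_alg U (\<lambda>z. J z + K z)"
| mult: "smooth_alg U J \<Longrightarrow> smooth_alg U K \<Longrightarrow> smooth_alg U (\<lambda>z. J z * K z)"
| inverse: "smooth_alg U J \<Longrightarrow> (\<And>z. z \<in> U \<Longrightarrow> J z \<noteq> 0) \<Longrightarrow> smooth_alg U (\<lambda>z. inverse (J z))"

lemma smooth_alg_imp_smooth_on:
  assumes "open U" "smooth_alg U J" shows "smooth_on U J"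
proof (rule smooth_on_coinduct[where P = "smooth_alg U"])
  fix J assume "smooth_alg U J"
  then show "continuous_on U J \<and> (\<forall>c. \<forall>z\<in>U. pdiff c J z) \<and>
      (\<forall>c. \<exists>K. smooth_alg U K \<and> (\<forall>z\<in>U. pd c J z = K z))"
  proof induction
    case (base J)
    from smooth_onD[OF this] show ?case
      by (intro conjI allI ballI exI[of _ "pd _ J"] smooth_alg.base) auto
  next
    case (add J K)
    have "\<exists>L. smooth_alg U L \<and> (\<forall>z\<in>U. pd c (\<lambda>z. J z + K z) z = L z)" for c
    proof -
      obtain J' K' where "smooth_alg U J'" "smooth_alg U K'"
        "\<forall>z\<in>U. pd c J z = J' z" "\<forall>z\<in>U. pd c K z = K' z"
        using add.IH by blast
      then show ?thesis using add
        by (intro exI[of _ "\<lambda>z. J' z + K' z"]) (auto intro: smooth_alg.add simp: pd_add)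
    qed
    then show ?case using add by (auto intro: continuous_intros pd_add)
  next
    case (mult J K)
    have "\<exists>L. smooth_alg U L \<and> (\<forall>z\<in>U. pd c (\<lambda>z. J z * K z) z = L z)" for c
    proof -
      obtain J' K' where "smooth_alg U J'" "smooth_alg U K'"
        "\<forall>z\<in>U. pd c J z = J' z" "\<forall>z\<in>U. pd c K z = K' z"
        using mult.IH by blast
      then show ?thesis using mult
        by (intro exI[of _ "\<lambda>z. J' z * K z + J z * K' z"]) (auto intro!: smooth_alg.add smooth_alg.mult simp: pd_mult)
    qed
    then show ?case using mult by (auto intro: continuous_intros pd_mult)
  next
    case (inverse J)
    have "\<exists>L. smooth_alg U L \<and> (\<forall>z\<in>U. pd c (\<lambda>z. inverse (J z)) z = L z)" for c
    proof -
      obtain J' where "smooth_alg U J'" and J': "\<forall>z\<in>U. pd c J z = J' z"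
        using inverse.IH by blast
      moreover have "smooth_alg U (\<lambda>z. - 1)" using assms(1) by (intro smooth_alg.base smooth_on_const)
      moreover have "smooth_alg U (\<lambda>z. inverse (J z))" using inverse by (intro smooth_alg.inverse) auto
      ultimately have "smooth_alg U (\<lambda>z. - 1 * (inverse (J z) * J' z * inverse (J z)))"
        by (intro smooth_alg.mult)
      moreover have "\<forall>z\<in>U. pd c (\<lambda>z. inverse (J z)) z = - 1 * (inverse (J z) * J' z * inverse (J z))"
        using J' inverse by (simp add: pd_inverse)
      ultimately show ?thesis by blast
    qed
    then show ?case using inverse by (auto intro: continuous_intros pd_inverse)
  qed
qed (use assms in auto)

lemma smooth_on_add: "smooth_on U J \<Longrightarrow> smooth_on U K \<Longrightarrow> smooth_on U (\<lambda>z. J z + K z)"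
  by (rule smooth_alg_imp_smooth_on[OF smooth_onD(1)], assumption, rule smooth_alg.add; rule smooth_alg.base)

lemma smooth_on_mult: "smooth_on U J \<Longrightarrow> smooth_on U K \<Longrightarrow> smooth_on U (\<lambda>z. J z * K z)"
  by (rule smooth_alg_imp_smooth_on[OF smooth_onD(1)], assumption, rule smooth_alg.mult; rule smooth_alg.base)

lemma smooth_on_inverse: "smooth_on U J \<Longrightarrow> (\<And>z. z \<in> U \<Longrightarrow> J z \<noteq> 0) \<Longrightarrow> smooth_on U (\<lambda>z. inverse (J z))"
  by (rule smooth_alg_imp_smooth_on[OF smooth_onD(1)], assumption, rule smooth_alg.inverse, rule smooth_alg.base)

section \<open>Dependence on finitely many coordinates and the chain rule\<close>

lemma depD:
  assumes "dep C U J" "z \<in> U" "\<And>c. c \<in> C \<Longrightarrow> z' c = z c"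
  shows "z' \<in> U" "J z' = J z"
  using assms(1)[unfolded dep_def, rule_format, OF assms(2,3)] by auto

lemma depI:
  assumes "\<And>z z'. z \<in> U \<Longrightarrow> (\<And>c. c \<in> C \<Longrightarrow> z' c = z c) \<Longrightarrow> z' \<in> U \<and> J z' = J z"
  shows "dep C U J"
  unfolding dep_def by (intro ballI allI impI assms) auto

lemma dep_mono:
  assumes "dep C U J" "C \<subseteq> D" shows "dep D U J"
proof (rule depI)
  fix z z' assume "z \<in> U" "\<And>c. c \<in> D \<Longrightarrow> z' c = z c"
  then show "z' \<in> U \<and> J z' = J z" using depD[OF assms(1), of z z'] assms(2) by blast
qed

lemma dep_pd_zero:
  assumes "dep C U J" "z \<in> U" "c \<notin> C" shows "pd c J z = 0"
proof -
  have "J (z(c := t)) = J z" for t using assms(3) by (intro depD[OF assms(1,2)]) auto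
  then show ?thesis by (intro pd_eqI) simp
qed

lemma dep_pd:
  assumes "open U" "dep C U J" shows "dep C U (pd c J)"
proof (rule depI)
  fix z z' assume z: "z \<in> U" "\<And>c. c \<in> C \<Longrightarrow> z' c = z c"
  have z': "z' \<in> U" using depD[OF assms(2) z] by blast
  show "z' \<in> U \<and> pd c J z' = pd c J z"
  proof (cases "c \<in> C")
    case False
    then show ?thesis using dep_pd_zero[OF assms(2) z(1)] dep_pd_zero[OF assms(2) z'] z' by simp
  next
    case True
    have "\<forall>\<^sub>F t in nhds (z c). J (z'(c := t)) = J (z(c := t))"
      using eventually_fun_upd[OF assms(1) z(1), of c]
    proof eventually_elim
      case (elim t)
      show ?case using z(2) by (intro depD[OF assms(2) elim]) simp
    qed
    then show ?thesis using z' z(2) True unfolding pd_def by (auto intro: deriv_cong_ev)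
  qed
qed

lemma tendsto_funI:
  fixes l :: "'c \<Rightarrow> real"
  assumes "\<And>c. ((\<lambda>x. f x c) \<longlongrightarrow> l c) F" shows "(f \<longlongrightarrow> l) F"
  using limitin_componentwise[of "\<lambda>c. euclidean" UNIV f l F] assms
  by (simp add: euclidean_product_topology)

text \<open>The end points may come in either order or coincide, since the increment of a coordinate
  along a path has no fixed sign.\<close>

lemma MVT_segment:
  fixes f :: "real \<Rightarrow> real"
  assumes "\<And>x. x \<in> closed_segment a b \<Longrightarrow> (f has_real_derivative f' x) (at x)"
  shows "\<exists>x\<in>closed_segment a b. f b - f a = (b - a) * f' x"
proof (cases a b rule: linorder_cases)
  case less
  then obtain x where "a < x" "x < b" "f b - f a = (b - a) * f' x"
    using MVT2[of a b f f'] assms by (auto simp: closed_segment_eq_real_ivl)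
  with less show ?thesis by (auto simp: closed_segment_eq_real_ivl)
next
  case greater
  then obtain x where "b < x" "x < a" "f a - f b = (a - b) * f' x"
    using MVT2[of b a f f'] assms by (auto simp: closed_segment_eq_real_ivl)
  with greater show ?thesis
    by (intro bexI[of _ x]) (auto simp: closed_segment_eq_real_ivl algebra_simps)
qed auto

text \<open>The map sending (t, s) to \<open>(\<gamma> t)(c := s)\<close> is continuous at the point
  (t0, \<open>\<gamma> t0 c\<close>). The segment lies in the resulting product neighbourhood
  because none of its points is farther from \<open>\<gamma> t0 c\<close> than
  \<open>\<gamma> t c\<close> is.\<close>

lemma eventually_segment_in_open:
  assumes "open W" "\<gamma> t0 \<in> W" "\<And>d. isCont (\<lambda>t. \<gamma> t d) t0"
  shows "\<forall>\<^sub>F t in nhds t0. \<forall>s\<in>closed_segment (\<gamma> t0 c) (\<gamma> t c). (\<gamma> t)(c := s :: real) \<in> W"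
proof -
  have cont: "((\<lambda>t. \<gamma> t d) \<longlongrightarrow> \<gamma> t0 d) (nhds t0)" for d
    using assms(3)[of d] tendsto_at_iff_tendsto_nhds[of "\<lambda>t. \<gamma> t d" t0] by (simp add: isCont_def)
  have "((\<lambda>p. (\<gamma> (fst p))(c := snd p)) \<longlongrightarrow> \<gamma> t0) (nhds t0 \<times>\<^sub>F nhds (\<gamma> t0 c))"
  proof (rule tendsto_funI)
    fix d
    have f: "((\<lambda>p. \<gamma> (fst p) d) \<longlongrightarrow> \<gamma> t0 d) (nhds t0 \<times>\<^sub>F nhds (\<gamma> t0 c))"
      by (rule filterlim_compose[OF cont[of d] filterlim_fst])
    have s: "(snd \<longlongrightarrow> \<gamma> t0 c) (nhds t0 \<times>\<^sub>F nhds (\<gamma> t0 c))"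
      by (rule filterlim_snd)
    show "((\<lambda>p. ((\<gamma> (fst p))(c := snd p)) d) \<longlongrightarrow> \<gamma> t0 d) (nhds t0 \<times>\<^sub>F nhds (\<gamma> t0 c))"
      using f s by (cases "d = c") auto
  qed
  then have "\<forall>\<^sub>F p in nhds t0 \<times>\<^sub>F nhds (\<gamma> t0 c). (\<gamma> (fst p))(c := snd p) \<in> W"
    using assms(1,2) by (rule topological_tendstoD)
  then obtain P Q where P: "eventually P (nhds t0)" and Q: "eventually Q (nhds (\<gamma> t0 c))"
    and PQ: "\<And>t s. P t \<Longrightarrow> Q s \<Longrightarrow> (\<gamma> t)(c := s) \<in> W"
    unfolding eventually_prod_filter by auto
  obtain e where e: "e > 0" "\<And>s. dist s (\<gamma> t0 c) < e \<Longrightarrow> Q s"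
    using Q unfolding eventually_nhds_metric by blast
  have "\<forall>\<^sub>F t in nhds t0. dist (\<gamma> t c) (\<gamma> t0 c) < e"
    using tendstoD[OF cont e(1)] .
  with P show ?thesis
  proof eventually_elim
    case (elim t)
    show ?case
    proof
      fix s assume "s \<in> closed_segment (\<gamma> t0 c) (\<gamma> t c)"
      then have "dist s (\<gamma> t0 c) \<le> dist (\<gamma> t c) (\<gamma> t0 c)"
        by (auto simp: closed_segment_eq_real_ivl dist_real_def split: if_splits)
      then show "(\<gamma> t)(c := s) \<in> W" using PQ elim e(2)[of s] by auto
    qed
  qed
qed

text \<open>Induction on the set of moving coordinates. Freezing the coordinate \<open>c\<close>
  gives the path \<open>\<delta>\<close> of the induction hypothesis; the mean value theorem in
  direction \<open>c\<close> expresses the difference by \<open>pd c J\<close> at an intermediate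
  point, and continuity of \<open>pd c J\<close> gives the limit.\<close>

lemma chain_rule_aux:
  assumes U: "smooth_on U J" and "finite C" "\<gamma> t0 \<in> U"
    and "\<And>c. c \<in> C \<Longrightarrow> ((\<lambda>t. \<gamma> t c) has_real_derivative v c) (at t0)"
    and "\<And>c t. c \<notin> C \<Longrightarrow> \<gamma> t c = \<gamma> t0 c"
  shows "((\<lambda>t. J (\<gamma> t)) has_real_derivative (\<Sum>c\<in>C. v c * pd c J (\<gamma> t0))) (at t0)"
  using assms(2-)
proof (induction C arbitrary: \<gamma> rule: finite_induct)
  case empty
  have "(\<lambda>t. J (\<gamma> t)) = (\<lambda>t. J (\<gamma> t0))"
    by (intro ext arg_cong[where f = J] empty.prems(3)) simp
  then show ?case by (simp only: sum.empty DERIV_const)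
next
  case (insert c C)
  define s0 where "s0 = \<gamma> t0 c"
  define \<delta> where "\<delta> t = (\<gamma> t)(c := s0)" for t
  define L where "L = pd c J (\<gamma> t0)"
  have \<delta>0: "\<delta> t0 = \<gamma> t0" by (simp add: \<delta>_def s0_def)
  have IH: "((\<lambda>t. J (\<delta> t)) has_real_derivative (\<Sum>c\<in>C. v c * pd c J (\<gamma> t0))) (at t0)"
    unfolding \<delta>0[symmetric]
  proof (rule insert.IH)
    show "\<delta> t0 \<in> U" using insert.prems(1) \<delta>0 by simp
    fix d
    { assume "d \<in> C"
      then have "(\<lambda>t. \<delta> t d) = (\<lambda>t. \<gamma> t d)" using insert.hyps(2) by (auto simp: \<delta>_def)
      then show "((\<lambda>t. \<delta> t d) has_real_derivative v d) (at t0)"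
        using insert.prems(2)[of d] \<open>d \<in> C\<close> by simp }
    { fix t assume "d \<notin> C"
      then show "\<delta> t d = \<delta> t0 d" using insert.prems(3)[of d t] by (auto simp: \<delta>_def) }
  qed
  have cont: "isCont (\<lambda>t. \<gamma> t d) t0" for d
  proof (cases "d \<in> insert c C")
    case True then show ?thesis using insert.prems(2) DERIV_isCont by blast
  next
    case False
    have "(\<lambda>t. \<gamma> t d) = (\<lambda>t. \<gamma> t0 d)" by (intro ext insert.prems(3)[OF False])
    then show ?thesis by (simp only: continuous_const)
  qed
  define good where "good t s \<longleftrightarrow> s \<in> closed_segment s0 (\<gamma> t c) \<and>
      J (\<gamma> t) - J (\<delta> t) = (\<gamma> t c - s0) * pd c J ((\<gamma> t)(c := s))" for t s
  have U': "open U" "continuous_on U (pd c J)" using smooth_onD[OF U] smooth_onD(2)[OF smooth_onD(4)[OF U]] by auto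
  have good: "\<forall>\<^sub>F t in nhds t0. \<exists>s. good t s"
    using eventually_segment_in_open[where \<gamma> = \<gamma> and c = c, OF U'(1) insert.prems(1) cont]
  proof eventually_elim
    case (elim t)
    have "\<exists>s\<in>closed_segment s0 (\<gamma> t c). J ((\<gamma> t)(c := \<gamma> t c)) - J ((\<gamma> t)(c := s0)) =
        (\<gamma> t c - s0) * pd c J ((\<gamma> t)(c := s))"
    proof (rule MVT_segment)
      fix s assume "s \<in> closed_segment s0 (\<gamma> t c)"
      then have "(\<gamma> t)(c := s) \<in> U" using elim by (simp add: s0_def)
      from smooth_onD(3)[OF U this, of c]
      show "((\<lambda>x. J ((\<gamma> t)(c := x))) has_real_derivative pd c J ((\<gamma> t)(c := s))) (at s)"
        unfolding pdiff_iff by simp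
    qed
    then show ?case unfolding good_def \<delta>_def by auto
  qed
  \<comment> \<open>The intermediate point is an arbitrary choice. Only its position on a segment
    that shrinks to \<open>\<gamma> t0\<close> enters the limit.\<close>
  define m where "m t = pd c J ((\<gamma> t)(c := (SOME s. good t s)))" for t
  have "(m \<longlongrightarrow> L) (at t0)"
  proof (rule tendstoI)
    fix e :: real assume "e > 0"
    define W where "W = U \<inter> pd c J -` ball L e"
    have "open W" unfolding W_def by (rule continuous_open_preimage[OF U'(2,1)]) simp
    have "\<gamma> t0 \<in> W" using insert.prems(1) \<open>e > 0\<close> by (simp add: W_def L_def)
    have "\<forall>\<^sub>F t in nhds t0. dist (m t) L < e"
      using eventually_segment_in_open[where \<gamma> = \<gamma> and c = c, OF \<open>open W\<close> \<open>\<gamma> t0 \<in> W\<close> cont] good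
    proof eventually_elim
      case (elim t)
      from elim(2) have "good t (SOME s. good t s)" by (rule someI_ex)
      then have "(\<gamma> t)(c := (SOME s. good t s)) \<in> W" using elim(1) by (auto simp: good_def s0_def)
      then show ?case by (simp add: m_def W_def dist_commute)
    qed
    then show "\<forall>\<^sub>F t in at t0. dist (m t) L < e"
      by (simp add: eventually_at_filter eventually_mono)
  qed
  moreover have "((\<lambda>t. (\<gamma> t c - s0) / (t - t0)) \<longlongrightarrow> v c) (at t0)"
    using insert.prems(2)[of c] by (simp add: has_field_derivative_iff s0_def)
  ultimately have "((\<lambda>t. (\<gamma> t c - s0) / (t - t0) * m t) \<longlongrightarrow> v c * L) (at t0)"
    by (intro tendsto_mult)
  moreover have "\<forall>\<^sub>F t in at t0. (\<gamma> t c - s0) / (t - t0) * m t =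
      ((J (\<gamma> t) - J (\<delta> t)) - (J (\<gamma> t0) - J (\<delta> t0))) / (t - t0)"
  proof -
    have "\<forall>\<^sub>F t in at t0. \<exists>s. good t s" using good by (simp add: eventually_at_filter eventually_mono)
    then show ?thesis
    proof eventually_elim
      case (elim t)
      then have "good t (SOME s. good t s)" by (rule someI_ex)
      then have "J (\<gamma> t) - J (\<delta> t) = (\<gamma> t c - s0) * m t" by (simp add: good_def m_def)
      then show ?case by (simp add: \<delta>0)
    qed
  qed
  ultimately have "((\<lambda>t. ((J (\<gamma> t) - J (\<delta> t)) - (J (\<gamma> t0) - J (\<delta> t0))) / (t - t0)) \<longlongrightarrow> v c * L) (at t0)"
    by (rule Lim_transform_eventually)
  then have "((\<lambda>t. J (\<gamma> t) - J (\<delta> t)) has_real_derivative v c * L) (at t0)"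
    by (simp add: has_field_derivative_iff)
  from DERIV_add[OF this IH] show ?case
    using insert.hyps by (simp add: L_def)
qed

lemma chain_rule:
  assumes U: "smooth_on U J" and C: "finite C" "dep C U J" and "\<gamma> t0 \<in> U"
    and v: "\<And>c. c \<in> C \<Longrightarrow> ((\<lambda>t. \<gamma> t c) has_real_derivative v c) (at t0)"
  shows "((\<lambda>t. J (\<gamma> t)) has_real_derivative (\<Sum>c\<in>C. v c * pd c J (\<gamma> t0))) (at t0)"
proof -
  define \<delta> where "\<delta> t c = (if c \<in> C then \<gamma> t c else \<gamma> t0 c)" for t c
  have \<delta>0: "\<delta> t0 = \<gamma> t0" by (auto simp: \<delta>_def)
  have cont: "isCont (\<lambda>t. \<delta> t c) t0" for c
    using DERIV_isCont[OF v] by (cases "c \<in> C") (auto simp: \<delta>_def)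
  have "((\<lambda>t. J (\<delta> t)) has_real_derivative (\<Sum>c\<in>C. v c * pd c J (\<delta> t0))) (at t0)"
    using v \<open>\<gamma> t0 \<in> U\<close> \<delta>0 by (intro chain_rule_aux[OF U C(1)]) (auto simp: \<delta>_def)
  moreover have "(\<delta> \<longlongrightarrow> \<gamma> t0) (nhds t0)"
    using cont \<delta>0 tendsto_at_iff_tendsto_nhds[of "\<lambda>t. \<delta> t _" t0]
    by (intro tendsto_funI) (simp add: isCont_def)
  then have "\<forall>\<^sub>F t in nhds t0. \<delta> t \<in> U"
    using smooth_onD(1)[OF U] \<open>\<gamma> t0 \<in> U\<close> by (rule topological_tendstoD)
  then have ev: "\<forall>\<^sub>F t in nhds t0. J (\<delta> t) = J (\<gamma> t)"
  proof eventually_elim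
    case (elim t)
    show ?case using depD(2)[OF C(2) elim, of "\<gamma> t"] by (auto simp: \<delta>_def)
  qed
  ultimately show ?thesis
    using DERIV_cong_ev[OF refl ev refl] \<delta>0 by simp
qed

section \<open>Symmetry of mixed partial derivatives\<close>

lemma eventually_square_in_open:
  assumes "open W" "z \<in> W"
  shows "\<exists>e>0. \<forall>s t. \<bar>s - z c\<bar> \<le> e \<longrightarrow> \<bar>t - z d\<bar> \<le> e \<longrightarrow> z(c := s, d := t :: real) \<in> W"
proof -
  define S where "S = {p. z(c := fst p, d := snd p) \<in> W}"
  have "continuous_on UNIV (\<lambda>p. z(c := fst p, d := snd p))"
  proof (rule continuous_on_coordinatewise_then_product)
    show "continuous_on UNIV (\<lambda>p. (z(c := fst p, d := snd p)) i)" for i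
      by (cases "i = d"; cases "i = c") (auto intro!: continuous_intros)
  qed
  from open_vimage[OF assms(1) this] have "open S" by (simp add: S_def vimage_def)
  moreover have "(z c, z d) \<in> S" using assms(2) by (simp add: S_def)
  ultimately obtain A B where AB: "open A" "open B" "z c \<in> A" "z d \<in> B" "A \<times> B \<subseteq> S"
    by (auto elim!: open_prod_elim)
  obtain e1 where e1: "e1 > 0" "cball (z c) e1 \<subseteq> A" using AB open_contains_cball by blast
  obtain e2 where e2: "e2 > 0" "cball (z d) e2 \<subseteq> B" using AB open_contains_cball by blast
  show ?thesis
  proof (intro exI[of _ "min e1 e2"] conjI allI impI)
    show "min e1 e2 > 0" using e1 e2 by simp
    fix s t assume "\<bar>s - z c\<bar> \<le> min e1 e2" "\<bar>t - z d\<bar> \<le> min e1 e2"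
    then have "s \<in> A" "t \<in> B" using e1 e2 by (auto simp: dist_real_def subset_iff)
    then show "z(c := s, d := t) \<in> W" using AB(5) by (auto simp: S_def)
  qed
qed

text \<open>Both mixed partial derivatives occur as values of the same second difference quotient.\<close>

lemma second_difference:
  assumes U: "smooth_on U J" and cd: "c \<noteq> d" and h: "h > 0"
    and sq: "\<And>s t. \<bar>s - z c\<bar> \<le> h \<Longrightarrow> \<bar>t - z d\<bar> \<le> h \<Longrightarrow> z(c := s, d := t) \<in> U"
  shows "\<exists>s t. \<bar>s - z c\<bar> \<le> h \<and> \<bar>t - z d\<bar> \<le> h \<and>
    J (z(c := z c + h, d := z d + h)) - J (z(c := z c + h, d := z d))
      - J (z(c := z c, d := z d + h)) + J (z(c := z c, d := z d))
    = h * h * pd d (pd c J) (z(c := s, d := t))"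
proof -
  define g where "g s t = J (z(c := s, d := t))" for s t
  define g1 where "g1 s t = pd c J (z(c := s, d := t))" for s t
  define g2 where "g2 s t = pd d (pd c J) (z(c := s, d := t))" for s t
  have g1: "((\<lambda>s. g s t) has_real_derivative g1 s t) (at s)"
    if "\<bar>s - z c\<bar> \<le> h" "\<bar>t - z d\<bar> \<le> h" for s t
    using smooth_onD(3)[OF U sq[OF that], of c] cd unfolding pdiff_iff g_def g1_def
    by (simp add: fun_upd_twist)
  have g2: "(g1 s has_real_derivative g2 s t) (at t)"
    if "\<bar>s - z c\<bar> \<le> h" "\<bar>t - z d\<bar> \<le> h" for s t
    using smooth_onD(3)[OF smooth_onD(4)[OF U] sq[OF that], of d c] unfolding pdiff_iff g1_def g2_def
    by simp
  obtain s where s: "z c < s" "s < z c + h" and es: "(g (z c + h) (z d + h) - g (z c + h) (z d)) -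
      (g (z c) (z d + h) - g (z c) (z d)) = (z c + h - z c) * (g1 s (z d + h) - g1 s (z d))"
    using MVT2[of "z c" "z c + h" "\<lambda>s. g s (z d + h) - g s (z d)" "\<lambda>s. g1 s (z d + h) - g1 s (z d)"]
      h g1 by (force intro: DERIV_diff)
  obtain t where t: "z d < t" "t < z d + h" and et: "g1 s (z d + h) - g1 s (z d) = (z d + h - z d) * g2 s t"
    using MVT2[of "z d" "z d + h" "g1 s" "g2 s"] h g2[of s] s by force
  show ?thesis
    using s t es et by (intro exI[of _ s] exI[of _ t]) (auto simp: g_def g2_def)
qed

text \<open>On a small square both mixed derivatives stay within \<open>e/2\<close> of their values
  at \<open>z\<close>, and the common difference quotient makes their values at two points of the
  square equal.\<close>

lemma pd_commute:
  assumes U: "smooth_on U J" and z: "z \<in> U"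
  shows "pd c (pd d J) z = pd d (pd c J) z"
proof (cases "c = d")
  case False
  have "\<bar>pd c (pd d J) z - pd d (pd c J) z\<bar> \<le> e" if "e > 0" for e
  proof -
    define A where "A = pd c (pd d J)"
    define B where "B = pd d (pd c J)"
    define W where "W = (U \<inter> A -` ball (A z) (e/2)) \<inter> (U \<inter> B -` ball (B z) (e/2))"
    have sm: "smooth_on U A" "smooth_on U B" unfolding A_def B_def using U by (simp_all add: smooth_onD)
    have "open W" unfolding W_def
      by (intro open_Int continuous_open_preimage smooth_onD(1,2)[OF sm(1)] smooth_onD(2)[OF sm(2)]) auto
    moreover have "z \<in> W" using z that by (simp add: W_def)
    ultimately obtain h where h: "h > 0"
      "\<And>s t. \<bar>s - z c\<bar> \<le> h \<Longrightarrow> \<bar>t - z d\<bar> \<le> h \<Longrightarrow> z(c := s, d := t) \<in> W"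
      using eventually_square_in_open[of W z c d] by blast
    have h': "z(c := s, d := t) \<in> U" if "\<bar>s - z c\<bar> \<le> h" "\<bar>t - z d\<bar> \<le> h" for s t
      using h(2)[OF that] by (simp add: W_def)
    define \<Delta> where "\<Delta> = J (z(c := z c + h, d := z d + h)) - J (z(c := z c + h, d := z d))
      - J (z(c := z c, d := z d + h)) + J (z(c := z c, d := z d))"
    obtain s t where st: "\<bar>s - z c\<bar> \<le> h" "\<bar>t - z d\<bar> \<le> h" "\<Delta> = h * h * B (z(c := s, d := t))"
      using second_difference[OF U False h(1) h'] unfolding \<Delta>_def B_def by blast
    have "\<exists>t s. \<bar>t - z d\<bar> \<le> h \<and> \<bar>s - z c\<bar> \<le> h \<and>
    J (z(d := z d + h, c := z c + h)) - J (z(d := z d + h, c := z c))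
      - J (z(d := z d, c := z c + h)) + J (z(d := z d, c := z c))
    = h * h * A (z(d := t, c := s))"
      unfolding A_def
      by (rule second_difference[OF U False[symmetric] h(1)]) (use h' False in \<open>simp add: fun_upd_twist\<close>)
    then obtain t' s' where st': "\<bar>t' - z d\<bar> \<le> h" "\<bar>s' - z c\<bar> \<le> h"
      "J (z(d := z d + h, c := z c + h)) - J (z(d := z d + h, c := z c))
        - J (z(d := z d, c := z c + h)) + J (z(d := z d, c := z c)) = h * h * A (z(d := t', c := s'))"
      by blast
    have twist: "z(d := t, c := s) = z(c := s, d := t)" for s t
      using False by (simp add: fun_upd_twist)
    have "\<Delta> = h * h * A (z(c := s', d := t'))"
      using st'(3) unfolding \<Delta>_def twist by linarith
    have "A (z(c := s', d := t')) = B (z(c := s, d := t))" using st(3) \<open>\<Delta> = h * h * A _\<close> h(1) by simp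
    moreover have "\<bar>A (z(c := s', d := t')) - A z\<bar> < e/2" "\<bar>B (z(c := s, d := t)) - B z\<bar> < e/2"
      using h(2)[OF st(1,2)] h(2)[OF st'(2,1)] by (simp_all add: W_def dist_real_def abs_minus_commute)
    ultimately show ?thesis unfolding A_def B_def by linarith
  qed
  then have "\<bar>pd c (pd d J) z - pd d (pd c J) z\<bar> \<le> 0" by (rule field_le_epsilon[where y = 0, simplified])
  then show ?thesis by simp
qed simp

section \<open>Derivations along tangent vectors\<close>

definition diffat :: "(('c \<Rightarrow> real) \<Rightarrow> real) \<Rightarrow> ('c \<Rightarrow> real) \<Rightarrow> bool" where
  "diffat J z \<longleftrightarrow> (\<forall>c. pdiff c J z) \<and> finite {c. pd c J z \<noteq> 0}"

text \<open>The derivative of \<open>J\<close> along a tangent vector with possibly infinitely many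
  nonzero components; \<open>diffat\<close> ensures that only finitely many of them
  contribute.\<close>

definition lie :: "('c \<Rightarrow> real) \<Rightarrow> (('c \<Rightarrow> real) \<Rightarrow> real) \<Rightarrow> ('c \<Rightarrow> real) \<Rightarrow> real" where
  "lie v J z = (\<Sum>c | pd c J z \<noteq> 0. v c * pd c J z)"

text \<open>With differentiability built in, the rules for sums, products and quotients chain by
  resolution and compute the derivative of a whole expression.\<close>

definition has_lie :: "('c \<Rightarrow> real) \<Rightarrow> (('c \<Rightarrow> real) \<Rightarrow> real) \<Rightarrow> real \<Rightarrow> ('c \<Rightarrow> real) \<Rightarrow> bool" where
  "has_lie v J d z \<longleftrightarrow> diffat J z \<and> lie v J z = d"

lemma lie_eq_sum:
  assumes "finite C" "\<And>c. c \<notin> C \<Longrightarrow> pd c J z = 0"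
  shows "lie v J z = (\<Sum>c\<in>C. v c * pd c J z)"
  unfolding lie_def by (rule sum.mono_neutral_left) (use assms in auto)

lemma has_lieD: "has_lie v J d z \<Longrightarrow> lie v J z = d"
  by (simp add: has_lie_def)

lemma has_lieI: "diffat J z \<Longrightarrow> lie v J z = d \<Longrightarrow> has_lie v J d z"
  by (simp add: has_lie_def)

lemma diffat_pdiff: "diffat J z \<Longrightarrow> pdiff c J z"
  by (simp add: diffat_def)

lemma has_lie_const: "0 = d \<Longrightarrow> has_lie v (\<lambda>z. k) d z"
proof -
  have "pd c (\<lambda>z. k) z = 0" "pdiff c (\<lambda>z. k) z" for c
    by (rule pd_eqI pdiffI, rule DERIV_const)+
  then show "0 = d \<Longrightarrow> has_lie v (\<lambda>z. k) d z" by (simp add: has_lie_def diffat_def lie_def)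
qed

lemma has_lie_coord: "v c = d \<Longrightarrow> has_lie v (\<lambda>z. z c) d z"
proof -
  have "{a. pd a (\<lambda>z. z c) z \<noteq> 0} = {c}" by (auto simp: pd_coord)
  then show "v c = d \<Longrightarrow> has_lie v (\<lambda>z. z c) d z"
    by (simp add: has_lie_def diffat_def lie_def pdiff_coord pd_coord)
qed

lemma has_lie_add:
  assumes "has_lie v J d1 z" "has_lie v K d2 z" "d1 + d2 = d"
  shows "has_lie v (\<lambda>z. J z + K z) d z"
proof -
  let ?C = "{c. pd c J z \<noteq> 0} \<union> {c. pd c K z \<noteq> 0}"
  have d: "diffat J z" "diffat K z" using assms by (simp_all add: has_lie_def)
  note pd = pd_add[OF diffat_pdiff[OF d(1)] diffat_pdiff[OF d(2)]]
  have fin: "finite ?C" using d by (simp add: diffat_def)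
  then have "finite {c. pd c (\<lambda>z. J z + K z) z \<noteq> 0}"
    by (rule rev_finite_subset) (auto simp: pd)
  moreover have "lie v (\<lambda>z. J z + K z) z = lie v J z + lie v K z"
    by (subst (1 2 3) lie_eq_sum[OF fin]) (auto simp: pd sum.distrib algebra_simps)
  ultimately show ?thesis using assms pd by (simp add: has_lie_def diffat_def)
qed

lemma has_lie_mult:
  assumes "has_lie v J d1 z" "has_lie v K d2 z" "d1 * K z + J z * d2 = d"
  shows "has_lie v (\<lambda>z. J z * K z) d z"
proof -
  let ?C = "{c. pd c J z \<noteq> 0} \<union> {c. pd c K z \<noteq> 0}"
  have d: "diffat J z" "diffat K z" using assms by (simp_all add: has_lie_def)
  note pd = pd_mult[OF diffat_pdiff[OF d(1)] diffat_pdiff[OF d(2)]]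
  have fin: "finite ?C" using d by (simp add: diffat_def)
  then have "finite {c. pd c (\<lambda>z. J z * K z) z \<noteq> 0}"
    by (rule rev_finite_subset) (auto simp: pd)
  moreover have "lie v (\<lambda>z. J z * K z) z = lie v J z * K z + J z * lie v K z"
    by (subst (1 2 3) lie_eq_sum[OF fin])
      (auto simp: pd sum.distrib sum_distrib_left sum_distrib_right algebra_simps)
  ultimately show ?thesis using assms pd by (simp add: has_lie_def diffat_def)
qed

lemma has_lie_inverse:
  assumes "has_lie v J d1 z" "J z \<noteq> 0"
  shows "has_lie v (\<lambda>z. inverse (J z)) (- (d1 / (J z)^2)) z"
proof -
  let ?C = "{c. pd c J z \<noteq> 0}"
  have d: "diffat J z" using assms by (simp_all add: has_lie_def)
  note pd = pd_inverse[OF diffat_pdiff[OF d] assms(2)]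
  have fin: "finite ?C" using d by (simp add: diffat_def)
  then have "finite {c. pd c (\<lambda>z. inverse (J z)) z \<noteq> 0}"
    by (rule rev_finite_subset) (auto simp: pd)
  moreover have "lie v (\<lambda>z. inverse (J z)) z = - (lie v J z / (J z)^2)"
    by (subst (1 2) lie_eq_sum[OF fin])
      (auto simp: pd sum_negf sum_distrib_left divide_inverse power2_eq_square algebra_simps)
  ultimately show ?thesis using assms pd by (simp add: has_lie_def diffat_def)
qed

lemma has_lie_minus:
  assumes "has_lie v J d1 z" "- d1 = d" shows "has_lie v (\<lambda>z. - J z) d z"
  using has_lie_mult[OF has_lie_const[of 0 v "- 1" z] assms(1)] assms(2) by simp

lemma has_lie_diff:
  assumes "has_lie v J d1 z" "has_lie v K d2 z" "d1 - d2 = d"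
  shows "has_lie v (\<lambda>z. J z - K z) d z"
  using has_lie_add[OF assms(1) has_lie_minus[OF assms(2) refl]] assms(3) by simp

lemma has_lie_divide:
  assumes "has_lie v J d1 z" "has_lie v K d2 z" "K z \<noteq> 0" "(d1 * K z - J z * d2) / (K z * K z) = d"
  shows "has_lie v (\<lambda>z. J z / K z) d z"
  using has_lie_mult[OF assms(1) has_lie_inverse[OF assms(2,3)]] assms(3,4)
  by (simp add: divide_simps power2_eq_square)

lemma has_lie_power:
  assumes "has_lie v J d1 z" "of_nat n * J z ^ (n - 1) * d1 = d"
  shows "has_lie v (\<lambda>z. J z ^ n) d z"
  unfolding assms(2)[symmetric]
proof (induction n)
  case (Suc n)
  show ?case
    using has_lie_mult[OF assms(1) Suc refl] by (cases n) (simp_all add: algebra_simps)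
qed (simp add: has_lie_const)

lemma has_lie_cong_on:
  assumes "open U" "z \<in> U" "\<And>w. w \<in> U \<Longrightarrow> J w = K w"
  shows "lie v J z = lie v K z" "diffat J z \<longleftrightarrow> diffat K z"
  unfolding lie_def diffat_def using pd_cong_on[OF assms] by simp_all

lemma lie_linear:
  "lie (\<lambda>c. a * v c + b * w c) J z = a * lie v J z + b * lie w J z"
  unfolding lie_def by (simp add: sum_distrib_left sum.distrib algebra_simps)

lemma lie_sum: "lie (\<lambda>c. \<Sum>i\<in>I. a i * v i c) J z = (\<Sum>i\<in>I. a i * lie (v i) J z)"
  unfolding lie_def sum_distrib_left sum_distrib_right
  by (subst sum.swap) (simp add: algebra_simps)

lemma lie_minus: "lie (\<lambda>c. - v c) J z = - lie v J z"
  unfolding lie_def by (simp add: sum_negf)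

subsection \<open>Smooth functions of finitely many coordinates\<close>

text \<open>For a constant function, \<open>smooth_on\<close> and \<open>dep\<close> constrain only
  the domain: it is open and a cylinder over finitely many coordinates.\<close>

definition tame_set :: "('c \<Rightarrow> real) set \<Rightarrow> bool" where
  "tame_set U \<longleftrightarrow> tame U (\<lambda>z. 0)"

lemma tameE:
  assumes "tame U J" obtains C where "finite C" "dep C U J" "smooth_on U J"
  using assms unfolding tame_def by blast

lemma tame_smooth: "tame U J \<Longrightarrow> smooth_on U J"
  by (simp add: tame_def)

lemma tame_open: "tame U J \<Longrightarrow> open U"
  using smooth_onD(1) tame_smooth by blast

lemma tame_diffat: "tame U J \<Longrightarrow> z \<in> U \<Longrightarrow> diffat J z"
proof (erule tameE)
  fix C assume C: "finite C" "dep C U J" "smooth_on U J" and z: "z \<in> U"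
  have "{c. pd c J z \<noteq> 0} \<subseteq> C" using dep_pd_zero[OF C(2) z] by auto
  then show "diffat J z" using C(1) smooth_onD(3)[OF C(3) z] finite_subset
    unfolding diffat_def by blast
qed

lemma tame_imp_tame_set: "tame U J \<Longrightarrow> tame_set U"
  unfolding tame_set_def
proof (erule tameE)
  fix C assume C: "finite C" "dep C U J" "smooth_on U J"
  have "dep C U (\<lambda>z. 0)" by (rule depI) (use depD(1)[OF C(2)] in blast)
  then show "tame U (\<lambda>z. 0)"
    unfolding tame_def using C(1) smooth_on_const[OF smooth_onD(1)[OF C(3)]] by blast
qed

lemma tame_set_UNIV [simp]: "tame_set UNIV"
  unfolding tame_set_def tame_def by (auto intro!: smooth_on_const exI[of _ "{}"] depI)

text \<open>Separates the two halves of \<open>dep\<close>: once the domain is a cylinder, values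
  have to be compared only between points of \<open>U\<close>.\<close>

lemma tame_dep_cong:
  assumes "tame_set U" "smooth_on U J" "finite C"
    "\<And>z z'. z \<in> U \<Longrightarrow> z' \<in> U \<Longrightarrow> (\<And>c. c \<in> C \<Longrightarrow> z' c = z c) \<Longrightarrow> J z' = J z"
  shows "tame U J"
proof -
  obtain D where D: "finite D" "dep D U (\<lambda>z. 0)" using assms(1) unfolding tame_set_def by (elim tameE)
  have "dep (C \<union> D) U J"
  proof (rule depI)
    fix z z' assume z: "z \<in> U" "\<And>c. c \<in> C \<union> D \<Longrightarrow> z' c = z c"
    have z': "z' \<in> U" by (rule depD(1)[OF D(2) z(1)]) (rule z(2), simp)
    have "J z' = J z" by (rule assms(4)[OF z(1) z']) (rule z(2), simp)
    with z' show "z' \<in> U \<and> J z' = J z" by simp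
  qed
  then show ?thesis using assms(2,3) D(1) unfolding tame_def by blast
qed

named_theorems tame_intros

lemma tame_const [tame_intros]: "tame_set U \<Longrightarrow> tame U (\<lambda>z. k)"
  by (rule tame_dep_cong[where C = "{}"]) (auto simp: tame_set_def intro: smooth_on_const tame_open)

lemma tame_coord [tame_intros]: "tame_set U \<Longrightarrow> tame U (\<lambda>z. z c)"
  by (rule tame_dep_cong[where C = "{c}"]) (auto simp: tame_set_def intro: smooth_on_coord tame_open)

lemma tame_binop:
  assumes "tame U J" "tame U K" "smooth_on U (\<lambda>z. h (J z) (K z))"
  shows "tame U (\<lambda>z. h (J z) (K z))"
proof -
  obtain C where C: "finite C" "dep C U J" using assms(1) by (elim tameE)
  obtain D where D: "finite D" "dep D U K" using assms(2) by (elim tameE)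
  show ?thesis
  proof (rule tame_dep_cong[where C = "C \<union> D"])
    fix z z' assume z: "z \<in> U" "\<And>c. c \<in> C \<union> D \<Longrightarrow> z' c = z c"
    have "J z' = J z" by (rule depD(2)[OF C(2) z(1)]) (rule z(2), simp)
    moreover have "K z' = K z" by (rule depD(2)[OF D(2) z(1)]) (rule z(2), simp)
    ultimately show "h (J z') (K z') = h (J z) (K z)" by simp
  qed (use assms C D tame_imp_tame_set in auto)
qed

lemma tame_add [tame_intros]: "tame U J \<Longrightarrow> tame U K \<Longrightarrow> tame U (\<lambda>z. J z + K z)"
  by (rule tame_binop) (auto intro: smooth_on_add tame_smooth)

lemma tame_mult [tame_intros]: "tame U J \<Longrightarrow> tame U K \<Longrightarrow> tame U (\<lambda>z. J z * K z)"
  by (rule tame_binop) (auto intro: smooth_on_mult tame_smooth)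

lemma tame_inverse: "tame U J \<Longrightarrow> (\<And>z. z \<in> U \<Longrightarrow> J z \<noteq> 0) \<Longrightarrow> tame U (\<lambda>z. inverse (J z))"
  by (rule tame_binop[where h = "\<lambda>x y. inverse x" and K = J]) (auto intro: smooth_on_inverse tame_smooth)

lemma tame_minus [tame_intros]: "tame U J \<Longrightarrow> tame U (\<lambda>z. - J z)"
  using tame_mult[OF tame_const[OF tame_imp_tame_set, of U J "- 1"]] by simp

lemma tame_diff [tame_intros]: "tame U J \<Longrightarrow> tame U K \<Longrightarrow> tame U (\<lambda>z. J z - K z)"
  using tame_add[of U J "\<lambda>z. - K z"] tame_minus[of U K] by simp

lemma tame_divide [tame_intros]:
  "tame U J \<Longrightarrow> tame U K \<Longrightarrow> (\<And>z. z \<in> U \<Longrightarrow> K z \<noteq> 0) \<Longrightarrow> tame U (\<lambda>z. J z / K z)"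
  using tame_mult[of U J "\<lambda>z. inverse (K z)"] tame_inverse[of U K] by (simp add: divide_inverse)

lemma tame_power [tame_intros]: "tame U J \<Longrightarrow> tame U (\<lambda>z. J z ^ n)"
  by (induction n) (auto intro: tame_const tame_mult tame_imp_tame_set)

lemma tame_sum [tame_intros]:
  "finite I \<Longrightarrow> tame_set U \<Longrightarrow> (\<And>i. i \<in> I \<Longrightarrow> tame U (J i)) \<Longrightarrow> tame U (\<lambda>z. \<Sum>i\<in>I. J i z)"
  by (induction I rule: finite_induct) (auto intro: tame_const tame_add)

lemma tame_cong:
  assumes "tame U K" "\<And>z. z \<in> U \<Longrightarrow> J z = K z" shows "tame U J"
proof -
  obtain C where C: "finite C" "dep C U K" "smooth_on U K" using assms(1) by (elim tameE)
  show ?thesis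
  proof (rule tame_dep_cong[OF tame_imp_tame_set[OF assms(1)] smooth_on_cong[OF C(3) assms(2)] C(1)])
    fix z z' assume z: "z \<in> U" "z' \<in> U" "\<And>c. c \<in> C \<Longrightarrow> z' c = z c"
    show "J z' = J z" using depD(2)[OF C(2) z(1,3)] assms(2)[OF z(1)] assms(2)[OF z(2)] by simp
  qed
qed

lemma tame_pd [tame_intros]: "tame U J \<Longrightarrow> tame U (pd c J)"
  by (elim tameE) (auto simp: tame_def intro: dep_pd smooth_onD)

lemma smooth_on_subset: "smooth_on U J \<Longrightarrow> open V \<Longrightarrow> V \<subseteq> U \<Longrightarrow> smooth_on V J"
  unfolding smooth_on_def by (meson continuous_on_subset subsetD)

lemma tame_restrict:
  assumes "tame U J" "tame_set V" "V \<subseteq> U" shows "tame V J"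
proof -
  obtain C where C: "finite C" "dep C U J" "smooth_on U J" using assms(1) by (elim tameE)
  have "smooth_on V J"
    using C(3) tame_open assms(2,3) unfolding tame_set_def by (blast intro: smooth_on_subset)
  with assms(2) show ?thesis using C(1)
  proof (rule tame_dep_cong)
    fix z z' assume z: "z \<in> V" "z' \<in> V" "\<And>c. c \<in> C \<Longrightarrow> z' c = z c"
    show "J z' = J z" by (rule depD(2)[OF C(2) _ z(3)]) (use z(1) assms(3) in blast)
  qed
qed

lemma tame_lie [tame_intros]:
  assumes "tame U J" "\<And>c. tame U (\<lambda>z. V z c)"
  shows "tame U (\<lambda>z. lie (V z) J z)"
proof -
  obtain C where C: "finite C" "dep C U J" using assms(1) by (elim tameE)
  have "tame U (\<lambda>z. \<Sum>c\<in>C. V z c * pd c J z)"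
    using C(1) assms tame_imp_tame_set by (intro tame_intros) auto
  then show ?thesis
  proof (rule tame_cong)
    show "lie (V z) J z = (\<Sum>c\<in>C. V z c * pd c J z)" if "z \<in> U" for z
      by (rule lie_eq_sum[OF C(1)]) (use dep_pd_zero[OF C(2) that] in auto)
  qed
qed

lemma has_lie_tame: "tame U J \<Longrightarrow> z \<in> U \<Longrightarrow> lie v J z = d \<Longrightarrow> has_lie v J d z"
  by (simp add: has_lieI tame_diffat)

lemma has_lie_finite_sum:
  assumes "finite I" "\<And>i. i \<in> I \<Longrightarrow> has_lie v (J i) (d i) z"
  shows "has_lie v (\<lambda>z. \<Sum>i\<in>I. J i z) (\<Sum>i\<in>I. d i) z"
  using assms by (induction I rule: finite_induct) (auto intro: has_lie_const intro!: has_lie_add[OF _ _ refl])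

section \<open>Brackets of vector fields and smoothness of compositions\<close>

lemma lie_lie:
  assumes J: "tame U J" and V: "\<And>c. tame U (\<lambda>z. V z c)" and z: "z \<in> U"
    and C: "finite C" "dep C U J"
  shows "lie v (\<lambda>z. lie (V z) J z) z =
    (\<Sum>c\<in>C. lie v (\<lambda>z. V z c) z * pd c J z) + (\<Sum>c\<in>C. \<Sum>d\<in>C. V z c * v d * pd d (pd c J) z)"
proof -
  have pd2: "lie v (pd c J) z = (\<Sum>d\<in>C. v d * pd d (pd c J) z)" for c
    by (rule lie_eq_sum[OF C(1)]) (rule dep_pd_zero[OF dep_pd[OF tame_open[OF J] C(2)] z])
  have "lie v (\<lambda>z. lie (V z) J z) z = lie v (\<lambda>z. \<Sum>c\<in>C. V z c * pd c J z) z"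
  proof (rule has_lie_cong_on(1)[OF tame_open[OF J] z])
    show "lie (V w) J w = (\<Sum>c\<in>C. V w c * pd c J w)" if "w \<in> U" for w
      by (rule lie_eq_sum[OF C(1)]) (use dep_pd_zero[OF C(2) that] in auto)
  qed
  also have "has_lie v (\<lambda>z. \<Sum>c\<in>C. V z c * pd c J z)
      (\<Sum>c\<in>C. lie v (\<lambda>z. V z c) z * pd c J z + V z c * lie v (pd c J) z) z"
    by (rule has_lie_finite_sum[OF C(1)])
      (rule has_lie_mult[OF has_lie_tame[OF V z refl] has_lie_tame[OF tame_pd[OF J] z refl] refl])
  then have "lie v (\<lambda>z. \<Sum>c\<in>C. V z c * pd c J z) z =
      (\<Sum>c\<in>C. lie v (\<lambda>z. V z c) z * pd c J z + V z c * lie v (pd c J) z)"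
    by (rule has_lieD)
  finally show ?thesis by (simp add: pd2 sum.distrib sum_distrib_left algebra_simps)
qed

text \<open>The second-order parts from \<open>lie_lie\<close> are exchanged by
  \<open>pd_commute\<close> and cancel, so the commutator is again a derivation and is determined by
  its effect on the coordinates.\<close>

lemma lie_commutator:
  assumes J: "tame U J" and V: "\<And>c. tame U (\<lambda>z. V z c)" and W: "\<And>c. tame U (\<lambda>z. W z c)" and z: "z \<in> U"
  shows "lie (V z) (\<lambda>z. lie (W z) J z) z - lie (W z) (\<lambda>z. lie (V z) J z) z =
    lie (\<lambda>c. lie (V z) (\<lambda>z. W z c) z - lie (W z) (\<lambda>z. V z c) z) J z"
proof -
  obtain C where C: "finite C" "dep C U J" using J by (elim tameE)
  have "(\<Sum>c\<in>C. \<Sum>d\<in>C. W z c * V z d * pd d (pd c J) z) = (\<Sum>d\<in>C. \<Sum>c\<in>C. V z d * W z c * pd c (pd d J) z)"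
    by (subst sum.swap) (simp add: pd_commute[OF tame_smooth[OF J] z] mult.commute)
  moreover have "lie (\<lambda>c. lie (V z) (\<lambda>z. W z c) z - lie (W z) (\<lambda>z. V z c) z) J z =
      (\<Sum>c\<in>C. (lie (V z) (\<lambda>z. W z c) z - lie (W z) (\<lambda>z. V z c) z) * pd c J z)"
    by (rule lie_eq_sum[OF C(1)]) (rule dep_pd_zero[OF C(2) z])
  ultimately show ?thesis
    unfolding lie_lie[OF J W z C] lie_lie[OF J V z C] by (simp add: sum_subtractf left_diff_distrib)
qed

text \<open>A derivative of \<open>J (\<Phi> b)\<close> is a finite sum of products of a derivative
  of a component of \<open>\<Phi>\<close> with \<open>pd c J\<close> composed with
  \<open>\<Phi>\<close>. Adding compositions with \<open>\<Phi>\<close> to the smooth functions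
  therefore gives a class stable under differentiation.\<close>

inductive comp_alg :: "('c \<Rightarrow> real) set \<Rightarrow> ('d \<Rightarrow> real) set \<Rightarrow> (('d \<Rightarrow> real) \<Rightarrow> 'c \<Rightarrow> real) \<Rightarrow> (('d \<Rightarrow> real) \<Rightarrow> real) \<Rightarrow> bool"
  for U V \<Phi> where
  comp: "tame U J \<Longrightarrow> comp_alg U V \<Phi> (\<lambda>b. J (\<Phi> b))"
| base: "smooth_on V H \<Longrightarrow> comp_alg U V \<Phi> H"
| add: "comp_alg U V \<Phi> H \<Longrightarrow> comp_alg U V \<Phi> K \<Longrightarrow> comp_alg U V \<Phi> (\<lambda>b. H b + K b)"
| mult: "comp_alg U V \<Phi> H \<Longrightarrow> comp_alg U V \<Phi> K \<Longrightarrow> comp_alg U V \<Phi> (\<lambda>b. H b * K b)"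

lemma comp_alg_sum:
  assumes "open V" "finite C" "\<And>c. c \<in> C \<Longrightarrow> comp_alg U V \<Phi> (H c)"
  shows "comp_alg U V \<Phi> (\<lambda>b. \<Sum>c\<in>C. H c b)"
  using assms(2,3)
  by (induction C rule: finite_induct) (auto intro: comp_alg.base smooth_on_const assms(1) comp_alg.add)

lemma smooth_on_compose:
  fixes \<Phi> :: "('d \<Rightarrow> real) \<Rightarrow> 'c \<Rightarrow> real"
  assumes J: "tame U J" and V: "open V" and \<Phi>: "\<And>c. smooth_on V (\<lambda>b. \<Phi> b c)" "\<And>b. b \<in> V \<Longrightarrow> \<Phi> b \<in> U"
  shows "smooth_on V (\<lambda>b. J (\<Phi> b))"
proof (rule smooth_on_coinduct[where P = "comp_alg U V \<Phi>"])
  fix H assume "comp_alg U V \<Phi> H"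
  then show "continuous_on V H \<and> (\<forall>c. \<forall>z\<in>V. pdiff c H z) \<and>
      (\<forall>c. \<exists>K. comp_alg U V \<Phi> K \<and> (\<forall>z\<in>V. pd c H z = K z))"
  proof induction
    case (comp J)
    obtain C where C: "finite C" "dep C U J" "smooth_on U J" using comp by (elim tameE)
    have \<Phi>_cont: "continuous_on V \<Phi>"
      by (intro continuous_on_coordinatewise_then_product smooth_onD(2)[OF \<Phi>(1)])
    have cont: "continuous_on V (\<lambda>b. J (\<Phi> b))"
      using continuous_on_compose2[OF smooth_onD(2)[OF C(3)] \<Phi>_cont] \<Phi>(2) by blast
    have der: "((\<lambda>t. J (\<Phi> (b(i := t)))) has_real_derivative
        (\<Sum>c\<in>C. pd i (\<lambda>b. \<Phi> b c) b * pd c J (\<Phi> b))) (at (b i))" if b: "b \<in> V" for b i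
      using chain_rule[OF C(3) C(1,2), of "\<lambda>t. \<Phi> (b(i := t))" "b i" "\<lambda>c. pd i (\<lambda>b. \<Phi> b c) b"]
        \<Phi>(2)[OF b] smooth_onD(3)[OF \<Phi>(1) b, unfolded pdiff_iff] by simp
    have alg: "comp_alg U V \<Phi> (\<lambda>b. \<Sum>c\<in>C. pd i (\<lambda>b. \<Phi> b c) b * pd c J (\<Phi> b))" for i
      by (intro comp_alg_sum V C(1) comp_alg.mult comp_alg.base smooth_onD(4) \<Phi>(1) comp_alg.comp tame_pd comp)
    have "\<forall>i. \<forall>b\<in>V. pdiff i (\<lambda>b. J (\<Phi> b)) b"
      by (intro allI ballI) (rule pdiffI, rule der)
    moreover have "\<forall>i. \<exists>K. comp_alg U V \<Phi> K \<and> (\<forall>b\<in>V. pd i (\<lambda>b. J (\<Phi> b)) b = K b)"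
      by (intro allI exI conjI ballI, rule alg) (rule pd_eqI, rule der)
    ultimately show ?case using cont by (intro conjI)
  next
    case (base H)
    from smooth_onD[OF this] show ?case
      by (intro conjI allI ballI exI[of _ "pd _ H"] comp_alg.base) auto
  next
    case (add J K)
    have "\<exists>L. comp_alg U V \<Phi> L \<and> (\<forall>z\<in>V. pd c (\<lambda>z. J z + K z) z = L z)" for c
    proof -
      obtain J' K' where "comp_alg U V \<Phi> J'" "comp_alg U V \<Phi> K'"
        "\<forall>z\<in>V. pd c J z = J' z" "\<forall>z\<in>V. pd c K z = K' z"
        using add.IH by blast
      then show ?thesis using add
        by (intro exI[of _ "\<lambda>z. J' z + K' z"]) (auto intro: comp_alg.add simp: pd_add)
    qed
    then show ?case using add by (auto intro: continuous_intros pd_add)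
  next
    case (mult J K)
    have "\<exists>L. comp_alg U V \<Phi> L \<and> (\<forall>z\<in>V. pd c (\<lambda>z. J z * K z) z = L z)" for c
    proof -
      obtain J' K' where "comp_alg U V \<Phi> J'" "comp_alg U V \<Phi> K'"
        "\<forall>z\<in>V. pd c J z = J' z" "\<forall>z\<in>V. pd c K z = K' z"
        using mult.IH by blast
      then show ?thesis using mult
        by (intro exI[of _ "\<lambda>z. J' z * K z + J z * K' z"]) (auto intro!: comp_alg.add comp_alg.mult simp: pd_mult)
    qed
    then show ?case using mult by (auto intro: continuous_intros pd_mult)
  qed
next
  show "comp_alg U V \<Phi> (\<lambda>b. J (\<Phi> b))" using J by (rule comp_alg.comp)
qed (rule V)

section \<open>Coordinates of finite jet order\<close>

lemma vector_4:
  "(vector [a, b, c, d] :: 'a::zero ^ 4) $ 1 = a" "(vector [a, b, c, d] :: 'a ^ 4) $ 2 = b"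
  "(vector [a, b, c, d] :: 'a ^ 4) $ 3 = c" "(vector [a, b, c, d] :: 'a ^ 4) $ 4 = d"
  unfolding vector_def by simp_all

lemma finite_jet_order_le: "finite {c. jet_order c \<le> s}"
proof -
  have sub: "{c. jet_order c \<le> s} \<subseteq> Base ` UNIV \<union> (Der \<circ> mset) ` {ks. set ks \<subseteq> UNIV \<and> length ks \<le> s}"
  proof
    fix c assume c: "c \<in> {c. jet_order c \<le> s}"
    show "c \<in> Base ` UNIV \<union> (Der \<circ> mset) ` {ks. set ks \<subseteq> UNIV \<and> length ks \<le> s}"
    proof (cases c)
      case (Der \<alpha>)
      obtain ks where "mset ks = \<alpha>" by (rule ex_mset[THEN exE])
      with Der c show ?thesis by (intro UnI2 image_eqI[of _ _ ks]) auto
    qed auto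
  qed
  have fin: "finite {ks. set ks \<subseteq> (UNIV :: 4 set) \<and> length ks \<le> s}"
    by (rule finite_lists_length_le) simp
  then have "finite (Base ` UNIV \<union> (Der \<circ> mset) ` {ks. set ks \<subseteq> UNIV \<and> length ks \<le> s})"
    by (intro finite_UnI finite_imageI fin) simp
  with sub show ?thesis by (rule finite_subset)
qed

lemma order_le_iff_dep: "order_le s U J \<longleftrightarrow> dep {c. jet_order c \<le> s} U J"
  unfolding order_le_def dep_def by simp

lemma order_le_tame: "smooth_on U J \<Longrightarrow> order_le s U J \<Longrightarrow> tame U J"
  unfolding order_le_iff_dep tame_def using finite_jet_order_le by blast

lemma tame_order_le: assumes "tame U J" shows "\<exists>s. order_le s U J"
proof -
  obtain C where C: "finite C" "dep C U J" using assms by (elim tameE)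
  have "C \<subseteq> {c. jet_order c \<le> Max (jet_order ` C)}" using C(1) by auto
  then show ?thesis unfolding order_le_iff_dep using C(2) dep_mono by blast
qed

subsection \<open>Total derivatives\<close>

text \<open>The total derivative in direction \<open>k\<close> as a vector field on the jet space;
  \<open>Dtot k\<close> is the derivation along it.\<close>

definition shift :: "4 \<Rightarrow> jet \<Rightarrow> coord \<Rightarrow> real" where
  "shift k z c = (case c of Base j \<Rightarrow> if j = k then 1 else 0 | Der \<alpha> \<Rightarrow> z (Der (add_mset k \<alpha>)))"

lemma shift_simps [simp]:
  "shift k z (Base j) = (if j = k then 1 else 0)" "shift k z (Der \<alpha>) = z (Der (add_mset k \<alpha>))"
  by (simp_all add: shift_def)

lemma lie_split:
  assumes "finite {c. pd c J z \<noteq> 0}"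
  shows "lie v J z = (\<Sum>k\<in>UNIV. v (Base k) * pd (Base k) J z) +
    (\<Sum>\<alpha> | pd (Der \<alpha>) J z \<noteq> 0. v (Der \<alpha>) * pd (Der \<alpha>) J z)"
proof -
  let ?A = "{\<alpha>. pd (Der \<alpha>) J z \<noteq> 0}"
  have inj: "inj Der" "inj Base" by (simp_all add: inj_def)
  have "finite (Der ` ?A)" by (rule finite_subset[OF _ assms]) auto
  then have fin: "finite ?A" using inj(1) by (simp add: finite_image_iff inj_on_subset)
  have "lie v J z = (\<Sum>c\<in>Base ` UNIV \<union> Der ` ?A. v c * pd c J z)"
  proof (rule lie_eq_sum)
    fix c assume "c \<notin> Base ` UNIV \<union> Der ` ?A"
    then show "pd c J z = 0" by (cases c) auto
  qed (use fin in auto)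
  also have "\<dots> = (\<Sum>c\<in>Base ` UNIV. v c * pd c J z) + (\<Sum>c\<in>Der ` ?A. v c * pd c J z)"
    using fin by (intro sum.union_disjoint) auto
  also have "\<dots> = (\<Sum>k\<in>UNIV. v (Base k) * pd (Base k) J z) + (\<Sum>\<alpha>\<in>?A. v (Der \<alpha>) * pd (Der \<alpha>) J z)"
    using inj by (simp add: sum.reindex inj_on_subset)
  finally show ?thesis .
qed

lemma Dtot_eq_lie:
  assumes "diffat J z" shows "Dtot k J z = lie (shift k z) J z"
proof -
  have "(\<Sum>j\<in>UNIV. (if j = k then 1 else 0) * pd (Base j) J z) = (\<Sum>j\<in>UNIV. if j = k then pd (Base j) J z else 0)"
    by (rule sum.cong) auto
  also have "\<dots> = pd (Base k) J z" by simp
  finally show ?thesis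
    using assms lie_split[of J z "shift k z"] unfolding Dtot_def diffat_def by simp
qed

lemma Dtot_eqI: "has_lie (shift k z) J d z \<Longrightarrow> Dtot k J z = d"
  by (simp add: has_lie_def Dtot_eq_lie)

lemma has_lie_Dtot: "diffat J z \<Longrightarrow> has_lie (shift k z) J (Dtot k J z) z"
  by (simp add: has_lie_def Dtot_eq_lie)

lemma tame_shift: "tame_set U \<Longrightarrow> tame U (\<lambda>z. shift k z c)"
  by (cases c) (auto intro: tame_const tame_coord)

lemma tame_Dtot [tame_intros]: "tame U J \<Longrightarrow> tame U (Dtot k J)"
  by (rule tame_cong[OF tame_lie[of U J "shift k"]])
    (auto intro: tame_shift tame_imp_tame_set Dtot_eq_lie tame_diffat)

lemma tame_fd [tame_intros]: "tame_set U \<Longrightarrow> tame U (fd ks)"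
  unfolding fd_def[abs_def] by (rule tame_coord)

lemma tame_Ddot [tame_intros]: "tame U J \<Longrightarrow> tame U (Ddot J)"
  unfolding Ddot_def[abs_def] by (auto intro!: tame_intros dest: tame_imp_tame_set)

lemma Dtot_cong_on:
  assumes "open U" "z \<in> U" "\<And>w. w \<in> U \<Longrightarrow> J w = K w" shows "Dtot k J z = Dtot k K z"
  unfolding Dtot_def using pd_cong_on(1)[OF assms] by simp

lemma Dtot_const [simp]: "Dtot k (\<lambda>z. c) = (\<lambda>z. 0)"
  by (intro ext Dtot_eqI has_lie_const) simp

lemma Dtot_Base [simp]: "Dtot k (\<lambda>z. z (Base j)) = (\<lambda>z. if j = k then 1 else 0)"
  by (intro ext Dtot_eqI has_lie_coord) simp

lemma Dtot_fd [simp]: "Dtot k (fd ks) = fd (k # ks)"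
  unfolding fd_def[abs_def] by (intro ext Dtot_eqI has_lie_coord) simp

lemma Dtot_add:
  assumes "diffat J z" "diffat K z" shows "Dtot k (\<lambda>z. J z + K z) z = Dtot k J z + Dtot k K z"
  using assms by (intro Dtot_eqI has_lie_add) (auto simp: has_lie_def Dtot_eq_lie)

lemma Dtot_diff:
  assumes "diffat J z" "diffat K z" shows "Dtot k (\<lambda>z. J z - K z) z = Dtot k J z - Dtot k K z"
  using assms by (intro Dtot_eqI has_lie_diff) (auto simp: has_lie_def Dtot_eq_lie)

lemma Dtot_minus:
  assumes "diffat J z" shows "Dtot k (\<lambda>z. - J z) z = - Dtot k J z"
  using assms by (intro Dtot_eqI has_lie_minus) (auto simp: has_lie_def Dtot_eq_lie)

lemma Dtot_mult:
  assumes "diffat J z" "diffat K z" shows "Dtot k (\<lambda>z. J z * K z) z = Dtot k J z * K z + J z * Dtot k K z"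
  using assms by (intro Dtot_eqI has_lie_mult) (auto simp: has_lie_def Dtot_eq_lie)

text \<open>The bracket of the two vector fields has zero components: on \<open>Der \<alpha>\<close>
  both orders give the coordinate whose multi-index is enlarged by \<open>k\<close> and
  \<open>l\<close>.\<close>

lemma Dtot_commute:
  assumes J: "tame U J" and z: "z \<in> U" shows "Dtot k (Dtot l J) z = Dtot l (Dtot k J) z"
proof -
  have tame_set: "tame_set U" using J by (rule tame_imp_tame_set)
  have eq: "Dtot a (Dtot b J) z = lie (shift a z) (\<lambda>z. lie (shift b z) J z) z" for a b
  proof -
    have "Dtot a (Dtot b J) z = lie (shift a z) (Dtot b J) z"
      by (intro Dtot_eq_lie tame_diffat[OF _ z] tame_Dtot J)
    also have "\<dots> = lie (shift a z) (\<lambda>z. lie (shift b z) J z) z"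
      by (rule has_lie_cong_on[OF tame_open[OF J] z]) (intro Dtot_eq_lie tame_diffat[OF J])
    finally show ?thesis .
  qed
  have shift_shift: "lie (shift a z) (\<lambda>z. shift b z c) z = (case c of Base j \<Rightarrow> 0 | Der \<alpha> \<Rightarrow> z (Der (add_mset a (add_mset b \<alpha>))))" for a b c
    by (cases c) (auto intro!: has_lieD has_lie_const has_lie_coord)
  have zero: "lie (shift k z) (\<lambda>z. shift l z c) z - lie (shift l z) (\<lambda>z. shift k z c) z = 0" for c
    unfolding shift_shift by (cases c) (simp_all add: add_mset_commute)
  have "lie (\<lambda>c. 0) J z = 0" by (simp add: lie_def)
  then show ?thesis
    using lie_commutator[where V = "shift k" and W = "shift l", OF J tame_shift[OF tame_set] tame_shift[OF tame_set] z] unfolding eq zero by simp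
qed

text \<open>The extra terms come from differentiating the coefficients p, q and f of
  \<open>Ddot\<close>.\<close>

lemma Dtot_Ddot:
  assumes J: "tame U J" and z: "z \<in> U"
  shows "Dtot k (Ddot J) z = Ddot (Dtot k J) z + (if k = 3 then Dtot 2 J z else 0)
    + (if k = 4 then Dtot 3 J z else 0) + fd [k] z * Dtot 4 J z"
proof -
  have D: "has_lie (shift k z) (Dtot j J) (Dtot k (Dtot j J) z) z" for j
    by (rule has_lie_Dtot[OF tame_diffat[OF tame_Dtot[OF J] z]])
  have f: "has_lie (shift k z) (fd []) (fd [k] z) z"
    using has_lie_Dtot[OF tame_diffat[OF tame_fd[OF tame_imp_tame_set[OF J]] z], of k "[]"] by simp
  have b: "has_lie (shift k z) (\<lambda>z. z (Base j)) (if j = k then 1 else 0) z" for j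
    by (rule has_lie_coord) simp
  have "Dtot k (Ddot J) z = Dtot k (Dtot 1 J) z
      + ((if 3 = k then 1 else 0) * Dtot 2 J z + z (Base 3) * Dtot k (Dtot 2 J) z)
      + ((if 4 = k then 1 else 0) * Dtot 3 J z + z (Base 4) * Dtot k (Dtot 3 J) z)
      + (fd [k] z * Dtot 4 J z + fd [] z * Dtot k (Dtot 4 J) z)"
    unfolding Ddot_def[abs_def]
    by (intro Dtot_eqI has_lie_add[OF _ _ refl] has_lie_mult[OF _ _ refl] D f b)
  then show ?thesis
    unfolding Ddot_def by (simp add: Dtot_commute[OF J z, of k] algebra_simps)
qed

subsection \<open>Prolonged generators\<close>

locale fiber_generator =
  fixes \<xi> \<eta> :: "jet \<Rightarrow> real" assumes gen: "generator \<xi> \<eta>"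
begin

lemma xi_eta_dep: "dep {Base 1} UNIV \<xi>" "dep {Base 1, Base 2} UNIV \<eta>"
proof -
  obtain g where "\<xi> = (\<lambda>z. g (z (Base 1)))" using gen unfolding generator_def by blast
  then show "dep {Base 1} UNIV \<xi>" by (auto intro: depI)
  obtain h where "\<eta> = (\<lambda>z. h (z (Base 1)) (z (Base 2)))" using gen unfolding generator_def by blast
  then show "dep {Base 1, Base 2} UNIV \<eta>" by (auto intro: depI)
qed

lemma tame_xi [simp]: "tame UNIV \<xi>" and tame_eta [simp]: "tame UNIV \<eta>"
proof -
  have sm: "smooth_on UNIV \<xi>" "smooth_on UNIV \<eta>" using gen by (simp_all add: generator_def)
  show "tame UNIV \<xi>" unfolding tame_def
    by (intro conjI sm exI[of _ "{Base 1}"] xi_eta_dep) simp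
  show "tame UNIV \<eta>" unfolding tame_def
    by (intro conjI sm exI[of _ "{Base 1, Base 2}"] xi_eta_dep) simp
qed

definition X :: "nat \<Rightarrow> jet \<Rightarrow> real" where "X i = (Ddot ^^ i) \<xi>"

text \<open>Iterating \<open>Ddot\<close> instead of the partial derivative in x absorbs the
  polynomials in p, q, f and its derivatives into which the prolongation coefficients would
  otherwise expand; compare \<open>mu_eq\<close>.\<close>

definition E :: "nat \<Rightarrow> nat \<Rightarrow> jet \<Rightarrow> real" where "E i j = (Ddot ^^ i) ((Dtot 2 ^^ j) \<eta>)"

lemma tame_X [simp]: "tame UNIV (X i)"
  by (induction i) (auto simp: X_def intro: tame_Ddot)

lemma tame_E [simp]: "tame UNIV (E i j)"
proof -
  have "tame UNIV ((Dtot 2 ^^ j) \<eta>)" by (induction j) (auto intro: tame_Dtot)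
  then show ?thesis by (induction i) (auto simp: E_def intro: tame_Ddot)
qed

lemma Ddot_X: "Ddot (X i) = X (Suc i)" by (simp add: X_def)

lemma Ddot_E: "Ddot (E i j) = E (Suc i) j" by (simp add: E_def)

lemma Dtot_dep_zero:
  assumes "tame UNIV J" "dep C UNIV J" "C \<subseteq> range Base" "Base k \<notin> C" shows "Dtot k J = (\<lambda>z. 0)"
proof
  fix z
  have "pd (Base k) J z = 0" "pd (Der \<alpha>) J z = 0" for \<alpha>
    using assms(3,4) by (auto intro!: dep_pd_zero[OF assms(2)])
  then show "Dtot k J z = 0" unfolding Dtot_def by simp
qed

lemma Dtot_xi [simp]: "Dtot 2 \<xi> = (\<lambda>z. 0)" "Dtot 3 \<xi> = (\<lambda>z. 0)" "Dtot 4 \<xi> = (\<lambda>z. 0)"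
  by (rule Dtot_dep_zero[OF tame_xi xi_eta_dep(1)]; auto)+

lemma Dtot_eta: "Dtot 3 \<eta> = (\<lambda>z. 0)" "Dtot 4 \<eta> = (\<lambda>z. 0)"
  by (rule Dtot_dep_zero[OF tame_eta xi_eta_dep(2)]; auto)+

lemma pd_xi: "pd (Base 1) \<xi> = X 1"
proof
  fix z
  have "pd (Der \<alpha>) \<xi> z = 0" for \<alpha> by (rule dep_pd_zero[OF xi_eta_dep(1)]) auto
  then have "Dtot 1 \<xi> z = pd (Base 1) \<xi> z" by (simp add: Dtot_def)
  then show "pd (Base 1) \<xi> z = X 1 z" by (simp add: X_def Ddot_def)
qed

lemma Ddot_zero: "Ddot (\<lambda>z. 0) = (\<lambda>z. 0)"
  by (simp add: Ddot_def fun_eq_iff)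

lemma Dtot_X [simp]: "Dtot 2 (X i) = (\<lambda>z. 0)" "Dtot 3 (X i) = (\<lambda>z. 0)" "Dtot 4 (X i) = (\<lambda>z. 0)"
proof (induction i)
  case 0
  show "Dtot 2 (X 0) = (\<lambda>z. 0)" "Dtot 3 (X 0) = (\<lambda>z. 0)" "Dtot 4 (X 0) = (\<lambda>z. 0)" by (simp_all add: X_def)
next
  case (Suc i)
  show "Dtot 2 (X (Suc i)) = (\<lambda>z. 0)" "Dtot 3 (X (Suc i)) = (\<lambda>z. 0)" "Dtot 4 (X (Suc i)) = (\<lambda>z. 0)"
    unfolding Ddot_X[symmetric] fun_eq_iff
    by (simp_all add: Dtot_Ddot[OF tame_X UNIV_I] Suc Ddot_zero)
qed

lemma Dtot_E0 [simp]: "Dtot 2 (E 0 j) = E 0 (Suc j)" "Dtot 3 (E 0 j) = (\<lambda>z. 0)" "Dtot 4 (E 0 j) = (\<lambda>z. 0)"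
proof -
  show "Dtot 2 (E 0 j) = E 0 (Suc j)" by (simp add: E_def)
  have "Dtot 3 (E 0 j) = (\<lambda>z. 0) \<and> Dtot 4 (E 0 j) = (\<lambda>z. 0)"
  proof (induction j)
    case 0 show ?case by (simp add: E_def Dtot_eta)
  next
    case (Suc j)
    have "E 0 (Suc j) = Dtot 2 (E 0 j)" by (simp add: E_def)
    moreover have "Dtot k (Dtot 2 (E 0 j)) = Dtot 2 (Dtot k (E 0 j))" for k
      by (intro ext Dtot_commute[OF tame_E UNIV_I])
    ultimately show ?case using Suc by simp
  qed
  then show "Dtot 3 (E 0 j) = (\<lambda>z. 0)" "Dtot 4 (E 0 j) = (\<lambda>z. 0)" by auto
qed

lemma Dtot_E_Suc:
  "Dtot 2 (E (Suc i) j) z = Ddot (Dtot 2 (E i j)) z + fd [2] z * Dtot 4 (E i j) z"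
  "Dtot 3 (E (Suc i) j) z = Ddot (Dtot 3 (E i j)) z + Dtot 2 (E i j) z + fd [3] z * Dtot 4 (E i j) z"
  "Dtot 4 (E (Suc i) j) z = Ddot (Dtot 4 (E i j)) z + Dtot 3 (E i j) z + fd [4] z * Dtot 4 (E i j) z"
  using Dtot_Ddot[OF tame_E UNIV_I, of 2 i j z] Dtot_Ddot[OF tame_E UNIV_I, of 3 i j z]
    Dtot_Ddot[OF tame_E UNIV_I, of 4 i j z] by (simp_all add: Ddot_E)

end

declare One_nat_def [simp del]

text \<open>Orients the symmetry of partial derivatives towards increasing indices. Exchanges within
  the first three places sort every list of length at most 3.\<close>

lemma fd_sort:
  "fd (2 # 1 # ks) = fd (1 # 2 # ks)" "fd (3 # 1 # ks) = fd (1 # 3 # ks)" "fd (4 # 1 # ks) = fd (1 # 4 # ks)"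
  "fd (3 # 2 # ks) = fd (2 # 3 # ks)" "fd (4 # 2 # ks) = fd (2 # 4 # ks)" "fd (4 # 3 # ks) = fd (3 # 4 # ks)"
  "fd (k # 2 # 1 # ks) = fd (k # 1 # 2 # ks)" "fd (k # 3 # 1 # ks) = fd (k # 1 # 3 # ks)"
  "fd (k # 4 # 1 # ks) = fd (k # 1 # 4 # ks)" "fd (k # 3 # 2 # ks) = fd (k # 2 # 3 # ks)"
  "fd (k # 4 # 2 # ks) = fd (k # 2 # 4 # ks)" "fd (k # 4 # 3 # ks) = fd (k # 3 # 4 # ks)"
  by (simp_all add: fd_def[abs_def] add_mset_commute)

lemma Ddot_add:
  assumes "diffat J z" "diffat K z" shows "Ddot (\<lambda>z. J z + K z) z = Ddot J z + Ddot K z"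
  using assms by (simp add: Ddot_def Dtot_add algebra_simps)

lemma Ddot_diff:
  assumes "diffat J z" "diffat K z" shows "Ddot (\<lambda>z. J z - K z) z = Ddot J z - Ddot K z"
  using assms by (simp add: Ddot_def Dtot_diff algebra_simps)

lemma Ddot_minus: "diffat J z \<Longrightarrow> Ddot (\<lambda>z. - J z) z = - Ddot J z"
  by (simp add: Ddot_def Dtot_minus algebra_simps)

lemma Ddot_mult:
  assumes "diffat J z" "diffat K z" shows "Ddot (\<lambda>z. J z * K z) z = Ddot J z * K z + J z * Ddot K z"
  using assms by (simp add: Ddot_def Dtot_mult algebra_simps)

lemma Ddot_Base: "Ddot (\<lambda>z. z (Base 1)) = (\<lambda>z. 1)" "Ddot (\<lambda>z. z (Base 2)) = (\<lambda>z. z (Base 3))"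
  "Ddot (\<lambda>z. z (Base 3)) = (\<lambda>z. z (Base 4))" "Ddot (\<lambda>z. z (Base 4)) = fd []"
  by (simp_all add: fun_eq_iff Ddot_def)

lemma Ddot_const [simp]: "Ddot (\<lambda>z. c) = (\<lambda>z. 0)"
  by (simp add: fun_eq_iff Ddot_def)

lemma Dtot_sum:
  assumes "finite I" "\<And>i. i \<in> I \<Longrightarrow> diffat (J i) z"
  shows "Dtot k (\<lambda>z. \<Sum>i\<in>I. J i z) z = (\<Sum>i\<in>I. Dtot k (J i) z)"
  by (intro Dtot_eqI has_lie_finite_sum has_lie_Dtot assms)

lemmas diffat_UNIV = tame_diffat[OF _ UNIV_I]

lemmas total_simps =
  Dtot_add[OF diffat_UNIV diffat_UNIV] Dtot_diff[OF diffat_UNIV diffat_UNIV]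
  Dtot_minus[OF diffat_UNIV] Dtot_mult[OF diffat_UNIV diffat_UNIV]
  Ddot_add[OF diffat_UNIV diffat_UNIV] Ddot_diff[OF diffat_UNIV diffat_UNIV]
  Ddot_minus[OF diffat_UNIV] Ddot_mult[OF diffat_UNIV diffat_UNIV] Ddot_Base

lemmas tame_UNIV_simps = tame_const[OF tame_set_UNIV] tame_coord[OF tame_set_UNIV] tame_fd[OF tame_set_UNIV]
  tame_add[of UNIV] tame_diff[of UNIV] tame_minus[of UNIV] tame_mult[of UNIV] tame_power[of UNIV]
  tame_Ddot[of UNIV] tame_Dtot[of UNIV]

context fiber_generator
begin

lemma Ddot_param [simp]: "Ddot (X i) = X (i + 1)" "Ddot (E i j) = E (i + 1) j"
  by (simp_all only: Ddot_X Ddot_E Suc_eq_plus1)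

lemma Dtot_E [simp]:
  "Dtot 2 (E 1 j) = E 1 (j + 1)" "Dtot 3 (E 1 j) = E 0 (j + 1)" "Dtot 4 (E 1 j) = (\<lambda>z. 0)"
  "Dtot 2 (E 2 j) = E 2 (j + 1)" "Dtot 3 (E 2 j) = (\<lambda>z. 2 * E 1 (j + 1) z)" "Dtot 4 (E 2 j) = E 0 (j + 1)"
  "Dtot 2 (E 3 j) = (\<lambda>z. E 3 (j + 1) z + fd [2] z * E 0 (j + 1) z)"
  "Dtot 3 (E 3 j) = (\<lambda>z. 3 * E 2 (j + 1) z + fd [3] z * E 0 (j + 1) z)"
  "Dtot 4 (E 3 j) = (\<lambda>z. 3 * E 1 (j + 1) z + fd [4] z * E 0 (j + 1) z)"
proof -
  show 1: "Dtot 2 (E 1 j) = E 1 (j + 1)" "Dtot 3 (E 1 j) = E 0 (j + 1)" "Dtot 4 (E 1 j) = (\<lambda>z. 0)"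
    using Dtot_E_Suc[of 0 j] by (simp_all add: fun_eq_iff One_nat_def)
  have "Suc 1 = 2" "Suc 2 = 3" by simp_all
  then show 2: "Dtot 2 (E 2 j) = E 2 (j + 1)" "Dtot 3 (E 2 j) = (\<lambda>z. 2 * E 1 (j + 1) z)" "Dtot 4 (E 2 j) = E 0 (j + 1)"
    using Dtot_E_Suc[of 1 j] by (simp_all add: fun_eq_iff 1)
  show "Dtot 2 (E 3 j) = (\<lambda>z. E 3 (j + 1) z + fd [2] z * E 0 (j + 1) z)"
    "Dtot 3 (E 3 j) = (\<lambda>z. 3 * E 2 (j + 1) z + fd [3] z * E 0 (j + 1) z)"
    "Dtot 4 (E 3 j) = (\<lambda>z. 3 * E 1 (j + 1) z + fd [4] z * E 0 (j + 1) z)"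
    using Dtot_E_Suc[of 2 j] by (simp_all add: fun_eq_iff 2 total_simps tame_UNIV_simps)
qed

lemma zeta1_eq: "zeta1 \<xi> \<eta> = (\<lambda>z. E 1 0 z - z (Base 3) * X 1 z)"
  by (simp add: zeta1_def fun_eq_iff pd_xi E_def One_nat_def)

lemma zeta2_eq: "zeta2 \<xi> \<eta> = (\<lambda>z. E 2 0 z - 2 * z (Base 4) * X 1 z - z (Base 3) * X 2 z)"
  by (simp add: zeta2_def zeta1_eq fun_eq_iff pd_xi total_simps tame_UNIV_simps)

lemma mu_eq: "mu \<xi> \<eta> = (\<lambda>z. E 3 0 z - 3 * fd [] z * X 1 z - 3 * z (Base 4) * X 2 z - z (Base 3) * X 3 z)"
  by (simp add: mu_def zeta2_eq fun_eq_iff pd_xi total_simps tame_UNIV_simps)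

lemma Ybase_eq: "Ybase \<xi> \<eta> z $ 1 = X 0 z" "Ybase \<xi> \<eta> z $ 2 = E 0 0 z"
  "Ybase \<xi> \<eta> z $ 3 = E 1 0 z - z (Base 3) * X 1 z"
  "Ybase \<xi> \<eta> z $ 4 = E 2 0 z - 2 * z (Base 4) * X 1 z - z (Base 3) * X 2 z"
  by (simp_all add: Ybase_def vector_4 zeta1_eq zeta2_eq X_def E_def)

lemma tame_Ybase [simp]: "tame UNIV (\<lambda>z. Ybase \<xi> \<eta> z $ k)"
  using exhaust_4[of k] by (auto simp: Ybase_eq tame_UNIV_simps)

lemma tame_Yder [simp]: "tame UNIV (Yder \<xi> \<eta> ks)"
proof (induction ks)
  case Nil show ?case by (simp add: mu_eq tame_UNIV_simps)
next
  case (Cons k ks)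
  then show ?case by (auto intro!: tame_diff tame_sum tame_mult tame_Dtot tame_fd)
qed

text \<open>After expansion each term is symmetric in \<open>k\<close> and \<open>l\<close> or has
  its mirror image as a partner. Thus the prolongation coefficient depends only on the
  multi-index.\<close>

lemma Yder_swap: "Yder \<xi> \<eta> (k # l # ks) = Yder \<xi> \<eta> (l # k # ks)"
proof
  fix z
  let ?B = "\<lambda>j w. Ybase \<xi> \<eta> w $ j"
  have *: "Yder \<xi> \<eta> (k # l # ks) z = Dtot k (Dtot l (Yder \<xi> \<eta> ks)) z
      - (\<Sum>j\<in>UNIV. fd (k # j # ks) z * Dtot l (?B j) z + fd (j # ks) z * Dtot k (Dtot l (?B j)) z)
      - (\<Sum>j\<in>UNIV. fd (j # l # ks) z * Dtot k (?B j) z)" for k l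
  proof -
    have t: "diffat (fd ks) z" "diffat (Dtot k (?B j)) z" "diffat (Dtot k (Yder \<xi> \<eta> ks)) z"
      "diffat (\<lambda>z. fd (j # ks) z * Dtot l (?B j) z) z"
      "diffat (\<lambda>z. \<Sum>j\<in>UNIV. fd (j # ks) z * Dtot l (?B j) z) z" for k j l ks
      by (rule diffat_UNIV; intro tame_fd tame_Dtot tame_Ybase tame_Yder tame_set_UNIV tame_mult tame_sum finite)+
    show ?thesis by (simp add: Dtot_diff[OF t(3,5)] Dtot_sum[OF finite t(4)] Dtot_mult[OF t(1,2)])
  qed
  have c: "Dtot k (Dtot l J) z = Dtot l (Dtot k J) z" if "tame UNIV J" for J
    using Dtot_commute[OF that UNIV_I] .
  have f: "fd (k # j # ks) = fd (j # k # ks)" for j k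
    by (simp add: fd_def[abs_def] add_mset_commute)
  show "Yder \<xi> \<eta> (k # l # ks) z = Yder \<xi> \<eta> (l # k # ks) z"
    unfolding * c[OF tame_Yder] c[OF tame_Ybase] f by (simp add: sum.distrib)
qed

text \<open>\<open>Yprol\<close> enumerates a multi-index by its sorted list, whereas the recursion
  adds an index in front; this reconciles the two.\<close>

lemma Yder_insort: "Yder \<xi> \<eta> (insort k ks) = Yder \<xi> \<eta> (k # ks)"
proof (induction ks)
  case (Cons l ks)
  show ?case
  proof (cases "k \<le> l")
    case False
    have "Yder \<xi> \<eta> (l # insort k ks) = Yder \<xi> \<eta> (l # k # ks)"
    proof -
      have "fd (j # insort k ks) = fd (j # k # ks)" for j by (simp add: fd_def[abs_def])
      then show ?thesis unfolding Yder.simps(2)[of _ _ l] Cons.IH by simp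
    qed
    then show ?thesis using False by (simp only: insort_key.simps if_False Yder_swap)
  qed simp
qed simp

text \<open>The infinite prolongation as one vector field. It serves all orders at once and agrees
  with \<open>Yprol s\<close> on functions of order \<open>s\<close>.\<close>

definition W :: "jet \<Rightarrow> coord \<Rightarrow> real" where
  "W z c = (case c of Base k \<Rightarrow> Ybase \<xi> \<eta> z $ k | Der \<alpha> \<Rightarrow> Yder \<xi> \<eta> (sorted_list_of_multiset \<alpha>) z)"

definition Y :: "(jet \<Rightarrow> real) \<Rightarrow> jet \<Rightarrow> real" where "Y J z = lie (W z) J z"

lemma W_Base: "W z (Base k) = Ybase \<xi> \<eta> z $ k" by (simp add: W_def)

lemma tame_W: "tame UNIV (\<lambda>z. W z c)"
  by (cases c) (simp_all add: W_def)

lemma tame_W': "tame_set U \<Longrightarrow> tame U (\<lambda>z. W z c)"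
  by (rule tame_restrict[OF tame_W]) auto

lemma tame_Y: "tame U J \<Longrightarrow> tame U (Y J)"
  unfolding Y_def[abs_def] by (auto intro: tame_lie tame_W' tame_imp_tame_set)

lemma Yprol_eq:
  assumes "tame U J" "order_le s U J" "z \<in> U" shows "Yprol s \<xi> \<eta> J z = Y J z"
proof -
  have dep: "dep {c. jet_order c \<le> s} U J" using assms(2) by (simp add: order_le_iff_dep)
  have fin: "finite {\<alpha> :: 4 multiset. size \<alpha> \<le> s}"
  proof -
    have "finite (Der -` {c. jet_order c \<le> s})"
      by (rule finite_vimageI[OF finite_jet_order_le]) (simp add: inj_def)
    then show ?thesis by (simp add: vimage_def)
  qed
  have "(\<Sum>\<alpha> | size \<alpha> \<le> s. Yder \<xi> \<eta> (sorted_list_of_multiset \<alpha>) z * pd (Der \<alpha>) J z) =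
      (\<Sum>\<alpha> | pd (Der \<alpha>) J z \<noteq> 0. Yder \<xi> \<eta> (sorted_list_of_multiset \<alpha>) z * pd (Der \<alpha>) J z)"
    using dep_pd_zero[OF dep assms(3), of "Der _"] by (intro sum.mono_neutral_right fin) auto
  moreover have "finite {c. pd c J z \<noteq> 0}" using tame_diffat[OF assms(1,3)] by (simp add: diffat_def)
  ultimately show ?thesis unfolding Yprol_def Y_def by (simp add: lie_split W_def)
qed

lemma W_add_mset:
  "W z (Der (add_mset k \<alpha>)) = Dtot k (\<lambda>w. W w (Der \<alpha>)) z
    - (\<Sum>j\<in>UNIV. z (Der (add_mset j \<alpha>)) * Dtot k (\<lambda>w. W w (Base j)) z)"
  by (simp add: W_def Yder_insort fd_def)

text \<open>The characteristic commutator of a prolongation. By \<open>lie_commutator\<close> only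
  the components of the bracket matter: on \<open>Base\<close> coordinates \<open>shift k\<close> is
  constant, and on \<open>Der\<close> coordinates the claim is the recursion
  \<open>W_add_mset\<close>.\<close>

lemma Y_Dtot:
  assumes J: "tame U J" and z: "z \<in> U"
  shows "Y (Dtot k J) z = Dtot k (Y J) z - (\<Sum>j\<in>UNIV. Dtot k (\<lambda>w. W w (Base j)) z * Dtot j J z)"
proof -
  note tame_set = tame_imp_tame_set[OF J]
  have 1: "Y (Dtot k J) z = lie (W z) (\<lambda>z. lie (shift k z) J z) z"
    unfolding Y_def by (rule has_lie_cong_on[OF tame_open[OF J] z]) (intro Dtot_eq_lie tame_diffat[OF J])
  have 2: "Dtot k (Y J) z = lie (shift k z) (\<lambda>z. lie (W z) J z) z"
    using Dtot_eq_lie[OF tame_diffat[OF tame_Y[OF J] z]] by (simp add: Y_def[abs_def])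
  have "lie (W z) (\<lambda>z. shift k z c) z - lie (shift k z) (\<lambda>z. W z c) z
      = - (\<Sum>j\<in>UNIV. Dtot k (\<lambda>w. W w (Base j)) z * shift j z c)" for c
  proof -
    have s: "lie (shift k z) (\<lambda>z. W z c) z = Dtot k (\<lambda>z. W z c) z"
      by (rule Dtot_eq_lie[OF diffat_UNIV[OF tame_W], symmetric])
    show ?thesis
    proof (cases c)
      case (Base i)
      have "lie (W z) (\<lambda>z. shift k z c) z = 0" unfolding Base
        by (rule has_lieD) (simp add: has_lie_const)
      moreover have "(\<Sum>j\<in>UNIV. Dtot k (\<lambda>w. W w (Base j)) z * shift j z c) = Dtot k (\<lambda>w. W w c) z"
        unfolding Base using exhaust_4[of i] by (auto simp: sum_4)
      ultimately show ?thesis using s by simp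
    next
      case (Der \<alpha>)
      have "lie (W z) (\<lambda>z. shift k z c) z = W z (Der (add_mset k \<alpha>))" unfolding Der
        by (rule has_lieD) (simp add: has_lie_coord)
      then show ?thesis unfolding s by (simp add: W_add_mset Der mult.commute)
    qed
  qed
  note bracket = this
  have "Y (Dtot k J) z - Dtot k (Y J) z = lie (\<lambda>c. - (\<Sum>j\<in>UNIV. Dtot k (\<lambda>w. W w (Base j)) z * shift j z c)) J z"
    unfolding 1 2 lie_commutator[where V = W and W = "shift k", OF J tame_W'[OF tame_set] tame_shift[OF tame_set] z] bracket ..
  also have "\<dots> = - (\<Sum>j\<in>UNIV. Dtot k (\<lambda>w. W w (Base j)) z * Dtot j J z)"
    unfolding lie_minus lie_sum by (simp add: Dtot_eq_lie[OF tame_diffat[OF J z]])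
  finally show ?thesis by simp
qed

text \<open>The matrix is triangular because the transformations preserve fibers: xi involves x
  only, eta no derivatives, zeta1 no q. This keeps the commutators with the derivatives in y, p and
  q short.\<close>

lemma Dtot_W_Base:
  "Dtot 2 (\<lambda>w. W w (Base 1)) = (\<lambda>z. 0)" "Dtot 2 (\<lambda>w. W w (Base 2)) = E 0 1"
  "Dtot 2 (\<lambda>w. W w (Base 3)) = E 1 1" "Dtot 2 (\<lambda>w. W w (Base 4)) = E 2 1"
  "Dtot 3 (\<lambda>w. W w (Base 1)) = (\<lambda>z. 0)" "Dtot 3 (\<lambda>w. W w (Base 2)) = (\<lambda>z. 0)"
  "Dtot 3 (\<lambda>w. W w (Base 3)) = (\<lambda>z. E 0 1 z - X 1 z)" "Dtot 3 (\<lambda>w. W w (Base 4)) = (\<lambda>z. 2 * E 1 1 z - X 2 z)"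
  "Dtot 4 (\<lambda>w. W w (Base 1)) = (\<lambda>z. 0)" "Dtot 4 (\<lambda>w. W w (Base 2)) = (\<lambda>z. 0)"
  "Dtot 4 (\<lambda>w. W w (Base 3)) = (\<lambda>z. 0)" "Dtot 4 (\<lambda>w. W w (Base 4)) = (\<lambda>z. E 0 1 z - 2 * X 1 z)"
  by (simp_all add: W_Base Ybase_eq fun_eq_iff total_simps tame_UNIV_simps One_nat_def[symmetric])

lemma Y_Dtot_numeral:
  assumes "tame U J" "z \<in> U"
  shows "Y (Dtot 2 J) z = Dtot 2 (Y J) z - E 0 1 z * Dtot 2 J z - E 1 1 z * Dtot 3 J z - E 2 1 z * Dtot 4 J z"
    "Y (Dtot 3 J) z = Dtot 3 (Y J) z - (E 0 1 z - X 1 z) * Dtot 3 J z - (2 * E 1 1 z - X 2 z) * Dtot 4 J z"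
    "Y (Dtot 4 J) z = Dtot 4 (Y J) z - (E 0 1 z - 2 * X 1 z) * Dtot 4 J z"
  using Y_Dtot[OF assms, of 2] Y_Dtot[OF assms, of 3] Y_Dtot[OF assms, of 4] by (simp_all add: sum_4 Dtot_W_Base algebra_simps)


lemma has_lie_Y: "diffat J z \<Longrightarrow> Y J z = d \<Longrightarrow> has_lie (W z) J d z"
  by (simp add: has_lie_def Y_def)

lemma Y_eqI: "has_lie (W z) J d z \<Longrightarrow> Y J z = d"
  by (simp add: has_lie_def Y_def)

lemma Y_Base: "Y (\<lambda>z. z (Base k)) z = Ybase \<xi> \<eta> z $ k"
  by (intro Y_eqI has_lie_coord) (simp add: W_Base)

lemma Y_fd_Nil: "Y (fd []) = mu \<xi> \<eta>"
  unfolding fd_def[abs_def] by (intro ext Y_eqI has_lie_coord) (simp add: W_def)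

text \<open>By the definitions of \<open>zeta1\<close>, \<open>zeta2\<close> and \<open>mu\<close>,
  applying \<open>Ddot\<close> to the components xi, eta, zeta1, zeta2 yields the images under
  \<open>Y\<close> of the coefficients 1, p, q, f of \<open>Ddot\<close>, plus \<open>X 1\<close>
  times these coefficients. Everything cancels except the multiple of \<open>Ddot\<close>.\<close>

lemma Y_Ddot:
  assumes J: "tame U J" and z: "z \<in> U"
  shows "Y (Ddot J) z = Ddot (Y J) z - X 1 z * Ddot J z"
proof -
  have t: "diffat (Dtot k J) z" for k by (rule tame_diffat[OF tame_Dtot[OF J] z])
  note D = has_lie_Y[OF t refl]
  have b: "has_lie (W z) (\<lambda>z. z (Base k)) (Ybase \<xi> \<eta> z $ k) z" for k
    by (rule has_lie_coord) (simp add: W_Base)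
  have f: "has_lie (W z) (fd []) (mu \<xi> \<eta> z) z"
    by (rule has_lie_Y) (simp_all add: Y_fd_Nil diffat_UNIV tame_UNIV_simps)
  have "Y (Ddot J) z = Y (Dtot 1 J) z + (Ybase \<xi> \<eta> z $ 3 * Dtot 2 J z + z (Base 3) * Y (Dtot 2 J) z)
      + (Ybase \<xi> \<eta> z $ 4 * Dtot 3 J z + z (Base 4) * Y (Dtot 3 J) z)
      + (mu \<xi> \<eta> z * Dtot 4 J z + fd [] z * Y (Dtot 4 J) z)"
    unfolding Ddot_def[abs_def]
    by (intro Y_eqI has_lie_add[OF _ _ refl] has_lie_mult[OF _ _ refl] D b f)
  moreover define d where "d = (\<lambda>k j. Dtot k (\<lambda>w. W w (Base j)) z)"
  have "d 1 j + z (Base 3) * d 2 j + z (Base 4) * d 3 j + fd [] z * d 4 j = Ddot (\<lambda>w. W w (Base j)) z" for j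
    by (simp add: d_def Ddot_def)
  note this[of 1] this[of 2] this[of 3] this[of 4]
  moreover have "Ddot (\<lambda>w. W w (Base 1)) z = X 1 z"
    "Ddot (\<lambda>w. W w (Base 2)) z = Ybase \<xi> \<eta> z $ 3 + X 1 z * z (Base 3)"
    "Ddot (\<lambda>w. W w (Base 3)) z = Ybase \<xi> \<eta> z $ 4 + X 1 z * z (Base 4)"
    "Ddot (\<lambda>w. W w (Base 4)) z = mu \<xi> \<eta> z + X 1 z * fd [] z"
    by (simp_all add: W_Base Ybase_eq mu_eq total_simps tame_UNIV_simps One_nat_def[symmetric])
  ultimately show ?thesis
    unfolding Y_Dtot[OF J z] Ddot_def sum_4 d_def[symmetric] by algebra
qed

lemma Y_add: "diffat J z \<Longrightarrow> diffat K z \<Longrightarrow> Y (\<lambda>z. J z + K z) z = Y J z + Y K z"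
  by (intro Y_eqI has_lie_add) (auto intro: has_lie_Y)

lemma Y_diff: "diffat J z \<Longrightarrow> diffat K z \<Longrightarrow> Y (\<lambda>z. J z - K z) z = Y J z - Y K z"
  by (intro Y_eqI has_lie_diff) (auto intro: has_lie_Y)

lemma Y_minus: "diffat J z \<Longrightarrow> Y (\<lambda>z. - J z) z = - Y J z"
  by (intro Y_eqI has_lie_minus) (auto intro: has_lie_Y)

lemma Y_mult: "diffat J z \<Longrightarrow> diffat K z \<Longrightarrow> Y (\<lambda>z. J z * K z) z = Y J z * K z + J z * Y K z"
  by (intro Y_eqI has_lie_mult) (auto intro: has_lie_Y)

lemma Y_power: "diffat J z \<Longrightarrow> Y (\<lambda>z. J z ^ n) z = of_nat n * J z ^ (n - 1) * Y J z"
  by (intro Y_eqI has_lie_power) (auto intro: has_lie_Y)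

lemma Y_const: "Y (\<lambda>z. k) z = 0"
  by (intro Y_eqI has_lie_const) simp

lemma Y_divide_const: "diffat J z \<Longrightarrow> Y (\<lambda>z. J z / k) z = Y J z / k"
  using Y_mult[of J z "\<lambda>z. 1 / k"] by (simp add: Y_const diffat_UNIV tame_UNIV_simps)

lemmas Y_simps = Y_add[OF diffat_UNIV diffat_UNIV] Y_diff[OF diffat_UNIV diffat_UNIV] Y_minus[OF diffat_UNIV]
  Y_mult[OF diffat_UNIV diffat_UNIV] Y_power[OF diffat_UNIV] Y_const Y_divide_const[OF diffat_UNIV]

text \<open>The index 1 is left out on purpose: derivatives in x are reached through
  \<open>Y_Ddot\<close>, whose right-hand side is much shorter.\<close>

lemma Y_fd_Cons:
  "Y (fd (2 # ks)) z = Dtot 2 (Y (fd ks)) z - E 0 1 z * fd (2 # ks) z - E 1 1 z * fd (3 # ks) z - E 2 1 z * fd (4 # ks) z"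
  "Y (fd (3 # ks)) z = Dtot 3 (Y (fd ks)) z - (E 0 1 z - X 1 z) * fd (3 # ks) z - (2 * E 1 1 z - X 2 z) * fd (4 # ks) z"
  "Y (fd (4 # ks)) z = Dtot 4 (Y (fd ks)) z - (E 0 1 z - 2 * X 1 z) * fd (4 # ks) z"
  using Y_Dtot_numeral[OF tame_fd[OF tame_set_UNIV] UNIV_I, of ks z] by simp_all

end

section \<open>Action of the generators on the derivatives of f and on the lambdas\<close>

lemmas lam_defs = lam4_def lam5_def lam6_def lam7_def lam8_def lam9_def lam10_def lam11_def lam12_def lam13_def lam14_def lam15_def lam16_def lam17_def lam18_def lam19_def

context fiber_generator
begin

lemma Y_fd_order0:
  "Y (fd []) = (\<lambda>z. E 3 0 z - 3 * X 1 z * fd [] z - 3 * X 2 z * z (Base 4) - X 3 z * z (Base 3))"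
  by (simp add: Y_fd_Nil mu_eq fun_eq_iff)

lemma Y_fd_order1:
  "Y (fd [4]) = (\<lambda>z. 3 * E 1 1 z - X 1 z * fd [4] z - 3 * X 2 z)"
  "Y (fd [3]) = (\<lambda>z. - 2 * E 1 1 z * fd [4] z + 3 * E 2 1 z - 2 * X 1 z * fd [3] z + X 2 z * fd [4] z - X 3 z)"
  "Y (fd [2]) = (\<lambda>z. - E 1 1 z * fd [3] z - E 2 1 z * fd [4] z + E 3 1 z - 3 * X 1 z * fd [2] z)"
  by (simp_all add: fun_eq_iff Y_fd_Cons Y_fd_order0 fd_sort total_simps tame_UNIV_simps algebra_simps)

lemma Y_fd_order2:
  "Y (fd [4,4]) = (\<lambda>z. - E 0 1 z * fd [4,4] z + X 1 z * fd [4,4] z)"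
  "Y (fd [3,4]) = (\<lambda>z. - E 0 1 z * fd [3,4] z + 3 * E 0 2 z - 2 * E 1 1 z * fd [4,4] z + X 2 z * fd [4,4] z)"
  "Y (fd [3,3]) = (\<lambda>z. - E 0 1 z * fd [3,3] z - 2 * E 0 2 z * fd [4] z - 4 * E 1 1 z * fd [3,4] z + 6 * E 1 2 z -
       X 1 z * fd [3,3] z + 2 * X 2 z * fd [3,4] z)"
  "Y (fd [2,4]) = (\<lambda>z. - E 0 1 z * fd [2,4] z - E 1 1 z * fd [3,4] z + 3 * E 1 2 z - E 2 1 z * fd [4,4] z - X 1 z
       * fd [2,4] z)"
  "Y (fd [2,3]) = (\<lambda>z. - E 0 1 z * fd [2,3] z - 2 * E 1 1 z * fd [2,4] z - E 1 1 z * fd [3,3] z - 2 * E 1 2 z * fd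
       [4] z - E 2 1 z * fd [3,4] z + 3 * E 2 2 z - 2 * X 1 z * fd [2,3] z + X 2 z * fd [2,4] z)"
  "Y (fd [2,2]) = (\<lambda>z. - E 0 1 z * fd [2,2] z + E 0 2 z * fd [2] z - 2 * E 1 1 z * fd [2,3] z - E 1 2 z * fd [3] z
       - 2 * E 2 1 z * fd [2,4] z - E 2 2 z * fd [4] z + E 3 2 z - 3 * X 1 z * fd [2,2] z)"
  by (simp_all add: fun_eq_iff Y_fd_Cons Y_fd_order1 fd_sort total_simps tame_UNIV_simps algebra_simps)

lemma Y_fd_order3:
  "Y (fd [4,4,4]) = (\<lambda>z. - 2 * E 0 1 z * fd [4,4,4] z + 3 * X 1 z * fd [4,4,4] z)"
  "Y (fd [3,4,4]) = (\<lambda>z. - 2 * E 0 1 z * fd [3,4,4] z - 2 * E 1 1 z * fd [4,4,4] z + 2 * X 1 z * fd [3,4,4] z + X 2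
       z * fd [4,4,4] z)"
  "Y (fd [3,3,4]) = (\<lambda>z. - 2 * E 0 1 z * fd [3,3,4] z - 2 * E 0 2 z * fd [4,4] z - 4 * E 1 1 z * fd [3,4,4] z + X 1
       z * fd [3,3,4] z + 2 * X 2 z * fd [3,4,4] z)"
  "Y (fd [3,3,3]) = (\<lambda>z. - 2 * E 0 1 z * fd [3,3,3] z - 6 * E 0 2 z * fd [3,4] z + 6 * E 0 3 z - 6 * E 1 1 z * fd
       [3,3,4] z + 3 * X 2 z * fd [3,3,4] z)"
  "Y (fd [2,4,4]) = (\<lambda>z. - 2 * E 0 1 z * fd [2,4,4] z - E 0 2 z * fd [4,4] z - E 1 1 z * fd [3,4,4] z - E 2 1 z * fd
       [4,4,4] z + X 1 z * fd [2,4,4] z)"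
  "Y (fd [2,3,4]) = (\<lambda>z. - 2 * E 0 1 z * fd [2,3,4] z - E 0 2 z * fd [3,4] z + 3 * E 0 3 z - 2 * E 1 1 z * fd
       [2,4,4] z - E 1 1 z * fd [3,3,4] z - 2 * E 1 2 z * fd [4,4] z - E 2 1 z * fd [3,4,4] z + X 2
       z * fd [2,4,4] z)"
  "Y (fd [2,3,3]) = (\<lambda>z. - 2 * E 0 1 z * fd [2,3,3] z - 2 * E 0 2 z * fd [2,4] z - E 0 2 z * fd [3,3] z - 2 * E 0 3
       z * fd [4] z - 4 * E 1 1 z * fd [2,3,4] z - E 1 1 z * fd [3,3,3] z - 4 * E 1 2 z * fd [3,4]
       z + 6 * E 1 3 z - E 2 1 z * fd [3,3,4] z - X 1 z * fd [2,3,3] z + 2 * X 2 z * fd [2,3,4] z)"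
  "Y (fd [2,2,4]) = (\<lambda>z. - 2 * E 0 1 z * fd [2,2,4] z - E 0 2 z * fd [2,4] z - 2 * E 1 1 z * fd [2,3,4] z - E 1 2 z
       * fd [3,4] z + 3 * E 1 3 z - 2 * E 2 1 z * fd [2,4,4] z - E 2 2 z * fd [4,4] z - X 1 z * fd
       [2,2,4] z)"
  "Y (fd [2,2,3]) = (\<lambda>z. - 2 * E 0 1 z * fd [2,2,3] z - E 0 2 z * fd [2,3] z - 2 * E 1 1 z * fd [2,2,4] z - 2 * E 1
       1 z * fd [2,3,3] z - 4 * E 1 2 z * fd [2,4] z - E 1 2 z * fd [3,3] z - 2 * E 1 3 z * fd [4]
       z - 2 * E 2 1 z * fd [2,3,4] z - E 2 2 z * fd [3,4] z + 3 * E 2 3 z - 2 * X 1 z * fd [2,2,3]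
       z + X 2 z * fd [2,2,4] z)"
  "Y (fd [2,2,2]) = (\<lambda>z. - 2 * E 0 1 z * fd [2,2,2] z + 2 * E 0 3 z * fd [2] z - 3 * E 1 1 z * fd [2,2,3] z - 3 * E
       1 2 z * fd [2,3] z - E 1 3 z * fd [3] z - 3 * E 2 1 z * fd [2,2,4] z - 3 * E 2 2 z * fd
       [2,4] z - E 2 3 z * fd [4] z + E 3 3 z - 3 * X 1 z * fd [2,2,2] z)"
  by (simp_all add: fun_eq_iff Y_fd_Cons Y_fd_order2 fd_sort total_simps tame_UNIV_simps algebra_simps)

lemma Y_Ddot_fd4: "Y (Ddot (fd [4])) = (\<lambda>z. 3 * E 2 1 z - 2 * X 1 z * Ddot (fd [4]) z - X 2 z * fd [4] z - 3 * X 3 z)"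
  by (simp add: fun_eq_iff Y_Ddot[OF _ UNIV_I] Y_fd_order1 total_simps tame_UNIV_simps algebra_simps)

lemmas Y_fd = Y_fd_order0 Y_fd_order1 Y_fd_order2 Y_fd_order3 Y_Ddot_fd4

lemmas Y_lam_simps = Y_simps Y_fd Y_Ddot[OF _ UNIV_I] total_simps tame_UNIV_simps field_simps power2_eq_square power3_eq_cube

text \<open>The lambdas are combinations in which every parameter \<open>E i j\<close> except
  \<open>E 0 1\<close> cancels. What survives here and below is the action of the parameters X 1 to
  X 4 and E 0 1 alone.\<close>

lemma Y_lam4: "Y lam4 z = - E 0 1 z * lam4 z + X 1 z * lam4 z"
  unfolding lam_defs[abs_def] Let_def
  by (simp add: Y_lam_simps)

lemma Y_lam5: "Y lam5 z = - E 0 1 z * lam5 z - X 1 z * lam5 z + 2 / 3 * X 3 z * lam4 z"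
  unfolding lam_defs[abs_def] Let_def
  by (simp add: Y_lam_simps)

lemma Y_lam6: "Y lam6 z = - 2 * E 0 1 z * lam6 z + 3 * X 1 z * lam6 z"
  unfolding lam_defs[abs_def] Let_def
  by (simp add: Y_lam_simps)

lemma Y_lam7: "Y lam7 z = - 2 * E 0 1 z * lam7 z + 2 * X 1 z * lam7 z - X 2 z * lam6 z"
  unfolding lam_defs[abs_def] Let_def
  by (simp add: Y_lam_simps)

lemma Y_lam8: "Y lam8 z = - 2 * E 0 1 z * lam8 z + X 1 z * lam8 z - 2 / 3 * X 2 z * lam4 z^2 - 2 * X 2 z * lam7 z"
  unfolding lam_defs[abs_def] Let_def
  by (simp add: Y_lam_simps)

lemma Y_lam9: "Y lam9 z = - 2 * E 0 1 z * lam9 z + X 1 z * lam9 z - 1 / 3 * X 2 z * lam4 z^2 - X 2 z * lam7 z - 1 / 3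
       * X 3 z * lam6 z"
  unfolding lam_defs[abs_def] Let_def
  by (simp add: Y_lam_simps)

lemma Y_lam10: "Y lam10 z = - 2 * E 0 1 z * lam10 z + 1 / 2 * X 2 z * lam8 z - X 2 z * lam9 z - 2 / 9 * X 3 z * lam4
       z^2 - 1 / 3 * X 3 z * lam7 z"
  unfolding lam_defs[abs_def] Let_def
  by (simp add: Y_lam_simps)

lemma Y_lam11: "Y lam11 z = - 2 * E 0 1 z * lam11 z - X 1 z * lam11 z + 2 * X 2 z * lam10 z + 1 / 3 * X 2 z * lam4 z *
       lam5 z - 1 / 3 * X 3 z * lam8 z + 4 / 3 * X 3 z * lam9 z"
  unfolding lam_defs[abs_def] Let_def
  by (simp add: Y_lam_simps)

lemma Y_lam12: "Y lam12 z = - 2 * X 1 z * lam12 z - 2 * X 3 z"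
  unfolding lam_defs[abs_def] Let_def
  by (simp add: Y_lam_simps)

lemma Y_lam13: "Y lam13 z = - 3 * X 1 z * lam13 z - X 2 z * lam12 z - X 4 z"
  unfolding lam_defs[abs_def] Let_def
  by (simp add: Y_lam_simps)

lemma Y_lam14: "Y lam14 z = - E 0 1 z * lam14 z"
  unfolding lam_defs[abs_def] Let_def
  by (simp add: Y_lam_simps)

lemma Y_lam15: "Y lam15 z = - E 0 1 z * lam15 z - X 1 z * lam15 z - X 2 z * lam14 z + 2 / 3 * X 3 z * lam4 z"
  unfolding lam_defs[abs_def] Let_def
  by (simp add: Y_lam_simps)

lemma Y_lam16: "Y lam16 z = - E 0 1 z * lam16 z - 2 * X 1 z * lam16 z - 2 / 3 * X 2 z * lam4 z * lam12 z - 2 * X 2 z *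
       lam15 z"
  unfolding lam_defs[abs_def] Let_def
  by (simp add: Y_lam_simps)

lemma Y_lam17: "Y lam17 z = - E 0 1 z * lam17 z - 2 * X 1 z * lam17 z - X 2 z * lam15 z + X 2 z * lam5 z - 1 / 3 * X 3
       z * lam14 z"
  unfolding lam_defs[abs_def] Let_def
  by (simp add: Y_lam_simps)

lemma Y_lam18: "Y lam18 z = - E 0 1 z * lam18 z - 3 * X 1 z * lam18 z - X 2 z * lam16 z - X 2 z * lam17 z - 2 / 9 * X 3
       z * lam4 z * lam12 z - 1 / 3 * X 3 z * lam15 z - 1 / 3 * X 3 z * lam5 z"
  unfolding lam_defs[abs_def] Let_def
  by (simp add: Y_lam_simps)

lemma Y_lam19: "Y lam19 z = - 3 * X 1 z * lam19 z - 3 * X 2 z * lam12 z - 3 * X 4 z"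
  unfolding lam_defs[abs_def] Let_def
  by (simp add: Y_lam_simps)


end

section \<open>Weights of the gammas and invariance of the betas\<close>

lemmas lie_intros = has_lie_const[OF refl] has_lie_add[OF _ _ refl] has_lie_diff[OF _ _ refl] has_lie_minus[OF _ refl]
  has_lie_mult[OF _ _ refl] has_lie_power[OF _ refl]

text \<open>Splitting off a denominator of known weight leaves a polynomial identity for the
  numerator, so no fractions occur in the large computations.\<close>

lemma has_lie_weight_divide:
  assumes "has_lie v J dJ z" "has_lie v K dK z" "K z \<noteq> 0" "dK = k * K z" "dJ = (m + k) * J z"
  shows "has_lie v (\<lambda>z. J z / K z) (m * (J z / K z)) z"
proof -
  have "(dJ * K z - J z * dK) / (K z * K z) = m * (J z / K z)"
    using assms(3-5) by (simp add: field_simps)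
  with has_lie_divide[OF assms(1-3) refl] show ?thesis by simp
qed

lemma has_lie_eq_rhs: "has_lie v J d z \<Longrightarrow> d = e \<Longrightarrow> has_lie v J e z"
  by simp

lemma tame_lam: "tame UNIV lam4" "tame UNIV lam5" "tame UNIV lam6" "tame UNIV lam7" "tame UNIV lam8" "tame UNIV lam9"
  "tame UNIV lam10" "tame UNIV lam11" "tame UNIV lam12" "tame UNIV lam13" "tame UNIV lam14" "tame UNIV lam15"
  "tame UNIV lam16" "tame UNIV lam17" "tame UNIV lam18" "tame UNIV lam19"
  unfolding lam_defs[abs_def] Let_def by (intro tame_intros tame_set_UNIV; simp)+

lemma Omega_lam: "z \<in> Omega \<Longrightarrow> lam4 z \<noteq> 0" "z \<in> Omega \<Longrightarrow> lam6 z \<noteq> 0"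
  by (simp_all add: Omega_def lam4_def lam6_def)

context fiber_generator
begin

lemmas Y_lam = Y_lam4 Y_lam5 Y_lam6 Y_lam7 Y_lam8 Y_lam9 Y_lam10 Y_lam11 Y_lam12 Y_lam13 Y_lam14
  Y_lam15 Y_lam16 Y_lam17 Y_lam18 Y_lam19

lemmas has_lie_lam = tame_lam[THEN diffat_UNIV, THEN has_lie_Y[OF _ refl]]

text \<open>The multipliers of the relative invariants are integer combinations of the infinitesimal
  scalings xi' and eta_y, and such a weight is additive under products.\<close>

definition wt :: "int \<Rightarrow> int \<Rightarrow> jet \<Rightarrow> real" where
  "wt i j z = of_int i * X 1 z + of_int j * E 0 1 z"

lemma has_lie_gam:
  assumes "z \<in> Omega"
  shows "has_lie (W z) gam4 (wt 1 (-1) z * gam4 z) z" "has_lie (W z) gam5 (wt 3 (-2) z * gam5 z) z"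
    "has_lie (W z) gam6 (wt 1 (-2) z * gam6 z) z"
    "has_lie (W z) gam7 (wt 1 (-2) z * gam7 z) z"
    "has_lie (W z) gam8 (wt 0 (-2) z * gam8 z) z"
    "has_lie (W z) gam9 (wt (-1) (-2) z * gam9 z) z"
    "has_lie (W z) gam10 (wt (-2) 0 z * gam10 z) z"
    "has_lie (W z) gam11 (wt 0 (-1) z * gam11 z) z"
    "has_lie (W z) gam12 (wt (-1) (-1) z * gam12 z) z"
    "has_lie (W z) gam13 (wt (-2) (-1) z * gam13 z) z"
    "has_lie (W z) gam14 (wt (-2) (-1) z * gam14 z) z"
    "has_lie (W z) gam15 (wt (-3) (-1) z * gam15 z) z"
    "has_lie (W z) gam16 (wt (-3) 0 z * gam16 z) z"
proof -
  note nz = Omega_lam[OF assms]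
  show "has_lie (W z) gam4 (wt 1 (-1) z * gam4 z) z"
    unfolding gam4_def[abs_def]
    by (rule has_lie_eq_rhs, (rule lie_intros has_lie_lam)+) (simp add: Y_lam wt_def algebra_simps)
  show "has_lie (W z) gam5 (wt 3 (-2) z * gam5 z) z"
    unfolding gam5_def[abs_def]
    by (rule has_lie_eq_rhs, (rule lie_intros has_lie_lam)+) (simp add: Y_lam wt_def algebra_simps)
  show "has_lie (W z) gam6 (wt 1 (-2) z * gam6 z) z"
    unfolding gam6_def[abs_def] Let_def
    \<comment> \<open>Here and below \<open>k\<close> is the weight of the denominator, in which
      each factor \<open>lam6\<close> counts \<open>wt 3 (-2)\<close> and each factor
      \<open>lam4\<close> counts \<open>wt 1 (-1)\<close>.\<close>
    by (rule has_lie_weight_divide[where k = "wt 3 (-2) z"], (rule lie_intros has_lie_lam)+)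
      (use nz in simp, simp_all add: Y_lam wt_def algebra_simps power2_eq_square power3_eq_cube)
  show "has_lie (W z) gam7 (wt 1 (-2) z * gam7 z) z"
    unfolding gam7_def[abs_def] Let_def
    by (rule has_lie_weight_divide[where k = "wt 4 (-3) z"], (rule lie_intros has_lie_lam)+)
      (use nz in simp, simp_all add: Y_lam wt_def algebra_simps power2_eq_square power3_eq_cube)
  show "has_lie (W z) gam8 (wt 0 (-2) z * gam8 z) z"
    unfolding gam8_def[abs_def] Let_def
    by (rule has_lie_weight_divide[where k = "wt 3 (-2) z"], (rule lie_intros has_lie_lam)+)
      (use nz in simp, simp_all add: Y_lam wt_def algebra_simps power2_eq_square power3_eq_cube)
  show "has_lie (W z) gam9 (wt (-1) (-2) z * gam9 z) z"
    unfolding gam9_def[abs_def] Let_def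
    by (rule has_lie_weight_divide[where k = "wt 8 (-6) z"], (rule lie_intros has_lie_lam)+)
      (use nz in simp, simp_all add: Y_lam wt_def algebra_simps power2_eq_square power3_eq_cube)
  show "has_lie (W z) gam10 (wt (-2) 0 z * gam10 z) z"
    unfolding gam10_def[abs_def] Let_def
    by (rule has_lie_weight_divide[where k = "wt 1 (-1) z"], (rule lie_intros has_lie_lam)+)
      (use nz in simp, simp_all add: Y_lam wt_def algebra_simps power2_eq_square power3_eq_cube)
  show "has_lie (W z) gam11 (wt 0 (-1) z * gam11 z) z"
    unfolding gam11_def[abs_def]
    by (rule has_lie_eq_rhs, (rule lie_intros has_lie_lam)+) (simp add: Y_lam wt_def algebra_simps)
  show "has_lie (W z) gam12 (wt (-1) (-1) z * gam12 z) z"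
    unfolding gam12_def[abs_def] Let_def
    by (rule has_lie_weight_divide[where k = "wt 3 (-2) z"], (rule lie_intros has_lie_lam)+)
      (use nz in simp, simp_all add: Y_lam wt_def algebra_simps power2_eq_square power3_eq_cube)
  show "has_lie (W z) gam13 (wt (-2) (-1) z * gam13 z) z"
    unfolding gam13_def[abs_def] Let_def
    by (rule has_lie_weight_divide[where k = "wt 6 (-4) z"], (rule lie_intros has_lie_lam)+)
      (use nz in simp, simp_all add: Y_lam wt_def algebra_simps power2_eq_square power3_eq_cube)
  show "has_lie (W z) gam14 (wt (-2) (-1) z * gam14 z) z"
    unfolding gam14_def[abs_def] Let_def
    by (rule has_lie_weight_divide[where k = "wt 7 (-5) z"], (rule lie_intros has_lie_lam)+)
      (use nz in simp, simp_all add: Y_lam wt_def algebra_simps power2_eq_square power3_eq_cube)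
  show "has_lie (W z) gam15 (wt (-3) (-1) z * gam15 z) z"
    unfolding gam15_def[abs_def] Let_def
    by (rule has_lie_weight_divide[where k = "wt 10 (-7) z"], (rule lie_intros has_lie_lam)+)
      (use nz in simp, simp_all add: Y_lam wt_def algebra_simps power2_eq_square power3_eq_cube)
  show "has_lie (W z) gam16 (wt (-3) 0 z * gam16 z) z"
    unfolding gam16_def[abs_def]
    by (rule has_lie_eq_rhs, (rule lie_intros has_lie_lam)+) (simp add: Y_lam wt_def algebra_simps)
qed

end

lemma tame_set_Omega: "tame_set Omega"
  unfolding tame_set_def tame_def
proof (intro conjI exI)
  have op: "open {z :: jet. z c \<noteq> 0}" for c
    by (intro open_Collect_neq continuous_on_product_coordinates continuous_on_const)
  have eq: "Omega = {z. z (Der (mset [4,4])) \<noteq> 0} \<inter> {z. z (Der (mset [4,4,4])) \<noteq> 0}"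
    by (auto simp: Omega_def fd_def)
  show "smooth_on Omega (\<lambda>z. 0)" unfolding eq by (intro smooth_on_const open_Int op)
  show "finite {Der (mset [4,4]), Der (mset [4,4,4])}" by simp
  show "dep {Der (mset [4,4]), Der (mset [4,4,4])} Omega (\<lambda>z. 0)"
    by (rule depI) (simp add: Omega_def fd_def)
qed

lemma lam_agree:
  assumes "\<And>c. jet_order c \<le> 3 \<Longrightarrow> z' c = z c"
  shows "lam4 z' = lam4 z" "lam5 z' = lam5 z" "lam6 z' = lam6 z" "lam7 z' = lam7 z" "lam8 z' = lam8 z"
    "lam9 z' = lam9 z" "lam10 z' = lam10 z" "lam11 z' = lam11 z" "lam12 z' = lam12 z" "lam13 z' = lam13 z"
    "lam14 z' = lam14 z" "lam15 z' = lam15 z" "lam16 z' = lam16 z" "lam17 z' = lam17 z" "lam18 z' = lam18 z"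
    "lam19 z' = lam19 z"
proof -
  have fd: "fd ks z' = fd ks z" if "length ks \<le> 3" for ks
    unfolding fd_def using that by (intro assms) simp
  have B: "z' (Base k) = z (Base k)" for k by (intro assms) simp
  have D: "Ddot (fd ks) z' = Ddot (fd ks) z" if "length ks \<le> 2" for ks
    using that by (simp add: Ddot_def fd B)
  \<comment> \<open>\<open>Dtot\<close> is defined by partial derivatives, which agreement of two
    jets does not control directly. Moving it inside \<open>Ddot\<close> leaves derivatives of f of
    order at most 3.\<close>
  have D1: "Dtot k (Ddot (fd [4])) z' = Dtot k (Ddot (fd [4])) z" for k
    by (simp add: Dtot_Ddot[OF tame_fd[OF tame_set_UNIV] UNIV_I] D fd)
  have DD: "Ddot (Ddot (fd [4])) z' = Ddot (Ddot (fd [4])) z"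
    using D1 by (simp add: Ddot_def[of "Ddot (fd [4])"] fd B)
  show "lam4 z' = lam4 z" "lam5 z' = lam5 z" "lam6 z' = lam6 z" "lam7 z' = lam7 z" "lam8 z' = lam8 z"
    "lam9 z' = lam9 z" "lam10 z' = lam10 z" "lam11 z' = lam11 z" "lam12 z' = lam12 z" "lam13 z' = lam13 z"
    "lam14 z' = lam14 z" "lam15 z' = lam15 z" "lam16 z' = lam16 z" "lam17 z' = lam17 z" "lam18 z' = lam18 z"
    "lam19 z' = lam19 z"
    by (simp_all add: lam_defs Let_def fd D DD)
qed

lemmas gam_defs = gam4_def gam5_def gam6_def gam7_def gam8_def gam9_def gam10_def gam11_def gam12_def
  gam13_def gam14_def gam15_def gam16_def

lemmas bet_defs = bet1_def bet2_def bet3_def bet4_def bet5_def bet6_def bet7_def bet8_def bet9_def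
  bet10_def bet11_def

lemma order_le_Omega:
  assumes "\<And>z z'. (\<And>c. jet_order c \<le> 3 \<Longrightarrow> z' c = z c) \<Longrightarrow> J z' = J z"
  shows "order_le 3 Omega J"
  unfolding order_le_def
proof (intro ballI allI impI)
  fix z z' :: jet assume z: "z \<in> Omega" "\<forall>c. jet_order c \<le> 3 \<longrightarrow> z' c = z c"
  then have "fd ks z' = fd ks z" if "length ks \<le> 3" for ks unfolding fd_def using that by simp
  with z show "z' \<in> Omega \<and> J z' = J z" using assms[of z' z] by (simp add: Omega_def)
qed

lemma tame_Omega: "tame UNIV J \<Longrightarrow> tame Omega J"
  by (rule tame_restrict[OF _ tame_set_Omega]) auto

lemmas tame_Omega_lam = tame_lam[THEN tame_Omega]

lemma gam_order_le: "\<gamma> \<in> set gammas \<Longrightarrow> order_le 3 Omega \<gamma>"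
proof (rule order_le_Omega)
  fix z z' :: jet assume "\<gamma> \<in> set gammas" and *: "\<And>c. jet_order c \<le> 3 \<Longrightarrow> z' c = z c"
  then show "\<gamma> z' = \<gamma> z" unfolding gammas_def by (auto simp: gam_defs lam_agree[OF *])
qed

lemma gam_tame: "\<gamma> \<in> set gammas \<Longrightarrow> tame Omega \<gamma>"
proof -
  have nz: "lam4 z \<noteq> 0" "lam6 z \<noteq> 0" if "z \<in> Omega" for z by (rule Omega_lam[OF that])+
  have t: "tame Omega gam4" "tame Omega gam5" "tame Omega gam6" "tame Omega gam7" "tame Omega gam8" "tame Omega gam9" "tame Omega gam10"
    "tame Omega gam11" "tame Omega gam12" "tame Omega gam13" "tame Omega gam14" "tame Omega gam15" "tame Omega gam16"
    unfolding gam_defs[abs_def] Let_def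
    by (intro tame_intros tame_Omega_lam tame_set_Omega; simp add: nz)+
  show "\<gamma> \<in> set gammas \<Longrightarrow> tame Omega \<gamma>" by (auto simp: gammas_def t)
qed

lemma bet_order_le: "\<beta> \<in> set betas \<Longrightarrow> order_le 3 Omega \<beta>"
proof (rule order_le_Omega)
  fix z z' :: jet assume "\<beta> \<in> set betas" and *: "\<And>c. jet_order c \<le> 3 \<Longrightarrow> z' c = z c"
  then show "\<beta> z' = \<beta> z" unfolding betas_def by (auto simp: bet_defs gam_defs lam_agree[OF *])
qed

lemma bet_tame: "\<beta> \<in> set betas \<Longrightarrow> tame Omega \<beta>"
proof -
  have g: "tame Omega gam4" "tame Omega gam5" "tame Omega gam6" "tame Omega gam7" "tame Omega gam8" "tame Omega gam9"
    "tame Omega gam10" "tame Omega gam11" "tame Omega gam12" "tame Omega gam13" "tame Omega gam14" "tame Omega gam15"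
    "tame Omega gam16" by (rule gam_tame; simp add: gammas_def)+
  have "gam4 z \<noteq> 0" if "z \<in> Omega" for z using Omega_lam(1)[OF that] by (simp add: gam4_def)
  then have d: "tame Omega (\<lambda>z. J z / gam4 z ^ n)" if "tame Omega J" for J n
    using that g(1) by (intro tame_divide tame_power) auto
  show "\<beta> \<in> set betas \<Longrightarrow> tame Omega \<beta>"
    unfolding betas_def bet_defs[abs_def] by (auto intro!: d tame_mult tame_power g)
qed

lemma has_lie_weight_mult:
  "has_lie v J (m * J z) z \<Longrightarrow> has_lie v K (k * K z) z \<Longrightarrow> has_lie v (\<lambda>z. J z * K z) ((m + k) * (J z * K z)) z"
  by (erule (1) has_lie_mult) (simp only: ring_distribs mult_ac)

lemma has_lie_weight_power:
  "has_lie v J (m * J z) z \<Longrightarrow> has_lie v (\<lambda>z. J z ^ n) (of_nat n * m * J z ^ n) z"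
  by (erule has_lie_power) (cases n; simp)

lemma has_lie_weight_quotient:
  "has_lie v J (m * J z) z \<Longrightarrow> has_lie v K (m * K z) z \<Longrightarrow> K z \<noteq> 0 \<Longrightarrow> has_lie v (\<lambda>z. J z / K z) 0 z"
  by (erule (2) has_lie_divide) simp

context fiber_generator
begin

text \<open>The power of \<open>gam5\<close> balances the two components of the weight: every
  numerator has \<open>n\<close> times the weight of \<open>gam4\<close>, where \<open>n\<close> is
  the exponent of \<open>gam4\<close> in the denominator.\<close>

lemma Y_bet:
  assumes z: "z \<in> Omega" and "\<beta> \<in> set betas" shows "Y \<beta> z = 0"
proof -
  have nz: "gam4 z \<noteq> 0" using Omega_lam(1)[OF z] by (simp add: gam4_def)
  have q: "Y (\<lambda>z. J z / gam4 z ^ n) z = 0"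
    if "has_lie (W z) J (m * J z) z" "m = of_nat n * wt 1 (-1) z" for J n m
    by (rule Y_eqI, rule has_lie_weight_quotient[OF that(1)])
      (use has_lie_weight_power[OF has_lie_gam(1)[OF z], of n] that(2) nz in simp_all)
  note g = has_lie_gam[OF z]
  note p = has_lie_weight_power[OF g(2)]
  have b1: "Y bet1 z = 0" unfolding bet1_def[abs_def]
    by (rule q[OF has_lie_weight_mult[OF g(3) g(2)]]) (simp add: wt_def algebra_simps)
  have b2: "Y bet2 z = 0" unfolding bet2_def[abs_def]
    by (rule q[OF has_lie_weight_mult[OF g(4) g(2)]]) (simp add: wt_def algebra_simps)
  have b3: "Y bet3 z = 0" unfolding bet3_def[abs_def]
    by (rule q[OF has_lie_weight_mult[OF g(5) p]]) (simp add: wt_def algebra_simps)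
  have b4: "Y bet4 z = 0" unfolding bet4_def[abs_def]
    by (rule q[OF has_lie_weight_mult[OF g(6) p]]) (simp add: wt_def algebra_simps)
  have b5: "Y bet5 z = 0" unfolding bet5_def[abs_def]
    by (rule q[OF has_lie_weight_mult[OF p g(7)]]) (simp add: wt_def algebra_simps)
  have b6: "Y bet6 z = 0" unfolding bet6_def[abs_def]
    by (rule q[OF has_lie_weight_mult[OF g(2) g(8)]]) (simp add: wt_def algebra_simps)
  have b7: "Y bet7 z = 0" unfolding bet7_def[abs_def]
    by (rule q[OF has_lie_weight_mult[OF g(9) p]]) (simp add: wt_def algebra_simps)
  have b8: "Y bet8 z = 0" unfolding bet8_def[abs_def]
    by (rule q[OF has_lie_weight_mult[OF g(10) p]]) (simp add: wt_def algebra_simps)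
  have b9: "Y bet9 z = 0" unfolding bet9_def[abs_def]
    by (rule q[OF has_lie_weight_mult[OF g(11) p]]) (simp add: wt_def algebra_simps)
  have b10: "Y bet10 z = 0" unfolding bet10_def[abs_def]
    by (rule q[OF has_lie_weight_mult[OF g(12) p]]) (simp add: wt_def algebra_simps)
  have b11: "Y bet11 z = 0" unfolding bet11_def[abs_def]
    by (rule q[OF has_lie_weight_mult[OF g(13) p]]) (simp add: wt_def algebra_simps)
  show ?thesis using assms(2) by (auto simp: betas_def b1 b2 b3 b4 b5 b6 b7 b8 b9 b10 b11)
qed

text \<open>The multiplier of a relative invariant has to be of order at most 3 itself; xi' and
  eta_y involve only x and y.\<close>

lemma dep_X1_E01: "dep {Base 1, Base 2} UNIV (X 1)" "dep {Base 1, Base 2} UNIV (E 0 1)"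
proof -
  show "dep {Base 1, Base 2} UNIV (X 1)"
    using dep_mono[OF dep_pd[OF open_UNIV xi_eta_dep(1)], of "{Base 1, Base 2}" "Base 1"] by (simp add: pd_xi)
  have "pd (Der \<alpha>) \<eta> z = 0" for \<alpha> z by (rule dep_pd_zero[OF xi_eta_dep(2)]) auto
  then have "E 0 1 = pd (Base 2) \<eta>" by (simp add: E_def One_nat_def Dtot_def fun_eq_iff)
  then show "dep {Base 1, Base 2} UNIV (E 0 1)" using dep_pd[OF open_UNIV xi_eta_dep(2)] by simp
qed

lemma wt_smooth: "smooth_on Omega (wt i j)"
  unfolding wt_def[abs_def]
  by (intro tame_smooth tame_Omega tame_add tame_mult tame_const tame_X tame_E tame_set_UNIV)

lemma wt_order_le: "order_le 3 Omega (wt i j)"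
proof (rule order_le_Omega)
  fix z z' :: jet assume *: "\<And>c. jet_order c \<le> 3 \<Longrightarrow> z' c = z c"
  have "X 1 z' = X 1 z" "E 0 1 z' = E 0 1 z"
    by (rule depD(2)[OF dep_X1_E01(1) UNIV_I], use * in force, rule depD(2)[OF dep_X1_E01(2) UNIV_I], use * in force)
  then show "wt i j z' = wt i j z" by (simp add: wt_def)
qed

lemma gam_weight:
  assumes "\<gamma> \<in> set gammas" shows "\<exists>i j. \<forall>z\<in>Omega. Y \<gamma> z = wt i j z * \<gamma> z"
  using assms has_lie_gam[THEN has_lieD] unfolding gammas_def Y_def by (auto; blast)

end

lemma gam_relative_invariant:
  assumes "\<gamma> \<in> set gammas" shows "relative_invariant 3 Omega \<gamma>"
  unfolding relative_invariant_def
proof (intro conjI allI impI)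
  show "smooth_on Omega \<gamma>" "order_le 3 Omega \<gamma>"
    using gam_tame[OF assms] gam_order_le[OF assms] by (simp_all add: tame_smooth)
  fix \<xi> \<eta> assume "generator \<xi> \<eta>"
  then interpret fiber_generator \<xi> \<eta> by unfold_locales
  obtain i j where "\<forall>z\<in>Omega. Y \<gamma> z = wt i j z * \<gamma> z" using gam_weight[OF assms] by blast
  then show "\<exists>m. smooth_on Omega m \<and> order_le 3 Omega m \<and> (\<forall>z\<in>Omega. Yprol 3 \<xi> \<eta> \<gamma> z = m z * \<gamma> z)"
    using wt_smooth wt_order_le Yprol_eq[OF gam_tame[OF assms] gam_order_le[OF assms]]
    by (intro exI[of _ "wt i j"]) simp
qed

lemma bet_differential_invariant:
  assumes "\<beta> \<in> set betas" shows "differential_invariant 3 Omega \<beta>"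
  unfolding differential_invariant_def
proof (intro conjI allI impI ballI)
  show "smooth_on Omega \<beta>" "order_le 3 Omega \<beta>"
    using bet_tame[OF assms] bet_order_le[OF assms] by (simp_all add: tame_smooth)
  fix \<xi> \<eta> z assume "generator \<xi> \<eta>" and z: "z \<in> Omega"
  then interpret fiber_generator \<xi> \<eta> by unfold_locales simp
  show "Yprol 3 \<xi> \<eta> \<beta> z = 0"
    using Yprol_eq[OF bet_tame[OF assms] bet_order_le[OF assms] z] Y_bet[OF z assms] by simp
qed

subsection \<open>Invariant differentiation\<close>

lemma op_component:
  "op1 z $ 1 = 0" "op1 z $ 2 = 0" "op1 z $ 3 = 0" "op1 z $ 4 = fd [4,4] z / fd [4,4,4] z"
  "op2 z $ 1 = 0" "op2 z $ 2 = 0"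
  "op2 z $ 3 = fd [4,4,4] z / (fd [4,4] z * fd [4,4,4] z)" "op2 z $ 4 = - fd [3,4,4] z / (fd [4,4] z * fd [4,4,4] z)"
  "op3 z $ 1 = 0" "op3 z $ 2 = 6 * fd [4,4] z * fd [4,4,4] z ^ 2 / (fd [4,4] z ^ 4 * fd [4,4,4] z)"
  "op3 z $ 3 = - (2 * fd [4,4] z * fd [4,4,4] z * (fd [4] z * fd [4,4,4] z + 3 * fd [3,4,4] z))
    / (fd [4,4] z ^ 4 * fd [4,4,4] z)"
  "op3 z $ 4 = (3 * fd [4,4] z * fd [3,4,4] z ^ 2 + fd [4,4,4] z ^ 2 * (3 * fd [3,3] z + 2 * fd [3,4] z * fd [4] z
    - 6 * fd [2,4] z)) / (fd [4,4] z ^ 4 * fd [4,4,4] z)"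
  "op4 z $ 1 = fd [4,4,4] z / fd [4,4] z ^ 2" "op4 z $ 2 = fd [4,4,4] z * z (Base 3) / fd [4,4] z ^ 2"
  "op4 z $ 3 = fd [4,4,4] z * z (Base 4) / fd [4,4] z ^ 2" "op4 z $ 4 = fd [4,4,4] z * fd [] z / fd [4,4] z ^ 2"
  by (simp_all add: op1_def op2_def op3_def op4_def Let_def vector_4)

abbreviation (input) ops :: "(jet \<Rightarrow> real^4) set" where "ops \<equiv> {op1, op2, op3, op4}"

lemma op_tame: "K \<in> ops \<Longrightarrow> tame Omega (\<lambda>z. K z $ k)"
proof -
  have nz: "fd [4,4] z \<noteq> 0" "fd [4,4,4] z \<noteq> 0" if "z \<in> Omega" for z using that by (simp_all add: Omega_def)
  have "K \<in> ops \<Longrightarrow> tame Omega (\<lambda>z. K z $ 1) \<and> tame Omega (\<lambda>z. K z $ 2) \<and> tame Omega (\<lambda>z. K z $ 3) \<and> tame Omega (\<lambda>z. K z $ 4)"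
    by (elim insertE emptyE; simp only: op_component; intro conjI tame_intros tame_set_Omega; simp add: nz)
  then show "K \<in> ops \<Longrightarrow> tame Omega (\<lambda>z. K z $ k)" using exhaust_4[of k] by auto
qed

lemma op_order_le: "K \<in> ops \<Longrightarrow> order_le 3 Omega (\<lambda>z. K z $ k)"
proof (rule order_le_Omega)
  fix z z' :: jet assume K: "K \<in> ops" and *: "\<And>c. jet_order c \<le> 3 \<Longrightarrow> z' c = z c"
  have fd: "fd ks z' = fd ks z" if "length ks \<le> 3" for ks
    unfolding fd_def using that by (intro *) simp
  have B: "z' (Base k) = z (Base k)" for k by (intro *) simp
  show "K z' $ k = K z $ k" using K exhaust_4[of k] by (auto simp: op_component fd B)
qed

context fiber_generator
begin

lemma has_lie_fd: "has_lie (W z) (fd ks) (Y (fd ks) z) z"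
  by (intro has_lie_Y diffat_UNIV tame_fd tame_set_UNIV refl)

lemma has_lie_W_Base: "has_lie (W z) (\<lambda>z. z (Base k)) (Ybase \<xi> \<eta> z $ k) z"
  by (rule has_lie_coord) (simp add: W_Base)

lemma has_lie_quotient:
  assumes "has_lie v J (m * J z + e) z" "has_lie v K (m * K z) z" "K z \<noteq> 0"
  shows "has_lie v (\<lambda>z. J z / K z) (e / K z) z"
proof -
  have "((m * J z + e) * K z - J z * (m * K z)) / (K z * K z) = e / K z"
    using assms(3) by (simp add: field_simps)
  with has_lie_divide[OF assms refl] show ?thesis by simp
qed

text \<open>The coefficients of an invariant operator transform like the components of a vector field on
  the space of the independent variables; those listed in \<open>ops\<close> have a common denominator which is
  a relative invariant.\<close>

lemma Y_common_denominator:
  assumes K: "\<And>z k. K z $ k = (vector [n1 z, n2 z, n3 z, n4 z] :: real^4) $ k / d z"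
    and d: "has_lie (W z) d (m * d z) z" "d z \<noteq> 0"
    and "has_lie (W z) n1 (m * n1 z + n1 z * X 1 z) z"
    and "has_lie (W z) n2 (m * n2 z + n1 z * (Ybase \<xi> \<eta> z $ 3 + X 1 z * z (Base 3)) + (n2 z - z (Base 3) * n1 z) * E 0 1 z) z"
    and "has_lie (W z) n3 (m * n3 z + n1 z * (Ybase \<xi> \<eta> z $ 4 + X 1 z * z (Base 4)) + (n2 z - z (Base 3) * n1 z) * E 1 1 z
      + (n3 z - z (Base 4) * n1 z) * (E 0 1 z - X 1 z)) z"
    and "has_lie (W z) n4 (m * n4 z + n1 z * (mu \<xi> \<eta> z + X 1 z * fd [] z) + (n2 z - z (Base 3) * n1 z) * E 2 1 z
      + (n3 z - z (Base 4) * n1 z) * (2 * E 1 1 z - X 2 z) + (n4 z - fd [] z * n1 z) * (E 0 1 z - 2 * X 1 z)) z"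
  shows "Y (\<lambda>z. K z $ k) z = (\<Sum>j\<in>UNIV. K z $ j * Dtot j (\<lambda>w. W w (Base k)) z)"
proof -
  \<comment> \<open>Trading the derivative in x for \<open>Ddot\<close> brings the operator to the
    basis of D and the derivatives in y, p, q. In that basis its coefficients are \<open>n1\<close>,
    \<open>n2\<close> - p \<open>n1\<close>, \<open>n3\<close> - q \<open>n1\<close> and
    \<open>n4\<close> - f \<open>n1\<close>.\<close>
  have D1: "Dtot 1 (\<lambda>w. W w (Base k)) z = Ddot (\<lambda>w. W w (Base k)) z - z (Base 3) * Dtot 2 (\<lambda>w. W w (Base k)) z
    - z (Base 4) * Dtot 3 (\<lambda>w. W w (Base k)) z - fd [] z * Dtot 4 (\<lambda>w. W w (Base k)) z" for k
    by (simp add: Ddot_def)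
  have DW: "Ddot (\<lambda>w. W w (Base 1)) z = X 1 z"
    "Ddot (\<lambda>w. W w (Base 2)) z = Ybase \<xi> \<eta> z $ 3 + X 1 z * z (Base 3)"
    "Ddot (\<lambda>w. W w (Base 3)) z = Ybase \<xi> \<eta> z $ 4 + X 1 z * z (Base 4)"
    "Ddot (\<lambda>w. W w (Base 4)) z = mu \<xi> \<eta> z + X 1 z * fd [] z"
    by (simp_all add: W_Base Ybase_eq mu_eq total_simps tame_UNIV_simps One_nat_def[symmetric])
  let ?S = "\<lambda>k. n1 z * Dtot 1 (\<lambda>w. W w (Base k)) z + n2 z * Dtot 2 (\<lambda>w. W w (Base k)) z
    + n3 z * Dtot 3 (\<lambda>w. W w (Base k)) z + n4 z * Dtot 4 (\<lambda>w. W w (Base k)) z"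
  have S: "(\<Sum>j\<in>UNIV. K z $ j * Dtot j (\<lambda>w. W w (Base k)) z) = ?S k / d z" for k
    by (simp add: sum_4 K vector_4 add_divide_distrib)
  have num: "has_lie (W z) n1 (m * n1 z + ?S 1) z" "has_lie (W z) n2 (m * n2 z + ?S 2) z"
    "has_lie (W z) n3 (m * n3 z + ?S 3) z" "has_lie (W z) n4 (m * n4 z + ?S 4) z"
    unfolding D1 DW Dtot_W_Base
    by (rule assms(4-)[THEN has_lie_eq_rhs], simp add: algebra_simps)+
  show ?thesis unfolding S using exhaust_4[of k] num[THEN has_lie_quotient, OF d]
    by (auto simp: K vector_4 intro: Y_eqI)
qed

text \<open>Together with \<open>Y_Dtot\<close> this says that the operator commutes with every
  generator.\<close>

lemma Y_op:
  assumes z: "z \<in> Omega" and K: "K \<in> ops"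
  shows "Y (\<lambda>z. K z $ k) z = (\<Sum>j\<in>UNIV. K z $ j * Dtot j (\<lambda>w. W w (Base k)) z)"
proof -
  have nz: "fd [4,4] z \<noteq> 0" "fd [4,4,4] z \<noteq> 0" using z by (simp_all add: Omega_def)
  note rules = lie_intros has_lie_fd has_lie_W_Base
  note simps = Y_fd_order0 Y_fd_order1 Y_fd_order2 Y_fd_order3 Ybase_eq mu_eq wt_def power2_eq_square power3_eq_cube power4_eq_xxxx
  \<comment> \<open>In all four cases \<open>m\<close> is the weight of the common denominator, a
    product of powers of f_44 and f_444.\<close>
  have 1: "Y (\<lambda>z. op1 z $ k) z = (\<Sum>j\<in>UNIV. op1 z $ j * Dtot j (\<lambda>w. W w (Base k)) z)"
  proof (rule Y_common_denominator[where ?n1.0 = "\<lambda>z. 0" and ?n2.0 = "\<lambda>z. 0"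
      and ?n3.0 = "\<lambda>z. 0"
      and ?n4.0 = "fd [4,4]"
      and d = "fd [4,4,4]" and m = "wt 3 (-2) z"])
    show "op1 z $ k = (vector [(\<lambda>z. 0) z, (\<lambda>z. 0) z, (\<lambda>z. 0) z, (fd [4,4]) z] :: real^4) $ k / ((fd [4,4,4]) z)" for z k
      using exhaust_4[of k] by (auto simp: op_component vector_4)
  qed (rule has_lie_eq_rhs, (rule rules)+, simp add: simps nz algebra_simps | simp add: nz)+
  have 2: "Y (\<lambda>z. op2 z $ k) z = (\<Sum>j\<in>UNIV. op2 z $ j * Dtot j (\<lambda>w. W w (Base k)) z)"
  proof (rule Y_common_denominator[where ?n1.0 = "\<lambda>z. 0" and ?n2.0 = "\<lambda>z. 0"
      and ?n3.0 = "fd [4,4,4]"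
      and ?n4.0 = "\<lambda>z. - fd [3,4,4] z"
      and d = "\<lambda>z. fd [4,4] z * fd [4,4,4] z" and m = "wt 4 (-3) z"])
    show "op2 z $ k = (vector [(\<lambda>z. 0) z, (\<lambda>z. 0) z, (fd [4,4,4]) z, (\<lambda>z. - fd [3,4,4] z) z] :: real^4) $ k / ((\<lambda>z. fd [4,4] z * fd [4,4,4] z) z)" for z k
      using exhaust_4[of k] by (auto simp: op_component vector_4)
  qed (rule has_lie_eq_rhs, (rule rules)+, simp add: simps nz algebra_simps | simp add: nz)+
  have 3: "Y (\<lambda>z. op3 z $ k) z = (\<Sum>j\<in>UNIV. op3 z $ j * Dtot j (\<lambda>w. W w (Base k)) z)"
  proof (rule Y_common_denominator[where ?n1.0 = "\<lambda>z. 0" and ?n2.0 = "\<lambda>z. 6 * fd [4,4] z * fd [4,4,4] z ^ 2"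
      and ?n3.0 = "\<lambda>z. - (2 * fd [4,4] z * fd [4,4,4] z * (fd [4] z * fd [4,4,4] z + 3 * fd [3,4,4] z))"
      and ?n4.0 = "\<lambda>z. 3 * fd [4,4] z * fd [3,4,4] z ^ 2 + fd [4,4,4] z ^ 2 * (3 * fd [3,3] z + 2 * fd [3,4] z * fd [4] z - 6 * fd [2,4] z)"
      and d = "\<lambda>z. fd [4,4] z ^ 4 * fd [4,4,4] z" and m = "wt 7 (-6) z"])
    show "op3 z $ k = (vector [(\<lambda>z. 0) z, (\<lambda>z. 6 * fd [4,4] z * fd [4,4,4] z ^ 2) z, (\<lambda>z. - (2 * fd [4,4] z * fd [4,4,4] z * (fd [4] z * fd [4,4,4] z + 3 * fd [3,4,4] z))) z, (\<lambda>z. 3 * fd [4,4] z * fd [3,4,4] z ^ 2 + fd [4,4,4] z ^ 2 * (3 * fd [3,3] z + 2 * fd [3,4] z * fd [4] z - 6 * fd [2,4] z)) z] :: real^4) $ k / ((\<lambda>z. fd [4,4] z ^ 4 * fd [4,4,4] z) z)" for z k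
      using exhaust_4[of k] by (auto simp: op_component vector_4)
  qed (rule has_lie_eq_rhs, (rule rules)+, simp add: simps nz algebra_simps | simp add: nz)+
  have 4: "Y (\<lambda>z. op4 z $ k) z = (\<Sum>j\<in>UNIV. op4 z $ j * Dtot j (\<lambda>w. W w (Base k)) z)"
  proof (rule Y_common_denominator[where ?n1.0 = "fd [4,4,4]" and ?n2.0 = "\<lambda>z. fd [4,4,4] z * z (Base 3)"
      and ?n3.0 = "\<lambda>z. fd [4,4,4] z * z (Base 4)"
      and ?n4.0 = "\<lambda>z. fd [4,4,4] z * fd [] z"
      and d = "\<lambda>z. fd [4,4] z ^ 2" and m = "wt 2 (-2) z"])
    show "op4 z $ k = (vector [(fd [4,4,4]) z, (\<lambda>z. fd [4,4,4] z * z (Base 3)) z, (\<lambda>z. fd [4,4,4] z * z (Base 4)) z, (\<lambda>z. fd [4,4,4] z * fd [] z) z] :: real^4) $ k / ((\<lambda>z. fd [4,4] z ^ 2) z)" for z k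
      using exhaust_4[of k] by (auto simp: op_component vector_4)
  qed (rule has_lie_eq_rhs, (rule rules)+, simp add: simps nz algebra_simps | simp add: nz)+
  show ?thesis using K by (elim insertE emptyE; simp only: 1 2 3 4)
qed

end

text \<open>\<open>Y I\<close> vanishes on the open set \<open>U\<close>, hence so do its total
  derivatives. In Y applied to the operator on \<open>I\<close> two double sums remain, one from the
  coefficients and one from \<open>Y_Dtot\<close>; they cancel after exchanging the summation
  indices.\<close>

lemma op_invariant_operator:
  assumes K: "K \<in> ops" shows "invariant_operator 3 Omega K"
  unfolding invariant_operator_def
proof (intro conjI allI impI)
  fix k show "smooth_on Omega (\<lambda>z. K z $ k)" "order_le 3 Omega (\<lambda>z. K z $ k)"
    using op_tame[OF K] op_order_le[OF K] by (simp_all add: tame_smooth)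
next
  fix U s I assume "U \<subseteq> Omega \<and> differential_invariant s U I"
  then have U: "U \<subseteq> Omega" and I: "smooth_on U I" "order_le s U I"
    and inv: "\<And>\<xi> \<eta> z. generator \<xi> \<eta> \<Longrightarrow> z \<in> U \<Longrightarrow> Yprol s \<xi> \<eta> I z = 0"
    by (auto simp: differential_invariant_def)
  have tI: "tame U I" by (rule order_le_tame[OF I])
  have tK: "tame U (\<lambda>z. K z $ k)" for k by (rule tame_restrict[OF op_tame[OF K] tame_imp_tame_set[OF tI] U])
  have t: "tame U (apply_op K I)" unfolding apply_op_def[abs_def]
    by (intro tame_sum tame_mult tK tame_Dtot tI tame_imp_tame_set[OF tI] finite)
  obtain t where ord: "order_le t U (apply_op K I)" using tame_order_le[OF t] by blast
  have "Yprol t \<xi> \<eta> (apply_op K I) z = 0" if "generator \<xi> \<eta>" and z: "z \<in> U" for \<xi> \<eta> z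
  proof -
    interpret fiber_generator \<xi> \<eta> by unfold_locales (rule that(1))
    have zO: "z \<in> Omega" using z U by blast
    have YI: "Y I w = 0" if "w \<in> U" for w
      using inv[OF \<open>generator \<xi> \<eta>\<close> that] Yprol_eq[OF tI I(2) that] by simp
    have DY: "Dtot k (Y I) z = 0" for k
      using Dtot_cong_on[OF tame_open[OF tI] z, of "Y I" "\<lambda>z. 0" k] YI by simp
    let ?d = "\<lambda>k j. Dtot k (\<lambda>w. W w (Base j)) z"
    have "has_lie (W z) (apply_op K I) (\<Sum>k\<in>UNIV. (\<Sum>j\<in>UNIV. K z $ j * ?d j k) * Dtot k I z
        + K z $ k * (- (\<Sum>j\<in>UNIV. ?d k j * Dtot j I z))) z"
      unfolding apply_op_def[abs_def]
    proof (intro has_lie_finite_sum has_lie_mult[OF _ _ refl] finite)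
      fix k
      show "has_lie (W z) (\<lambda>z. K z $ k) (\<Sum>j\<in>UNIV. K z $ j * ?d j k) z"
        by (rule has_lie_Y[OF tame_diffat[OF tK z] Y_op[OF zO K]])
      show "has_lie (W z) (Dtot k I) (- (\<Sum>j\<in>UNIV. ?d k j * Dtot j I z)) z"
        by (rule has_lie_Y[OF tame_diffat[OF tame_Dtot[OF tI] z]]) (simp add: Y_Dtot[OF tI z] DY)
    qed
    then have "Y (apply_op K I) z = (\<Sum>k\<in>UNIV. (\<Sum>j\<in>UNIV. K z $ j * ?d j k) * Dtot k I z
        + K z $ k * (- (\<Sum>j\<in>UNIV. ?d k j * Dtot j I z)))"
      by (rule Y_eqI)
    also have "\<dots> = 0" by (simp add: sum_4 algebra_simps)
    finally show ?thesis using Yprol_eq[OF t ord z] by simp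
  qed
  then show "\<exists>t. differential_invariant t U (apply_op K I)"
    using tame_smooth[OF t] ord unfolding differential_invariant_def by blast
qed

text \<open>The coefficient matrix is triangular with nonzero diagonal: the derivative in x occurs
  only in \<open>op4\<close>, then the one in y only in \<open>op3\<close>, and so on.\<close>

lemma independent_ops: "independent_operators Omega [op1, op2, op3, op4]"
  unfolding independent_operators_def
proof (intro ballI allI impI)
  fix z a i assume z: "z \<in> Omega" and i: "i < length [op1, op2, op3, op4]"
    and "(\<Sum>i<length [op1, op2, op3, op4]. a i *\<^sub>R ([op1, op2, op3, op4] ! i) z) = 0"
  then have eq: "a 0 * op1 z $ k + a 1 * op2 z $ k + a 2 * op3 z $ k + a 3 * op4 z $ k = 0" for k
    by (simp add: vec_eq_iff eval_nat_numeral One_nat_def)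
  have nz: "fd [4,4] z \<noteq> 0" "fd [4,4,4] z \<noteq> 0" using z by (simp_all add: Omega_def)
  have "a 3 = 0" using eq[of 1] nz by (simp add: op_component)
  moreover from this have "a 2 = 0" using eq[of 2] nz by (simp add: op_component)
  moreover from calculation have "a 1 = 0" using eq[of 3] nz by (simp add: op_component)
  moreover from calculation have "a 0 = 0" using eq[of 4] nz by (simp add: op_component)
  ultimately have "\<forall>i<4. a i = 0" by (simp add: eval_nat_numeral less_Suc_eq One_nat_def)
  then show "a i = 0" using i by simp
qed

section \<open>Generators with prescribed derivatives at a point\<close>

definition taylor :: "(nat \<Rightarrow> real) \<Rightarrow> nat \<Rightarrow> real \<Rightarrow> jet \<Rightarrow> real" where
  "taylor c n a z = (\<Sum>i\<le>n. c i * ((z (Base 1) - a) ^ i / fact i))"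

lemma tame_monomial: "tame_set U \<Longrightarrow> tame U (\<lambda>z. (z (Base 1) - a) ^ i / fact i)"
  by (intro tame_intros) auto

lemma tame_taylor [simp]: "tame UNIV (taylor c n a)"
  unfolding taylor_def[abs_def] by (intro tame_sum tame_mult tame_const tame_monomial) auto

lemma Dtot_taylor: "k \<noteq> 1 \<Longrightarrow> Dtot k (taylor c n a) = (\<lambda>z. 0)"
proof (rule ext, rule Dtot_eqI, rule has_lie_eq_rhs)
  fix z assume k: "k \<noteq> 1"
  show "has_lie (shift k z) (taylor c n a) (\<Sum>i\<le>n. 0) z"
    unfolding taylor_def[abs_def]
  proof (rule has_lie_finite_sum)
    fix i
    show "has_lie (shift k z) (\<lambda>z. c i * ((z (Base 1) - a) ^ i / fact i)) 0 z"
      by (rule has_lie_eq_rhs, (rule has_lie_divide[OF _ _ _ refl] lie_intros has_lie_coord[OF refl])+)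
        (use k in auto)
  qed simp
qed simp

text \<open>Since the coefficient after the last is 0, differentiation is a pure shift of the
  coefficients and the length \<open>n\<close> can stay fixed.\<close>

lemma Ddot_taylor:
  assumes "c (Suc n) = 0" shows "Ddot (taylor c n a) = taylor (\<lambda>i. c (Suc i)) n a"
proof
  fix z
  have "Ddot (taylor c n a) z = Dtot 1 (taylor c n a) z"
    by (simp add: Ddot_def Dtot_taylor)
  also have "\<dots> = (\<Sum>i\<le>n. c i * (of_nat i * (z (Base 1) - a) ^ (i - 1) / fact i))"
  proof (rule Dtot_eqI)
    show "has_lie (shift 1 z) (taylor c n a) (\<Sum>i\<le>n. c i * (of_nat i * (z (Base 1) - a) ^ (i - 1) / fact i)) z"
      unfolding taylor_def[abs_def]
    proof (rule has_lie_finite_sum)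
      fix i
      show "has_lie (shift 1 z) (\<lambda>z. c i * ((z (Base 1) - a) ^ i / fact i)) (c i * (of_nat i * (z (Base 1) - a) ^ (i - 1) / fact i)) z"
        by (rule has_lie_eq_rhs, (rule has_lie_divide[OF _ _ _ refl] lie_intros has_lie_coord[OF refl])+) auto
    qed simp
  qed
  also have "\<dots> = (\<Sum>i\<le>Suc n. c i * (of_nat i * (z (Base 1) - a) ^ (i - 1) / fact i))"
    using assms by simp
  also have "\<dots> = (\<Sum>i\<le>n. c (Suc i) * (of_nat (Suc i) * (z (Base 1) - a) ^ i / fact (Suc i)))"
    unfolding sum.atMost_Suc_shift by simp
  also have "\<dots> = taylor (\<lambda>i. c (Suc i)) n a z"
    unfolding taylor_def by (intro sum.cong refl) (simp add: field_simps del: of_nat_Suc)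
  finally show "Ddot (taylor c n a) z = taylor (\<lambda>i. c (Suc i)) n a z" .
qed

lemma Ddot_pow_taylor:
  assumes "\<And>i. i > n \<Longrightarrow> c i = 0" shows "(Ddot ^^ k) (taylor c n a) = taylor (\<lambda>i. c (i + k)) n a"
  using assms by (induction k) (simp_all add: Ddot_taylor)

lemma taylor_at: "z (Base 1) = a \<Longrightarrow> taylor c n a z = c 0"
proof -
  have "(\<Sum>i\<le>n. c i * (0 ^ i / fact i)) = (\<Sum>i\<le>n. if i = 0 then c 0 else 0)" by (intro sum.cong) auto
  then show "z (Base 1) = a \<Longrightarrow> taylor c n a z = c 0" by (simp add: taylor_def)
qed

text \<open>Vanishing to order \<open>n\<close> at \<open>z\<close> in the direction of
  \<open>Ddot\<close>. By the Leibniz rule these functions form an ideal, see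
  \<open>flat_add\<close> and \<open>flat_mult\<close>.\<close>

definition flat :: "jet \<Rightarrow> nat \<Rightarrow> (jet \<Rightarrow> real) \<Rightarrow> bool" where
  "flat z n J \<longleftrightarrow> tame UNIV J \<and> (\<forall>k\<le>n. (Ddot ^^ k) J z = 0)"

lemma tame_Ddot_pow: "tame U J \<Longrightarrow> tame U ((Ddot ^^ k) J)"
  by (induction k) (auto intro: tame_Ddot)

lemma flat_Suc: "flat z (Suc n) J \<longleftrightarrow> tame UNIV J \<and> J z = 0 \<and> flat z n (Ddot J)"
proof -
  have "(\<forall>k\<le>Suc n. (Ddot ^^ k) J z = 0) \<longleftrightarrow> J z = 0 \<and> (\<forall>k\<le>n. (Ddot ^^ k) (Ddot J) z = 0)"
    using All_less_Suc2[of "Suc n" "\<lambda>k. (Ddot ^^ k) J z = 0"]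
    by (simp only: less_Suc_eq_le funpow_0 funpow_Suc_right comp_apply)
  then show ?thesis unfolding flat_def using tame_Ddot[of UNIV J] by blast
qed

lemma Ddot_pow_add:
  assumes "tame UNIV J" "tame UNIV K"
  shows "(Ddot ^^ k) (\<lambda>z. J z + K z) = (\<lambda>z. (Ddot ^^ k) J z + (Ddot ^^ k) K z)"
  using assms
proof (induction k)
  case (Suc k)
  show ?case
  proof
    fix w
    show "(Ddot ^^ Suc k) (\<lambda>z. J z + K z) w = (Ddot ^^ Suc k) J w + (Ddot ^^ Suc k) K w"
      using Suc.prems by (simp add: Suc.IH total_simps tame_Ddot_pow)
  qed
qed simp

lemma flat_add: "flat z n J \<Longrightarrow> flat z n K \<Longrightarrow> flat z n (\<lambda>z. J z + K z)"
  by (simp add: flat_def Ddot_pow_add tame_add)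

lemma flat_mult: "flat z n J \<Longrightarrow> tame UNIV K \<Longrightarrow> flat z n (\<lambda>z. J z * K z)"
proof (induction n arbitrary: J K)
  case 0 then show ?case by (simp add: flat_def tame_mult)
next
  case (Suc n)
  have J: "tame UNIV J" "J z = 0" "flat z n (Ddot J)" using Suc.prems(1) unfolding flat_Suc by auto
  have J': "flat z n J" using Suc.prems(1) unfolding flat_def by simp
  have "Ddot (\<lambda>z. J z * K z) = (\<lambda>z. Ddot J z * K z + J z * Ddot K z)"
    using J(1) Suc.prems(2) by (simp add: fun_eq_iff total_simps)
  moreover have "flat z n (\<lambda>z. Ddot J z * K z + J z * Ddot K z)"
    by (intro flat_add Suc.IH J J' Suc.prems(2) tame_Ddot)
  ultimately show ?case using J Suc.prems(2) by (simp add: flat_Suc tame_mult)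
qed

lemma flat_sum: "finite I \<Longrightarrow> (\<And>i. i \<in> I \<Longrightarrow> flat z n (J i)) \<Longrightarrow> flat z n (\<lambda>z. \<Sum>i\<in>I. J i z)"
proof (induction I rule: finite_induct)
  case empty
  have "(Ddot ^^ k) (\<lambda>z. 0) = (\<lambda>z. 0)" for k by (induction k) simp_all
  then show ?case by (simp add: flat_def tame_const)
qed (auto intro: flat_add)

text \<open>Writing \<open>\<eta>\<close> as a polynomial in \<open>y - Y(x)\<close>, where \<open>Y\<close> is a curve whose derivatives at the
  given point are \<open>y, p, q, f, \<dots>\<close>, makes the total derivatives of \<open>\<eta>\<close> and of its
  \<open>y\<close>-derivatives at that point ordinary derivatives of the coefficients.\<close>

lemma ex_generator:
  fixes z :: jet and c :: "nat \<Rightarrow> real" and e :: "nat \<Rightarrow> nat \<Rightarrow> real"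
  shows "\<exists>\<xi> \<eta>. generator \<xi> \<eta> \<and> (\<forall>i\<le>6. (Ddot ^^ i) \<xi> z = c i) \<and>
    (\<forall>i\<le>6. \<forall>j\<le>3. (Ddot ^^ i) ((Dtot 2 ^^ j) \<eta>) z = e i j)"
proof -
  define a where "a = z (Base 1)"
  \<comment> \<open>These numbers are y, p, q, f and further total derivatives at \<open>z\<close>;
    subtracting their Taylor polynomial from y makes \<open>R\<close> flat to order 6.\<close>
  define m where "m k = (if k \<le> 6 then (Ddot ^^ k) (\<lambda>w. w (Base 2)) z else 0)" for k
  define R where "R = (\<lambda>w. w (Base 2) - taylor m 6 a w)"
  \<comment> \<open>The factorial makes the derivative in y lower \<open>l\<close> by one, so that
    \<open>\<eta> j\<close> below becomes the \<open>j\<close>-th derivative of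
    \<open>\<eta> 0\<close> in y.\<close>
  define S where "S l = (\<lambda>w. R w ^ l / fact l)" for l
  define c' where "c' i = (if i \<le> 6 then c i else 0)" for i
  \<comment> \<open>The cut-off at 6 permits \<open>Ddot_pow_taylor\<close>; the cut-off at 3 makes
    the last summand vanish when \<open>j\<close> is raised.\<close>
  define e' where "e' j i = (if i \<le> 6 \<and> j \<le> 3 then e i j else 0)" for i j
  define \<xi> where "\<xi> = taylor c' 6 a"
  define \<eta> where "\<eta> j = (\<lambda>w. \<Sum>l\<le>3. taylor (e' (l + j)) 6 a w * S l w)" for j
  have tB: "tame UNIV (\<lambda>w :: jet. w (Base k))" for k by (intro tame_coord tame_set_UNIV)
  have tR: "tame UNIV R" unfolding R_def by (intro tame_diff tB tame_taylor)
  have tS: "tame UNIV (S l)" for l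
    unfolding S_def by (intro tame_divide tame_power tR tame_const tame_set_UNIV) simp
  have t\<eta>: "tame UNIV (\<eta> j)" for j
    unfolding \<eta>_def by (intro tame_sum tame_mult tame_taylor tS tame_set_UNIV) simp
  have "generator \<xi> (\<eta> 0)"
    unfolding generator_def
  proof (intro conjI)
    show "smooth_on UNIV \<xi>" "smooth_on UNIV (\<eta> 0)" using t\<eta> by (simp_all add: \<xi>_def tame_smooth)
    show "\<exists>g. \<xi> = (\<lambda>z. g (z (Base 1)))"
      unfolding \<xi>_def taylor_def[abs_def] by (rule exI[of _ "\<lambda>x. \<Sum>i\<le>6. c' i * ((x - a) ^ i / fact i)"]) simp
    show "\<exists>h. \<eta> 0 = (\<lambda>z. h (z (Base 1)) (z (Base 2)))"
      unfolding \<eta>_def S_def R_def taylor_def[abs_def]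
      by (rule exI[of _ "\<lambda>x y. \<Sum>l\<le>3. (\<Sum>i\<le>6. e' (l + 0) i * ((x - a) ^ i / fact i)) *
        ((y - (\<Sum>i\<le>6. m i * ((x - a) ^ i / fact i))) ^ l / fact l)"]) simp
  qed
  moreover have "(Ddot ^^ i) \<xi> z = c i" if "i \<le> 6" for i
    unfolding \<xi>_def using that by (subst Ddot_pow_taylor) (auto simp: c'_def taylor_at a_def)
  moreover have "(Ddot ^^ i) ((Dtot 2 ^^ j) (\<eta> 0)) z = e i j" if ij: "i \<le> 6" "j \<le> 3" for i j
  proof -
    have DR: "Dtot 2 R = (\<lambda>w. 1)"
      unfolding R_def by (simp add: fun_eq_iff total_simps tB Dtot_taylor)
    have DS: "Dtot 2 (S (Suc l)) = S l" "Dtot 2 (S 0) = (\<lambda>w. 0)" for l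
    proof -
      show "Dtot 2 (S 0) = (\<lambda>w. 0)" by (simp add: S_def)
      have "has_lie (shift 2 w) (S (Suc l)) (S l w) w" for w
        unfolding S_def
        by (rule has_lie_eq_rhs, (rule has_lie_divide[OF _ _ _ refl] lie_intros has_lie_Dtot[OF diffat_UNIV[OF tR]])+)
          (simp_all add: DR field_simps del: of_nat_Suc)
      then show "Dtot 2 (S (Suc l)) = S l" by (intro ext Dtot_eqI)
    qed
    have "Dtot 2 (\<eta> j) = \<eta> (Suc j)" for j
    proof
      fix w
      have "Dtot 2 (\<eta> j) w = (\<Sum>l\<le>3. taylor (e' (l + j)) 6 a w * Dtot 2 (S l) w)"
        unfolding \<eta>_def
        by (rule Dtot_eqI, rule has_lie_finite_sum)
          (auto intro!: has_lie_eq_rhs[OF has_lie_mult[OF has_lie_Dtot[OF diffat_UNIV] has_lie_Dtot[OF diffat_UNIV] refl]]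
            simp: tS Dtot_taylor)
      also have "\<dots> = \<eta> (Suc j) w"
      proof -
        have 3: "(3::nat) = Suc 2" by simp
        have "(\<Sum>l\<le>3. taylor (e' (l + j)) 6 a w * Dtot 2 (S l) w) = (\<Sum>l\<le>2. taylor (e' (l + Suc j)) 6 a w * S l w)"
          unfolding 3 sum.atMost_Suc_shift by (simp add: DS)
        moreover have "taylor (e' (3 + Suc j)) 6 a w = 0" by (simp add: e'_def taylor_def)
        ultimately show ?thesis unfolding \<eta>_def 3 sum.atMost_Suc by simp
      qed
      finally show "Dtot 2 (\<eta> j) w = \<eta> (Suc j) w" .
    qed
    then have pow: "(Dtot 2 ^^ j) (\<eta> 0) = \<eta> j" by (induction j) simp_all
    have DB: "(Ddot ^^ k) R z = 0" if "k \<le> 6" for k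
    proof -
      have "(Ddot ^^ k) R = (\<lambda>w. (Ddot ^^ k) (\<lambda>w. w (Base 2)) w + (Ddot ^^ k) (taylor (\<lambda>i. - m i) 6 a) w)"
      proof -
        have "R = (\<lambda>w. w (Base 2) + taylor (\<lambda>i. - m i) 6 a w)"
          by (simp add: R_def taylor_def fun_eq_iff sum_negf)
        then show ?thesis using Ddot_pow_add[OF tB tame_taylor] by simp
      qed
      moreover have "(Ddot ^^ k) (taylor (\<lambda>i. - m i) 6 a) z = - m k"
        by (subst Ddot_pow_taylor) (auto simp: m_def taylor_at a_def)
      ultimately show ?thesis using that by (simp add: m_def)
    qed
    then have flatR: "flat z 6 R" using tR by (simp add: flat_def)
    \<comment> \<open>Each summand with \<open>l\<close> at least 1 contains the flat factor
      \<open>R\<close>, so at \<open>z\<close> only the term with \<open>l = 0\<close>, a polynomial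
      in x, is seen.\<close>
    have "flat z 6 (\<lambda>w. \<Sum>l\<in>{1..3}. taylor (e' (l + j)) 6 a w * S l w)"
    proof (rule flat_sum)
      fix l :: nat assume l: "l \<in> {1..3}"
      have "tame UNIV (\<lambda>w. R w ^ (l - 1) / fact l * taylor (e' (l + j)) 6 a w)"
        by (intro tame_mult tame_divide tame_power tR tame_const tame_set_UNIV tame_taylor) simp
      from flat_mult[OF flatR this]
      show "flat z 6 (\<lambda>w. taylor (e' (l + j)) 6 a w * S l w)"
        using l by (cases l) (simp_all add: S_def mult_ac)
    qed simp
    moreover have "\<eta> j = (\<lambda>w. taylor (e' j) 6 a w + (\<Sum>l\<in>{1..3}. taylor (e' (l + j)) 6 a w * S l w))"
    proof
      fix w
      have "{..3::nat} = insert 0 {1..3}" by auto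
      then show "\<eta> j w = taylor (e' j) 6 a w + (\<Sum>l\<in>{1..3}. taylor (e' (l + j)) 6 a w * S l w)"
        by (simp add: \<eta>_def S_def)
    qed
    ultimately have "(Ddot ^^ i) (\<eta> j) z = (Ddot ^^ i) (taylor (e' j) 6 a) z"
      using ij(1) Ddot_pow_add[OF tame_taylor] by (simp add: flat_def)
    also have "\<dots> = e i j"
      using ij by (subst Ddot_pow_taylor) (auto simp: e'_def taylor_at a_def)
    finally show ?thesis by (simp add: pow)
  qed
  ultimately show ?thesis by blast
qed

section \<open>Functions on which the generators take arbitrary values\<close>

context fiber_generator
begin

lemma Y_Ddot_fd:
  "Y (Ddot (fd [])) = (\<lambda>z. E 4 0 z - 4 * X 1 z * Ddot (fd []) z - 6 * X 2 z * fd [] z - 4 * X 3 z * z (Base 4) - X 4 z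
       * z (Base 3))"
  "Y (Ddot (fd [2])) = (\<lambda>z. - E 1 1 z * Ddot (fd [3]) z - E 2 1 z * fd [3] z - E 2 1 z * Ddot (fd [4]) z - E 3 1 z * fd
       [4] z + E 4 1 z - 4 * X 1 z * Ddot (fd [2]) z - 3 * X 2 z * fd [2] z)"
  "Y (Ddot (fd [3])) = (\<lambda>z. - 2 * E 1 1 z * Ddot (fd [4]) z - 2 * E 2 1 z * fd [4] z + 3 * E 3 1 z - 3 * X 1 z * Ddot
       (fd [3]) z - 2 * X 2 z * fd [3] z + X 2 z * Ddot (fd [4]) z + X 3 z * fd [4] z - X 4 z)"
  "Y (Ddot (fd [2,2])) = (\<lambda>z. - E 0 1 z * Ddot (fd [2,2]) z + E 0 2 z * Ddot (fd [2]) z - E 1 1 z * fd [2,2] z - 2 * E 1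
       1 z * Ddot (fd [2,3]) z + E 1 2 z * fd [2] z - E 1 2 z * Ddot (fd [3]) z - 2 * E 2 1 z * fd
       [2,3] z - 2 * E 2 1 z * Ddot (fd [2,4]) z - E 2 2 z * fd [3] z - E 2 2 z * Ddot (fd [4]) z -
       2 * E 3 1 z * fd [2,4] z - E 3 2 z * fd [4] z + E 4 2 z - 4 * X 1 z * Ddot (fd [2,2]) z - 3
       * X 2 z * fd [2,2] z)"
  by (simp_all add: fun_eq_iff Y_Ddot[OF _ UNIV_I] Y_fd_order0 Y_fd_order1 Y_fd_order2 total_simps tame_UNIV_simps algebra_simps)

lemma Y_Ddot2_fd:
  "Y (Ddot (Ddot (fd []))) = (\<lambda>z. E 5 0 z - 5 * X 1 z * Ddot (Ddot (fd [])) z - 10 * X 2 z * Ddot (fd []) z - 10 * X 3 z * fd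
       [] z - 5 * X 4 z * z (Base 4) - X 5 z * z (Base 3))"
  "Y (Ddot (Ddot (fd [2]))) = (\<lambda>z. - E 1 1 z * Ddot (Ddot (fd [3])) z - 2 * E 2 1 z * Ddot (fd [3]) z - E 2 1 z * Ddot (Ddot
       (fd [4])) z - E 3 1 z * fd [3] z - 2 * E 3 1 z * Ddot (fd [4]) z - E 4 1 z * fd [4] z + E 5
       1 z - 5 * X 1 z * Ddot (Ddot (fd [2])) z - 7 * X 2 z * Ddot (fd [2]) z - 3 * X 3 z * fd [2]
       z)"
  "Y (Ddot (Ddot (fd [3]))) = (\<lambda>z. - 2 * E 1 1 z * Ddot (Ddot (fd [4])) z - 4 * E 2 1 z * Ddot (fd [4]) z - 2 * E 3 1 z * fd
       [4] z + 3 * E 4 1 z - 4 * X 1 z * Ddot (Ddot (fd [3])) z - 5 * X 2 z * Ddot (fd [3]) z + X 2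
       z * Ddot (Ddot (fd [4])) z - 2 * X 3 z * fd [3] z + 2 * X 3 z * Ddot (fd [4]) z + X 4 z * fd
       [4] z - X 5 z)"
  by (simp_all add: fun_eq_iff Y_Ddot[OF _ UNIV_I] Y_Ddot_fd total_simps tame_UNIV_simps algebra_simps)

lemma Y_Ddot3_fd:
  "Y (Ddot (Ddot (Ddot (fd [])))) = (\<lambda>z. E 6 0 z - 6 * X 1 z * Ddot (Ddot (Ddot (fd []))) z - 15 * X 2 z * Ddot (Ddot (fd [])) z - 20
       * X 3 z * Ddot (fd []) z - 15 * X 4 z * fd [] z - 6 * X 5 z * z (Base 4) - X 6 z * z (Base
       3))"
  by (simp_all add: fun_eq_iff Y_Ddot[OF _ UNIV_I] Y_Ddot2_fd total_simps tame_UNIV_simps algebra_simps)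

end

text \<open>Together with the betas these replace the 39 coordinates of order at most 3:
  \<open>lam7\<close> stands for f_344, \<open>lam5\<close> for f_24, and each term with
  \<open>Ddot\<close> for a derivative of f with at least one index 1. They are chosen so that the
  equations for the parameters can be solved one after another.\<close>

definition kept :: "(jet \<Rightarrow> real) list" where
  "kept = [\<lambda>z. z (Base 1),
    \<lambda>z. z (Base 2),
    \<lambda>z. z (Base 3),
    \<lambda>z. z (Base 4),
    fd [],
    fd [4,4],
    fd [4,4,4],
    lam7,
    lam5,
    fd [4],
    fd [3],
    fd [3,4],
    fd [3,3],
    fd [2],
    Ddot (fd [3]),
    Ddot (fd [2]),
    Ddot (Ddot (fd [3])),
    Ddot (Ddot (fd [2])),
    fd [2,3],
    fd [2,2],
    Ddot (fd [2,2]),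
    fd [3,3,3],
    fd [2,3,3],
    fd [2,2,3],
    fd [2,2,2],
    Ddot (fd []),
    Ddot (Ddot (fd [])),
    Ddot (Ddot (Ddot (fd [])))]"

lemma ex_affine:
  fixes t c :: real
  assumes "\<And>x. g x = g 0 + c * x" "c \<noteq> 0" shows "\<exists>x. g x = t"
proof
  show "g ((t - g 0) / c) = t" using assms(2) by (subst assms(1)) simp
qed

text \<open>In the order below each equation contains one new parameter, affinely and with a
  coefficient that is a nonzero number or a nonzero multiple of \<open>lam4\<close> or
  \<open>lam6\<close>. Only f_44 and f_444 have to be treated together.\<close>

lemma ex_generator_kept:
  assumes z: "z \<in> Omega"
  shows "\<exists>\<xi> \<eta>. generator \<xi> \<eta> \<and> (\<forall>n<length kept. fiber_generator.Y \<xi> \<eta> (kept ! n) z = t n)"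
proof -
  have nz: "fd [4,4] z \<noteq> 0" "fd [4,4,4] z \<noteq> 0" using z by (simp_all add: Omega_def)
  have nzl: "lam4 z \<noteq> 0" "lam6 z \<noteq> 0" using Omega_lam[OF z] .
  \<comment> \<open>The solution of X 1 - E 0 1 = \<open>t 5\<close> / f_44 and 3 X 1 - 2 E 0 1 =
    \<open>t 6\<close> / f_444, a system of determinant 1.\<close>
  define x1 where "x1 = t 6 / fd [4,4,4] z - 2 * (t 5 / fd [4,4] z)"
  define e01 where "e01 = t 6 / fd [4,4,4] z - 3 * (t 5 / fd [4,4] z)"
  \<comment> \<open>X 6 enters only the equation for the third total derivative of f, where
    \<open>e60\<close> compensates for any choice.\<close>
  define x6 :: real where "x6 = 0"
  have 5: "- e01 * fd [4,4] z + x1 * fd [4,4] z = t 5"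
    using nz by (simp add: x1_def e01_def field_simps)
  have 6: "- 2 * e01 * fd [4,4,4] z + 3 * x1 * fd [4,4,4] z = t 6"
    using nz by (simp add: x1_def e01_def field_simps)
  obtain x2 where 7: "- 2 * e01 * lam7 z + 2 * x1 * lam7 z - x2 * lam6 z = t 7"
    by (atomize_elim, rule ex_affine[where c = "- lam6 z"]) (use nzl in \<open>simp_all add: algebra_simps\<close>)
  obtain x3 where 8: "- e01 * lam5 z - x1 * lam5 z + 2 / 3 * x3 * lam4 z = t 8"
    by (atomize_elim, rule ex_affine[where c = "2 / 3 * lam4 z"]) (use nzl in \<open>simp_all add: algebra_simps\<close>)
  obtain e11 where 9: "3 * e11 - x1 * fd [4] z - 3 * x2 = t 9"
    by (atomize_elim, rule ex_affine[where c = "3"]) (use nzl in \<open>simp_all add: algebra_simps\<close>)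
  obtain e21 where 10: "- 2 * e11 * fd [4] z + 3 * e21 - 2 * x1 * fd [3] z + x2 * fd [4] z - x3 = t 10"
    by (atomize_elim, rule ex_affine[where c = "3"]) (use nzl in \<open>simp_all add: algebra_simps\<close>)
  obtain e02 where 11: "- e01 * fd [3,4] z + 3 * e02 - 2 * e11 * fd [4,4] z + x2 * fd [4,4] z = t 11"
    by (atomize_elim, rule ex_affine[where c = "3"]) (use nzl in \<open>simp_all add: algebra_simps\<close>)
  obtain e12 where 12: "- e01 * fd [3,3] z - 2 * e02 * fd [4] z - 4 * e11 * fd [3,4] z + 6 * e12 - x1 * fd [3,3] z +
      2 * x2 * fd [3,4] z = t 12"
    by (atomize_elim, rule ex_affine[where c = "6"]) (use nzl in \<open>simp_all add: algebra_simps\<close>)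
  obtain e31 where 13: "- e11 * fd [3] z - e21 * fd [4] z + e31 - 3 * x1 * fd [2] z = t 13"
    by (atomize_elim, rule ex_affine[where c = "1"]) (use nzl in \<open>simp_all add: algebra_simps\<close>)
  obtain x4 where 14: "- 2 * e11 * Ddot (fd [4]) z - 2 * e21 * fd [4] z + 3 * e31 - 3 * x1 * Ddot (fd [3]) z - 2 *
      x2 * fd [3] z + x2 * Ddot (fd [4]) z + x3 * fd [4] z - x4 = t 14"
    by (atomize_elim, rule ex_affine[where c = "- 1"]) (use nzl in \<open>simp_all add: algebra_simps\<close>)
  obtain e41 where 15: "- e11 * Ddot (fd [3]) z - e21 * fd [3] z - e21 * Ddot (fd [4]) z - e31 * fd [4] z + e41 - 4
      * x1 * Ddot (fd [2]) z - 3 * x2 * fd [2] z = t 15"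
    by (atomize_elim, rule ex_affine[where c = "1"]) (use nzl in \<open>simp_all add: algebra_simps\<close>)
  obtain x5 where 16: "- 2 * e11 * Ddot (Ddot (fd [4])) z - 4 * e21 * Ddot (fd [4]) z - 2 * e31 * fd [4] z + 3 *
      e41 - 4 * x1 * Ddot (Ddot (fd [3])) z - 5 * x2 * Ddot (fd [3]) z + x2 * Ddot (Ddot (fd [4]))
      z - 2 * x3 * fd [3] z + 2 * x3 * Ddot (fd [4]) z + x4 * fd [4] z - x5 = t 16"
    by (atomize_elim, rule ex_affine[where c = "- 1"]) (use nzl in \<open>simp_all add: algebra_simps\<close>)
  obtain e51 where 17: "- e11 * Ddot (Ddot (fd [3])) z - 2 * e21 * Ddot (fd [3]) z - e21 * Ddot (Ddot (fd [4])) z -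
      e31 * fd [3] z - 2 * e31 * Ddot (fd [4]) z - e41 * fd [4] z + e51 - 5 * x1 * Ddot (Ddot (fd
      [2])) z - 7 * x2 * Ddot (fd [2]) z - 3 * x3 * fd [2] z = t 17"
    by (atomize_elim, rule ex_affine[where c = "1"]) (use nzl in \<open>simp_all add: algebra_simps\<close>)
  obtain e22 where 18: "- e01 * fd [2,3] z - 2 * e11 * fd [2,4] z - e11 * fd [3,3] z - 2 * e12 * fd [4] z - e21 * fd
      [3,4] z + 3 * e22 - 2 * x1 * fd [2,3] z + x2 * fd [2,4] z = t 18"
    by (atomize_elim, rule ex_affine[where c = "3"]) (use nzl in \<open>simp_all add: algebra_simps\<close>)
  obtain e32 where 19: "- e01 * fd [2,2] z + e02 * fd [2] z - 2 * e11 * fd [2,3] z - e12 * fd [3] z - 2 * e21 * fd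
      [2,4] z - e22 * fd [4] z + e32 - 3 * x1 * fd [2,2] z = t 19"
    by (atomize_elim, rule ex_affine[where c = "1"]) (use nzl in \<open>simp_all add: algebra_simps\<close>)
  obtain e42 where 20: "- e01 * Ddot (fd [2,2]) z + e02 * Ddot (fd [2]) z - e11 * fd [2,2] z - 2 * e11 * Ddot (fd
      [2,3]) z + e12 * fd [2] z - e12 * Ddot (fd [3]) z - 2 * e21 * fd [2,3] z - 2 * e21 * Ddot
      (fd [2,4]) z - e22 * fd [3] z - e22 * Ddot (fd [4]) z - 2 * e31 * fd [2,4] z - e32 * fd [4]
      z + e42 - 4 * x1 * Ddot (fd [2,2]) z - 3 * x2 * fd [2,2] z = t 20"
    by (atomize_elim, rule ex_affine[where c = "1"]) (use nzl in \<open>simp_all add: algebra_simps\<close>)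
  obtain e03 where 21: "- 2 * e01 * fd [3,3,3] z - 6 * e02 * fd [3,4] z + 6 * e03 - 6 * e11 * fd [3,3,4] z + 3 * x2
      * fd [3,3,4] z = t 21"
    by (atomize_elim, rule ex_affine[where c = "6"]) (use nzl in \<open>simp_all add: algebra_simps\<close>)
  obtain e13 where 22: "- 2 * e01 * fd [2,3,3] z - 2 * e02 * fd [2,4] z - e02 * fd [3,3] z - 2 * e03 * fd [4] z - 4
      * e11 * fd [2,3,4] z - e11 * fd [3,3,3] z - 4 * e12 * fd [3,4] z + 6 * e13 - e21 * fd
      [3,3,4] z - x1 * fd [2,3,3] z + 2 * x2 * fd [2,3,4] z = t 22"
    by (atomize_elim, rule ex_affine[where c = "6"]) (use nzl in \<open>simp_all add: algebra_simps\<close>)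
  obtain e23 where 23: "- 2 * e01 * fd [2,2,3] z - e02 * fd [2,3] z - 2 * e11 * fd [2,2,4] z - 2 * e11 * fd [2,3,3]
      z - 4 * e12 * fd [2,4] z - e12 * fd [3,3] z - 2 * e13 * fd [4] z - 2 * e21 * fd [2,3,4] z -
      e22 * fd [3,4] z + 3 * e23 - 2 * x1 * fd [2,2,3] z + x2 * fd [2,2,4] z = t 23"
    by (atomize_elim, rule ex_affine[where c = "3"]) (use nzl in \<open>simp_all add: algebra_simps\<close>)
  obtain e33 where 24: "- 2 * e01 * fd [2,2,2] z + 2 * e03 * fd [2] z - 3 * e11 * fd [2,2,3] z - 3 * e12 * fd [2,3]
      z - e13 * fd [3] z - 3 * e21 * fd [2,2,4] z - 3 * e22 * fd [2,4] z - e23 * fd [4] z + e33 -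
      3 * x1 * fd [2,2,2] z = t 24"
    by (atomize_elim, rule ex_affine[where c = "1"]) (use nzl in \<open>simp_all add: algebra_simps\<close>)
  obtain x0 where 0: "x0 = t 0"
    by (atomize_elim, rule ex_affine[where c = "1"]) (use nzl in \<open>simp_all add: algebra_simps\<close>)
  obtain e00 where 1: "e00 = t 1"
    by (atomize_elim, rule ex_affine[where c = "1"]) (use nzl in \<open>simp_all add: algebra_simps\<close>)
  obtain e10 where 2: "e10 - z (Base 3) * x1 = t 2"
    by (atomize_elim, rule ex_affine[where c = "1"]) (use nzl in \<open>simp_all add: algebra_simps\<close>)
  obtain e20 where 3: "e20 - 2 * z (Base 4) * x1 - z (Base 3) * x2 = t 3"
    by (atomize_elim, rule ex_affine[where c = "1"]) (use nzl in \<open>simp_all add: algebra_simps\<close>)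
  obtain e30 where 4: "e30 - 3 * x1 * fd [] z - 3 * x2 * z (Base 4) - x3 * z (Base 3) = t 4"
    by (atomize_elim, rule ex_affine[where c = "1"]) (use nzl in \<open>simp_all add: algebra_simps\<close>)
  obtain e40 where 25: "e40 - 4 * x1 * Ddot (fd []) z - 6 * x2 * fd [] z - 4 * x3 * z (Base 4) - x4 * z (Base 3) = t 25"
    by (atomize_elim, rule ex_affine[where c = "1"]) (use nzl in \<open>simp_all add: algebra_simps\<close>)
  obtain e50 where 26: "e50 - 5 * x1 * Ddot (Ddot (fd [])) z - 10 * x2 * Ddot (fd []) z - 10 * x3 * fd [] z - 5 * x4
      * z (Base 4) - x5 * z (Base 3) = t 26"
    by (atomize_elim, rule ex_affine[where c = "1"]) (use nzl in \<open>simp_all add: algebra_simps\<close>)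
  obtain e60 where 27: "e60 - 6 * x1 * Ddot (Ddot (Ddot (fd []))) z - 15 * x2 * Ddot (Ddot (fd [])) z - 20 * x3 *
      Ddot (fd []) z - 15 * x4 * fd [] z - 6 * x5 * z (Base 4) - x6 * z (Base 3) = t 27"
    by (atomize_elim, rule ex_affine[where c = "1"]) (use nzl in \<open>simp_all add: algebra_simps\<close>)
  \<comment> \<open>The entries 0 in the table belong to parameters that occur in none of the 28
    equations.\<close>
  obtain \<xi> \<eta> where gen: "generator \<xi> \<eta>" and X: "\<And>i. i \<le> 6 \<Longrightarrow> (Ddot ^^ i) \<xi> z = [x0, x1, x2, x3, x4, x5, x6] ! i"
    and E: "\<And>i j. i \<le> 6 \<Longrightarrow> j \<le> 3 \<Longrightarrow> (Ddot ^^ i) ((Dtot 2 ^^ j) \<eta>) z = [[e00, e01, e02, e03],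
      [e10, e11, e12, e13],
      [e20, e21, e22, e23],
      [e30, e31, e32, e33],
      [e40, e41, e42, 0],
      [e50, e51, 0, 0],
      [e60, 0, 0, 0]] ! i ! j"
    using ex_generator[of z "\<lambda>i. [x0, x1, x2, x3, x4, x5, x6] ! i" "\<lambda>i j. [[e00, e01, e02, e03],
      [e10, e11, e12, e13],
      [e20, e21, e22, e23],
      [e30, e31, e32, e33],
      [e40, e41, e42, 0],
      [e50, e51, 0, 0],
      [e60, 0, 0, 0]] ! i ! j"] by blast
  interpret fiber_generator \<xi> \<eta> by unfold_locales (rule gen)
  have X: "X 0 z = x0" "X 1 z = x1" "X 2 z = x2" "X 3 z = x3" "X 4 z = x4" "X 5 z = x5" "X 6 z = x6"
    unfolding X_def by (subst X; simp add: One_nat_def)+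
  have E: "E 0 0 z = e00" "E 0 1 z = e01" "E 0 2 z = e02" "E 0 3 z = e03"
    "E 1 0 z = e10" "E 1 1 z = e11" "E 1 2 z = e12" "E 1 3 z = e13"
    "E 2 0 z = e20" "E 2 1 z = e21" "E 2 2 z = e22" "E 2 3 z = e23"
    "E 3 0 z = e30" "E 3 1 z = e31" "E 3 2 z = e32" "E 3 3 z = e33"
    "E 4 0 z = e40" "E 4 1 z = e41" "E 4 2 z = e42"
    "E 5 0 z = e50" "E 5 1 z = e51"
    "E 6 0 z = e60"
    unfolding E_def by (subst E; simp add: One_nat_def)+
  have len: "length kept = 28" by (simp add: kept_def)
  have "map (\<lambda>g. Y g z) kept = map t [0, 1, 2, 3, 4, 5, 6, 7, 8, 9, 10, 11, 12, 13, 14, 15, 16, 17, 18, 19, 20, 21, 22, 23, 24, 25, 26, 27]"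
    by (simp only: kept_def list.map Y_Base Ybase_eq Y_fd_order0 Y_fd_order1 Y_fd_order2 Y_fd_order3
      Y_Ddot_fd Y_Ddot2_fd Y_Ddot3_fd Y_lam5 Y_lam7 X E 0 1 2 3 4 5 6 7 8 9 10 11 12 13 14 15 16 17 18 19 20 21 22 23 24 25 26 27)
  also have "[0, 1, 2, 3, 4, 5, 6, 7, 8, 9, 10, 11, 12, 13, 14, 15, 16, 17, 18, 19, 20, 21, 22, 23, 24, 25, 26, 27] = [0..<28]" by (simp add: upt_conv_Cons One_nat_def[symmetric])
  finally have eq: "map (\<lambda>g. Y g z) kept = map t [0..<28]" .
  have "Y (kept ! n) z = t n" if "n < 28" for n
    using arg_cong[OF eq, of "\<lambda>l. l ! n"] that len by simp
  then show ?thesis using gen len by auto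
qed

section \<open>Triangular dependence of the betas on eleven coordinates\<close>

definition cd :: "4 list \<Rightarrow> coord" where "cd ks = Der (mset ks)"

text \<open>Counting the four indices lets the simplifier decide whether two concrete multi-indices
  agree.\<close>

lemma mset_eq_4: "mset ks = mset (ls :: 4 list) \<longleftrightarrow> count_list ks 1 = count_list ls 1 \<and> count_list ks 2 = count_list ls 2 \<and>
    count_list ks 3 = count_list ls 3 \<and> count_list ks 4 = count_list ls 4"
  by (simp add: multiset_eq_iff count_mset forall_4)

lemma fd_upd: "fd ks (z(cd ls := t)) = (if count_list ks 1 = count_list ls 1 \<and> count_list ks 2 = count_list ls 2 \<and>
    count_list ks 3 = count_list ls 3 \<and> count_list ks 4 = count_list ls 4 then t else fd ks z)"
  by (simp add: fd_def cd_def mset_eq_4)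

lemma Base_neq_cd [simp]: "Base k \<noteq> cd ls" by (simp add: cd_def)

lemma Ddot_fd: "Ddot (fd ks) z = fd (1 # ks) z + z (Base 3) * fd (2 # ks) z + z (Base 4) * fd (3 # ks) z + fd [] z * fd (4 # ks) z"
  by (simp add: Ddot_def)

lemma Ddot2_fd4: "Ddot (Ddot (fd [4])) z = Ddot (fd [1,4]) z + z (Base 4) * fd [2,4] z + z (Base 3) * Ddot (fd [2,4]) z
    + fd [] z * fd [3,4] z + z (Base 4) * Ddot (fd [3,4]) z + Ddot (fd []) z * fd [4,4] z + fd [] z * Ddot (fd [4,4]) z"
proof -
  have "Ddot (fd [4]) = (\<lambda>z. fd [1,4] z + z (Base 3) * fd [2,4] z + z (Base 4) * fd [3,4] z + fd [] z * fd [4,4] z)"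
    by (simp add: fun_eq_iff Ddot_fd)
  then show ?thesis by (simp add: total_simps tame_UNIV_simps)
qed

lemmas upd_simps = lam_defs Let_def Ddot2_fd4 Ddot_fd fd_upd

text \<open>This and the next ten lemmas each vary one coordinate of \<open>solved\<close> and cover
  the lambdas that enter the corresponding beta and the earlier ones. Among these exactly one moves,
  linearly with a constant coefficient; lambdas of later betas may depend on the coordinate too,
  which a triangular system allows.\<close>

lemma lam_upd0:
  fixes z t defines "z' \<equiv> z(cd [3,3,4] := t)"
  shows "lam4 z' = lam4 z" "lam5 z' = lam5 z" "lam6 z' = lam6 z" "lam7 z' = lam7 z"
    "lam8 z' = lam8 z + (t - fd [3,3,4] z)"
  unfolding z'_def by (simp_all add: upd_simps field_simps)

lemma lam_upd1:
  fixes z t defines "z' \<equiv> z(cd [2,4,4] := t)"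
  shows "lam4 z' = lam4 z" "lam5 z' = lam5 z" "lam6 z' = lam6 z" "lam7 z' = lam7 z" "lam8 z' = lam8 z"
    "lam9 z' = lam9 z + (t - fd [2,4,4] z)"
  unfolding z'_def by (simp_all add: upd_simps field_simps)

lemma lam_upd2:
  fixes z t defines "z' \<equiv> z(cd [2,3,4] := t)"
  shows "lam4 z' = lam4 z" "lam5 z' = lam5 z" "lam6 z' = lam6 z" "lam7 z' = lam7 z" "lam8 z' = lam8 z"
    "lam9 z' = lam9 z"
    "lam10 z' = lam10 z + (t - fd [2,3,4] z)"
  unfolding z'_def by (simp_all add: upd_simps field_simps)

lemma lam_upd3:
  fixes z t defines "z' \<equiv> z(cd [2,2,4] := t)"
  shows "lam4 z' = lam4 z" "lam5 z' = lam5 z" "lam6 z' = lam6 z" "lam7 z' = lam7 z" "lam8 z' = lam8 z"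
    "lam9 z' = lam9 z" "lam10 z' = lam10 z"
    "lam11 z' = lam11 z - 2 * (t - fd [2,2,4] z)"
  unfolding z'_def by (simp_all add: upd_simps field_simps)

lemma lam_upd4:
  fixes z t defines "z' \<equiv> z(cd [1,4] := t)"
  shows "lam4 z' = lam4 z" "lam5 z' = lam5 z" "lam6 z' = lam6 z" "lam7 z' = lam7 z" "lam8 z' = lam8 z"
    "lam9 z' = lam9 z" "lam10 z' = lam10 z" "lam11 z' = lam11 z"
    "lam12 z' = lam12 z + (t - fd [1,4] z)"
  unfolding z'_def by (simp_all add: upd_simps field_simps)

lemma lam_upd5:
  fixes z t defines "z' \<equiv> z(cd [1,4,4] := t)"
  shows "lam4 z' = lam4 z" "lam5 z' = lam5 z" "lam6 z' = lam6 z" "lam7 z' = lam7 z" "lam8 z' = lam8 z"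
    "lam9 z' = lam9 z" "lam10 z' = lam10 z" "lam11 z' = lam11 z" "lam12 z' = lam12 z" "lam13 z' = lam13 z"
    "lam14 z' = lam14 z + (t - fd [1,4,4] z)"
  unfolding z'_def by (simp_all add: upd_simps field_simps)

lemma lam_upd6:
  fixes z t defines "z' \<equiv> z(cd [1,3,4] := t)"
  shows "lam4 z' = lam4 z" "lam5 z' = lam5 z" "lam6 z' = lam6 z" "lam7 z' = lam7 z" "lam8 z' = lam8 z"
    "lam9 z' = lam9 z" "lam10 z' = lam10 z" "lam11 z' = lam11 z" "lam12 z' = lam12 z" "lam13 z' = lam13 z"
    "lam14 z' = lam14 z"
    "lam15 z' = lam15 z + (t - fd [1,3,4] z)"
  unfolding z'_def by (simp_all add: upd_simps field_simps)

lemma lam_upd7: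
  fixes z t defines "z' \<equiv> z(cd [1,3,3] := t)"
  shows "lam4 z' = lam4 z" "lam5 z' = lam5 z" "lam6 z' = lam6 z" "lam7 z' = lam7 z" "lam8 z' = lam8 z"
    "lam9 z' = lam9 z" "lam10 z' = lam10 z" "lam11 z' = lam11 z" "lam12 z' = lam12 z" "lam13 z' = lam13 z"
    "lam14 z' = lam14 z" "lam15 z' = lam15 z"
    "lam16 z' = lam16 z + (t - fd [1,3,3] z)"
  unfolding z'_def by (simp_all add: upd_simps field_simps)

lemma lam_upd8:
  fixes z t defines "z' \<equiv> z(cd [1,2,4] := t)"
  shows "lam4 z' = lam4 z" "lam5 z' = lam5 z" "lam6 z' = lam6 z" "lam7 z' = lam7 z" "lam8 z' = lam8 z"
    "lam9 z' = lam9 z" "lam10 z' = lam10 z" "lam11 z' = lam11 z" "lam12 z' = lam12 z" "lam13 z' = lam13 z"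
    "lam14 z' = lam14 z" "lam15 z' = lam15 z" "lam16 z' = lam16 z"
    "lam17 z' = lam17 z + (t - fd [1,2,4] z)"
  unfolding z'_def by (simp_all add: upd_simps field_simps)

lemma lam_upd9:
  fixes z t defines "z' \<equiv> z(cd [1,2,3] := t)"
  shows "lam4 z' = lam4 z" "lam5 z' = lam5 z" "lam6 z' = lam6 z" "lam7 z' = lam7 z" "lam8 z' = lam8 z"
    "lam9 z' = lam9 z" "lam10 z' = lam10 z" "lam11 z' = lam11 z" "lam12 z' = lam12 z" "lam13 z' = lam13 z"
    "lam14 z' = lam14 z" "lam15 z' = lam15 z" "lam16 z' = lam16 z" "lam17 z' = lam17 z"
    "lam18 z' = lam18 z + (t - fd [1,2,3] z)"
  unfolding z'_def by (simp_all add: upd_simps field_simps)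

lemma lam_upd10:
  fixes z t defines "z' \<equiv> z(cd [1,1,4] := t)"
  shows "lam4 z' = lam4 z" "lam5 z' = lam5 z" "lam6 z' = lam6 z" "lam7 z' = lam7 z" "lam8 z' = lam8 z"
    "lam9 z' = lam9 z" "lam10 z' = lam10 z" "lam11 z' = lam11 z" "lam12 z' = lam12 z" "lam13 z' = lam13 z"
    "lam14 z' = lam14 z" "lam15 z' = lam15 z" "lam16 z' = lam16 z" "lam17 z' = lam17 z" "lam18 z' = lam18 z"
    "lam19 z' = lam19 z + (t - fd [1,1,4] z)"
  unfolding z'_def by (simp_all add: upd_simps field_simps)

text \<open>Coordinates with an index 1 that are absent from all lambdas. They are recovered at the
  end from total derivatives in \<open>kept\<close>.\<close>

definition others :: "coord list" where
  "others = [cd [1,1], cd [1,2,2], cd [1,1,1], cd [1,1,2], cd [1,1,3]]"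

lemma lam_upd_others:
  fixes z t c defines "z' \<equiv> z(c := t)"
  assumes "c \<in> set others"
  shows "lam4 z' = lam4 z" "lam5 z' = lam5 z" "lam6 z' = lam6 z" "lam7 z' = lam7 z" "lam8 z' = lam8 z"
    "lam9 z' = lam9 z" "lam10 z' = lam10 z" "lam11 z' = lam11 z" "lam12 z' = lam12 z" "lam13 z' = lam13 z"
    "lam14 z' = lam14 z" "lam15 z' = lam15 z" "lam16 z' = lam16 z" "lam17 z' = lam17 z" "lam18 z' = lam18 z"
    "lam19 z' = lam19 z"
  using assms(2) unfolding z'_def others_def list.set insert_iff empty_iff simp_thms
  by (elim disjE; hypsubst; simp add: upd_simps)+

text \<open>The positions match those in \<open>betas\<close>: an entry may occur in later betas but
  in none before its own.\<close>

definition solved :: "coord list" where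
  "solved = [cd [3,3,4], cd [2,4,4], cd [2,3,4], cd [2,2,4], cd [1,4], cd [1,4,4], cd [1,3,4], cd [1,3,3], cd [1,2,4], cd [1,2,3], cd [1,1,4]]"

text \<open>The slope of each beta in its own solved coordinate. It involves only f_44 and f_444 and
  is therefore unaffected by changes of solved coordinates. The factor -2 comes from -54 f_224 / 27
  in \<open>lam11\<close>; the other leading coefficients are 1.\<close>

definition pivots :: "(jet \<Rightarrow> real) list" where
  "pivots = [\<lambda>z. lam6 z / lam4 z ^ 4,
    \<lambda>z. lam6 z / lam4 z ^ 4,
    \<lambda>z. lam6 z ^ 2 / lam4 z ^ 6,
    \<lambda>z. - 2 * lam6 z ^ 3 / lam4 z ^ 8,
    \<lambda>z. lam6 z ^ 2 / lam4 z ^ 4,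
    \<lambda>z. lam6 z / lam4 z ^ 3,
    \<lambda>z. lam6 z ^ 2 / lam4 z ^ 5,
    \<lambda>z. lam6 z ^ 3 / lam4 z ^ 7,
    \<lambda>z. lam6 z ^ 3 / lam4 z ^ 7,
    \<lambda>z. lam6 z ^ 4 / lam4 z ^ 9,
    \<lambda>z. lam6 z ^ 3 / lam4 z ^ 6]"

lemma bet_upd_less:
  shows "\<beta> \<in> set (take 1 betas) \<Longrightarrow> \<beta> (z(cd [2,4,4] := t)) = \<beta> z"
    "\<beta> \<in> set (take 2 betas) \<Longrightarrow> \<beta> (z(cd [2,3,4] := t)) = \<beta> z"
    "\<beta> \<in> set (take 3 betas) \<Longrightarrow> \<beta> (z(cd [2,2,4] := t)) = \<beta> z"
    "\<beta> \<in> set (take 4 betas) \<Longrightarrow> \<beta> (z(cd [1,4] := t)) = \<beta> z"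
    "\<beta> \<in> set (take 5 betas) \<Longrightarrow> \<beta> (z(cd [1,4,4] := t)) = \<beta> z"
    "\<beta> \<in> set (take 6 betas) \<Longrightarrow> \<beta> (z(cd [1,3,4] := t)) = \<beta> z"
    "\<beta> \<in> set (take 7 betas) \<Longrightarrow> \<beta> (z(cd [1,3,3] := t)) = \<beta> z"
    "\<beta> \<in> set (take 8 betas) \<Longrightarrow> \<beta> (z(cd [1,2,4] := t)) = \<beta> z"
    "\<beta> \<in> set (take 9 betas) \<Longrightarrow> \<beta> (z(cd [1,2,3] := t)) = \<beta> z"
    "\<beta> \<in> set (take 10 betas) \<Longrightarrow> \<beta> (z(cd [1,1,4] := t)) = \<beta> z"
  by (auto simp: betas_def bet_defs gam_defs Let_def One_nat_def lam_upd1 lam_upd2 lam_upd3 lam_upd4 lam_upd5 lam_upd6 lam_upd7 lam_upd8 lam_upd9 lam_upd10)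

text \<open>Here and in the next ten lemmas the coordinate enters through the last lambda of a
  gamma, which has coefficient 1 there.\<close>

lemma bet_upd0:
  assumes "z \<in> Omega"
  shows "bet1 (z(cd [3,3,4] := t)) = bet1 z + (lam6 z / lam4 z ^ 4) * (t - fd [3,3,4] z)"
proof -
  note nz = Omega_lam[OF assms]
  have eq: "gam6 (z(cd [3,3,4] := t)) = gam6 z + (t - fd [3,3,4] z)"
    using nz unfolding gam_defs Let_def lam_upd0
    by (simp add: divide_simps) (simp add: algebra_simps power2_eq_square power3_eq_cube)?
  show ?thesis
    using nz unfolding bet1_def gam4_def gam5_def lam_upd0 eq
    by (simp add: divide_simps) (simp add: algebra_simps)?
qed

lemma bet_upd1:
  assumes "z \<in> Omega"
  shows "bet2 (z(cd [2,4,4] := t)) = bet2 z + (lam6 z / lam4 z ^ 4) * (t - fd [2,4,4] z)"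
proof -
  note nz = Omega_lam[OF assms]
  have eq: "gam7 (z(cd [2,4,4] := t)) = gam7 z + (t - fd [2,4,4] z)"
    using nz unfolding gam_defs Let_def lam_upd1
    by (simp add: divide_simps) (simp add: algebra_simps power2_eq_square power3_eq_cube)?
  show ?thesis
    using nz unfolding bet2_def gam4_def gam5_def lam_upd1 eq
    by (simp add: divide_simps) (simp add: algebra_simps)?
qed

lemma bet_upd2:
  assumes "z \<in> Omega"
  shows "bet3 (z(cd [2,3,4] := t)) = bet3 z + (lam6 z ^ 2 / lam4 z ^ 6) * (t - fd [2,3,4] z)"
proof -
  note nz = Omega_lam[OF assms]
  have eq: "gam8 (z(cd [2,3,4] := t)) = gam8 z + (t - fd [2,3,4] z)"
    using nz unfolding gam_defs Let_def lam_upd2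
    by (simp add: divide_simps) (simp add: algebra_simps power2_eq_square power3_eq_cube)?
  show ?thesis
    using nz unfolding bet3_def gam4_def gam5_def lam_upd2 eq
    by (simp add: divide_simps) (simp add: algebra_simps)?
qed

lemma bet_upd3:
  assumes "z \<in> Omega"
  shows "bet4 (z(cd [2,2,4] := t)) = bet4 z + (- 2 * lam6 z ^ 3 / lam4 z ^ 8) * (t - fd [2,2,4] z)"
proof -
  note nz = Omega_lam[OF assms]
  have eq: "gam9 (z(cd [2,2,4] := t)) = gam9 z + -2 * (t - fd [2,2,4] z)"
    using nz unfolding gam_defs Let_def lam_upd3
    by (simp add: divide_simps) (simp add: algebra_simps power2_eq_square power3_eq_cube)?
  show ?thesis
    using nz unfolding bet4_def gam4_def gam5_def lam_upd3 eq
    by (simp add: divide_simps) (simp add: algebra_simps)?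
qed

lemma bet_upd4:
  assumes "z \<in> Omega"
  shows "bet5 (z(cd [1,4] := t)) = bet5 z + (lam6 z ^ 2 / lam4 z ^ 4) * (t - fd [1,4] z)"
proof -
  note nz = Omega_lam[OF assms]
  have eq: "gam10 (z(cd [1,4] := t)) = gam10 z + (t - fd [1,4] z)"
    using nz unfolding gam_defs Let_def lam_upd4
    by (simp add: divide_simps) (simp add: algebra_simps power2_eq_square power3_eq_cube)?
  show ?thesis
    using nz unfolding bet5_def gam4_def gam5_def lam_upd4 eq
    by (simp add: divide_simps) (simp add: algebra_simps)?
qed

lemma bet_upd5:
  assumes "z \<in> Omega"
  shows "bet6 (z(cd [1,4,4] := t)) = bet6 z + (lam6 z / lam4 z ^ 3) * (t - fd [1,4,4] z)"
proof -
  note nz = Omega_lam[OF assms]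
  have eq: "gam11 (z(cd [1,4,4] := t)) = gam11 z + (t - fd [1,4,4] z)"
    using nz unfolding gam_defs Let_def lam_upd5
    by (simp add: divide_simps) (simp add: algebra_simps power2_eq_square power3_eq_cube)?
  show ?thesis
    using nz unfolding bet6_def gam4_def gam5_def lam_upd5 eq
    by (simp add: divide_simps) (simp add: algebra_simps)?
qed

lemma bet_upd6:
  assumes "z \<in> Omega"
  shows "bet7 (z(cd [1,3,4] := t)) = bet7 z + (lam6 z ^ 2 / lam4 z ^ 5) * (t - fd [1,3,4] z)"
proof -
  note nz = Omega_lam[OF assms]
  have eq: "gam12 (z(cd [1,3,4] := t)) = gam12 z + (t - fd [1,3,4] z)"
    using nz unfolding gam_defs Let_def lam_upd6
    by (simp add: divide_simps) (simp add: algebra_simps power2_eq_square power3_eq_cube)?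
  show ?thesis
    using nz unfolding bet7_def gam4_def gam5_def lam_upd6 eq
    by (simp add: divide_simps) (simp add: algebra_simps)?
qed

lemma bet_upd7:
  assumes "z \<in> Omega"
  shows "bet8 (z(cd [1,3,3] := t)) = bet8 z + (lam6 z ^ 3 / lam4 z ^ 7) * (t - fd [1,3,3] z)"
proof -
  note nz = Omega_lam[OF assms]
  have eq: "gam13 (z(cd [1,3,3] := t)) = gam13 z + (t - fd [1,3,3] z)"
    using nz unfolding gam_defs Let_def lam_upd7
    by (simp add: divide_simps) (simp add: algebra_simps power2_eq_square power3_eq_cube)?
  show ?thesis
    using nz unfolding bet8_def gam4_def gam5_def lam_upd7 eq
    by (simp add: divide_simps) (simp add: algebra_simps)?
qed

lemma bet_upd8:
  assumes "z \<in> Omega"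
  shows "bet9 (z(cd [1,2,4] := t)) = bet9 z + (lam6 z ^ 3 / lam4 z ^ 7) * (t - fd [1,2,4] z)"
proof -
  note nz = Omega_lam[OF assms]
  have eq: "gam14 (z(cd [1,2,4] := t)) = gam14 z + (t - fd [1,2,4] z)"
    using nz unfolding gam_defs Let_def lam_upd8
    by (simp add: divide_simps) (simp add: algebra_simps power2_eq_square power3_eq_cube)?
  show ?thesis
    using nz unfolding bet9_def gam4_def gam5_def lam_upd8 eq
    by (simp add: divide_simps) (simp add: algebra_simps)?
qed

lemma bet_upd9:
  assumes "z \<in> Omega"
  shows "bet10 (z(cd [1,2,3] := t)) = bet10 z + (lam6 z ^ 4 / lam4 z ^ 9) * (t - fd [1,2,3] z)"
proof -
  note nz = Omega_lam[OF assms]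
  have eq: "gam15 (z(cd [1,2,3] := t)) = gam15 z + (t - fd [1,2,3] z)"
    using nz unfolding gam_defs Let_def lam_upd9
    by (simp add: divide_simps) (simp add: algebra_simps power2_eq_square power3_eq_cube)?
  show ?thesis
    using nz unfolding bet10_def gam4_def gam5_def lam_upd9 eq
    by (simp add: divide_simps) (simp add: algebra_simps)?
qed

lemma bet_upd10:
  assumes "z \<in> Omega"
  shows "bet11 (z(cd [1,1,4] := t)) = bet11 z + (lam6 z ^ 3 / lam4 z ^ 6) * (t - fd [1,1,4] z)"
proof -
  note nz = Omega_lam[OF assms]
  have eq: "gam16 (z(cd [1,1,4] := t)) = gam16 z + (t - fd [1,1,4] z)"
    using nz unfolding gam_defs Let_def lam_upd10
    by (simp add: divide_simps) (simp add: algebra_simps power2_eq_square power3_eq_cube)?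
  show ?thesis
    using nz unfolding bet11_def gam4_def gam5_def lam_upd10 eq
    by (simp add: divide_simps) (simp add: algebra_simps)?
qed

lemma bet_upd_others: "\<beta> \<in> set betas \<Longrightarrow> c \<in> set others \<Longrightarrow> \<beta> (z(c := t)) = \<beta> z"
  unfolding betas_def by (auto simp: bet_defs gam_defs Let_def lam_upd_others)

lemma fd_solved_upd:
  assumes "c \<in> set solved" shows "fd [4,4] (z(c := t)) = fd [4,4] z" "fd [4,4,4] (z(c := t)) = fd [4,4,4] z"
  using assms by (auto simp: solved_def fd_upd)

lemma Omega_solved_upd: "z \<in> Omega \<Longrightarrow> c \<in> set solved \<Longrightarrow> z(c := t) \<in> Omega"
  by (simp add: Omega_def fd_solved_upd)

lemma pivots_solved_upd:
  assumes "g \<in> set pivots" "c \<in> set solved" shows "g (z(c := t)) = g z"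
  using assms(1) fd_solved_upd[OF assms(2)] by (auto simp: pivots_def lam4_def lam6_def)

lemma length_lists [simp]: "length betas = 11" "length solved = 11" "length pivots = 11"
  by (simp_all add: betas_def solved_def pivots_def)

lemma less_11: "j < 11 \<Longrightarrow> j = 0 \<or> j = 1 \<or> j = 2 \<or> j = 3 \<or> j = 4 \<or> j = 5 \<or> j = 6 \<or> j = 7 \<or> j = 8 \<or> j = 9 \<or> j = (10::nat)"
  by arith

lemma pivots_nonzero:
  assumes "z \<in> Omega" "j < 11" shows "(pivots ! j) z \<noteq> 0"
  using Omega_lam[OF assms(1)] less_11[OF assms(2)] by (elim disjE) (simp_all add: pivots_def One_nat_def)

lemma bet_upd_greater:
  assumes "i < j" "j < 11" shows "(betas ! i) (z(solved ! j := t)) = (betas ! i) z"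
proof -
  have "betas ! i \<in> set (take j betas)" using assms by (auto simp: in_set_conv_nth intro!: exI[of _ i])
  with less_11[OF assms(2)] assms(1) show ?thesis
    by (elim disjE) (simp_all add: solved_def One_nat_def[symmetric] bet_upd_less)
qed

lemma bet_upd_same:
  assumes "z \<in> Omega" "j < 11"
  shows "(betas ! j) (z(solved ! j := t)) = (betas ! j) z + (pivots ! j) z * (t - z (solved ! j))"
proof -
  have cd: "fd ks z = z (cd ks)" for ks by (simp add: fd_def cd_def)
  note upd = bet_upd0 bet_upd1 bet_upd2 bet_upd3 bet_upd4 bet_upd5 bet_upd6 bet_upd7 bet_upd8 bet_upd9 bet_upd10
  show ?thesis
    using less_11[OF assms(2)]
    by (elim disjE) (simp_all add: betas_def solved_def pivots_def One_nat_def[symmetric] upd[OF assms(1), unfolded cd])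
qed

lemma pd_bet_less: "i < j \<Longrightarrow> j < 11 \<Longrightarrow> pd (solved ! j) (betas ! i) z = 0"
  by (intro pd_eqI) (simp add: bet_upd_greater)

lemma pd_bet_same: "z \<in> Omega \<Longrightarrow> j < 11 \<Longrightarrow> pd (solved ! j) (betas ! j) z = (pivots ! j) z"
  by (intro pd_eqI) (auto simp: bet_upd_same intro!: derivative_eq_intros)

text \<open>Test the relation on \<open>solved ! i\<close>, going down from the last index: betas
  before the \<open>i\<close>-th do not contain this coordinate, and the coefficients of those after
  it are already known to vanish.\<close>

lemma betas_independent: "functionally_independent Omega betas"
  unfolding functionally_independent_def
proof (intro ballI allI impI)
  fix z a i assume z: "z \<in> Omega" and eq: "\<forall>c. (\<Sum>i<length betas. a i * pd c (betas ! i) z) = 0" and "i < length betas"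
  then have "i < 11" by simp
  then show "a i = 0"
  proof (induction "10 - i" arbitrary: i rule: less_induct)
    case less
    have "(\<Sum>k<11. a k * pd (solved ! i) (betas ! k) z) = (\<Sum>k<11. if k = i then a i * (pivots ! i) z else 0)"
    proof (rule sum.cong)
      fix k assume k: "k \<in> {..<11::nat}"
      show "a k * pd (solved ! i) (betas ! k) z = (if k = i then a i * (pivots ! i) z else 0)"
      proof (cases k i rule: linorder_cases)
        case greater
        then have "a k = 0" using k by (intro less.hyps) auto
        with greater show ?thesis by simp
      qed (use k less.prems z in \<open>simp_all add: pd_bet_less pd_bet_same\<close>)
    qed simp
    then have "a i * (pivots ! i) z = 0" using eq[rule_format, of "solved ! i"] less.prems by simp
    then show ?case using pivots_nonzero[OF z less.prems] by simp
  qed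
qed

section \<open>The common kernel of the differentials of the betas\<close>

lemma lie_fd: "lie u (fd ks) z = u (cd ks)"
  unfolding fd_def[abs_def] cd_def by (rule has_lieD[OF has_lie_coord]) simp

lemma lie_Base: "lie u (\<lambda>z. z (Base k)) z = u (Base k)"
  by (rule has_lieD[OF has_lie_coord]) simp

lemma lie_const: "lie u (\<lambda>z. k) z = 0"
  by (rule has_lieD[OF has_lie_const]) simp

lemma has_lie_UNIV: "tame UNIV J \<Longrightarrow> has_lie u J (lie u J z) z"
  by (rule has_lie_tame) auto

lemmas lie_simps = lie_fd lie_Base lie_const
  has_lieD[OF has_lie_add[OF has_lie_UNIV has_lie_UNIV refl]]
  has_lieD[OF has_lie_diff[OF has_lie_UNIV has_lie_UNIV refl]]
  has_lieD[OF has_lie_mult[OF has_lie_UNIV has_lie_UNIV refl]]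

lemma lie_Ddot:
  assumes "tame UNIV J"
  shows "lie u (Ddot J) z = lie u (Dtot 1 J) z + (u (Base 3) * Dtot 2 J z + z (Base 3) * lie u (Dtot 2 J) z)
    + (u (Base 4) * Dtot 3 J z + z (Base 4) * lie u (Dtot 3 J) z) + (u (cd []) * Dtot 4 J z + fd [] z * lie u (Dtot 4 J) z)"
  unfolding Ddot_def[abs_def] using assms by (simp add: lie_simps tame_UNIV_simps)

lemma Dtot_Ddot_UNIV:
  assumes "tame UNIV J"
  shows "Dtot 1 (Ddot J) = (\<lambda>z. Ddot (Dtot 1 J) z + fd [1] z * Dtot 4 J z)"
    "Dtot 2 (Ddot J) = (\<lambda>z. Ddot (Dtot 2 J) z + fd [2] z * Dtot 4 J z)"
    "Dtot 3 (Ddot J) = (\<lambda>z. Ddot (Dtot 3 J) z + Dtot 2 J z + fd [3] z * Dtot 4 J z)"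
    "Dtot 4 (Ddot J) = (\<lambda>z. Ddot (Dtot 4 J) z + Dtot 3 J z + fd [4] z * Dtot 4 J z)"
  by (simp_all add: fun_eq_iff Dtot_Ddot[OF assms UNIV_I])

lemma Dtot_UNIV:
  assumes "tame UNIV J" "tame UNIV K"
  shows "Dtot k (\<lambda>z. J z + K z) = (\<lambda>z. Dtot k J z + Dtot k K z)"
    "Dtot k (\<lambda>z. J z * K z) = (\<lambda>z. Dtot k J z * K z + J z * Dtot k K z)"
  using assms by (simp_all add: fun_eq_iff total_simps)

lemma cd_sort:
  "cd (2 # 1 # ks) = cd (1 # 2 # ks)" "cd (3 # 1 # ks) = cd (1 # 3 # ks)" "cd (4 # 1 # ks) = cd (1 # 4 # ks)"
  "cd (3 # 2 # ks) = cd (2 # 3 # ks)" "cd (4 # 2 # ks) = cd (2 # 4 # ks)" "cd (4 # 3 # ks) = cd (3 # 4 # ks)"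
  "cd (k # 2 # 1 # ks) = cd (k # 1 # 2 # ks)" "cd (k # 3 # 1 # ks) = cd (k # 1 # 3 # ks)"
  "cd (k # 4 # 1 # ks) = cd (k # 1 # 4 # ks)" "cd (k # 3 # 2 # ks) = cd (k # 2 # 3 # ks)"
  "cd (k # 4 # 2 # ks) = cd (k # 2 # 4 # ks)" "cd (k # 4 # 3 # ks) = cd (k # 3 # 4 # ks)"
  by (simp_all add: cd_def add_mset_commute)

lemma jet_order_le_3:
  assumes "jet_order c \<le> 3"
  obtains k where "c = Base k" | "c = cd []" | k where "c = cd [k]" | k l where "c = cd [k, l]"
    | k l m where "c = cd [k, l, m]"
proof (cases c)
  case (Der \<alpha>)
  obtain ks where ks: "mset ks = \<alpha>" by (rule ex_mset[THEN exE])
  then have c: "c = cd ks" and "length ks \<le> 3" using Der assms by (auto simp: cd_def)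
  then consider "length ks = 0" | "length ks = 1" | "length ks = 2" | "length ks = 3" by linarith
  then show ?thesis
  proof cases
    case 1 then show ?thesis using that c by simp
  next
    case 2 then show ?thesis using that c by (auto simp: One_nat_def length_Suc_conv)
  next
    case 3 then show ?thesis using that c by (auto simp: numeral_2_eq_2 length_Suc_conv)
  next
    case 4 then show ?thesis using that c by (auto simp: numeral_3_eq_3 length_Suc_conv)
  qed
qed (use that in auto)

lemma pd_bet_others: "\<beta> \<in> set betas \<Longrightarrow> c \<in> set others \<Longrightarrow> pd c \<beta> z = 0"
  by (intro pd_eqI) (simp add: bet_upd_others)

text \<open>The differentials of the 28 kept functions and the 11 betas span those of all 39
  coordinates of order at most 3. The elimination alternates between the two lists, because each
  contains coordinates that only the other determines.\<close>

lemma kept_betas_coordinates: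
  assumes z: "z \<in> Omega" and kept: "\<And>g. g \<in> set kept \<Longrightarrow> lie u g z = 0"
    and bet: "\<And>\<beta>. \<beta> \<in> set betas \<Longrightarrow> lie u \<beta> z = 0" and c: "jet_order c \<le> 3"
  shows "u c = 0"
proof -
  have nz: "fd [4,4] z \<noteq> 0" "fd [4,4,4] z \<noteq> 0" using z by (simp_all add: Omega_def)
  have B: "u (Base 1) = 0" "u (Base 2) = 0" "u (Base 3) = 0" "u (Base 4) = 0"
    using kept[of "\<lambda>z. z (Base _)"] by (simp_all add: kept_def lie_Base)
  then have B: "u (Base k) = 0" for k using exhaust_4[of k] by auto
  have F: "u (cd []) = 0" "u (cd [4]) = 0" "u (cd [3]) = 0" "u (cd [2]) = 0" "u (cd [4,4]) = 0"
    "u (cd [3,4]) = 0" "u (cd [3,3]) = 0" "u (cd [2,3]) = 0" "u (cd [2,2]) = 0" "u (cd [4,4,4]) = 0"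
    "u (cd [3,3,3]) = 0" "u (cd [2,3,3]) = 0" "u (cd [2,2,3]) = 0" "u (cd [2,2,2]) = 0"
    using kept[of "fd _"] unfolding lie_fd by (simp_all add: kept_def)
  have "lie u lam5 z = 0" "lie u lam7 z = 0" by (rule kept; simp add: kept_def)+
  moreover have "lie u lam5 z = - 2 * u (cd [2,4])" "lie u lam7 z = u (cd [3,4,4])"
    by (rule has_lieD[OF has_lie_eq_rhs], unfold lam_defs[abs_def] Let_def,
      (rule has_lie_divide[OF _ _ _ refl] lie_intros has_lie_UNIV[OF tame_fd[OF tame_set_UNIV]])+; simp add: lie_simps F)+
  ultimately have F': "u (cd [2,4]) = 0" "u (cd [3,4,4]) = 0" by simp_all
  have D: "lie u (Ddot (fd [])) z = 0" "lie u (Ddot (fd [2])) z = 0" "lie u (Ddot (fd [3])) z = 0"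
    "lie u (Ddot (fd [2,2])) z = 0" "lie u (Ddot (Ddot (fd []))) z = 0" "lie u (Ddot (Ddot (fd [2]))) z = 0"
    "lie u (Ddot (Ddot (fd [3]))) z = 0" "lie u (Ddot (Ddot (Ddot (fd [])))) z = 0"
    by (rule kept; simp add: kept_def)+
  \<comment> \<open>These come before the betas, which contain f_1, f_12 and f_13 through total
    derivatives.\<close>
  have F'': "u (cd [1]) = 0" "u (cd [1,2]) = 0" "u (cd [1,3]) = 0"
    using D(1,2,3) by (simp_all add: lie_Ddot tame_UNIV_simps lie_simps B F F' fd_sort cd_sort)
  have known: "u c = 0 \<or> c \<in> set solved \<union> set others" if "jet_order c \<le> 3" for c
    using that
  proof (cases rule: jet_order_le_3)
    case (1 k) then show ?thesis using B by simp
  next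
    case 2 then show ?thesis using F by simp
  next
    case (3 k) then show ?thesis using exhaust_4[of k] F F'' by auto
  next
    case (4 k l) then show ?thesis using exhaust_4[of k] exhaust_4[of l]
      by (elim disjE; hypsubst) (simp_all add: cd_sort F F' F'' solved_def others_def)
  next
    case (5 k l m) then show ?thesis using exhaust_4[of k] exhaust_4[of l] exhaust_4[of m]
      by (elim disjE; hypsubst) (simp_all add: cd_sort F F' F'' solved_def others_def)
  qed
  \<comment> \<open>Upward induction, opposite to the one for independence: in the
    \<open>i\<close>-th equation the earlier solved coordinates are settled and the later ones do
    not occur.\<close>
  have S: "u (solved ! i) = 0" if "i < 11" for i
    using that
  proof (induction i rule: less_induct)
    case (less i)
    have b: "betas ! i \<in> set betas" using less.prems by simp
    have dep: "dep {c. jet_order c \<le> 3} Omega (betas ! i)"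
      using bet_order_le[OF b] by (simp add: order_le_iff_dep)
    have o: "jet_order (solved ! i) \<le> 3"
      using less_11[OF less.prems] by (elim disjE) (simp_all add: solved_def cd_def One_nat_def)
    have "0 = (\<Sum>c | jet_order c \<le> 3. u c * pd c (betas ! i) z)"
      using bet[OF b] lie_eq_sum[OF finite_jet_order_le dep_pd_zero[OF dep z]] by metis
    also have "\<dots> = (\<Sum>c\<in>{solved ! i}. u c * pd c (betas ! i) z)"
    proof (rule sum.mono_neutral_right[OF finite_jet_order_le])
      show "\<forall>c\<in>{c. jet_order c \<le> 3} - {solved ! i}. u c * pd c (betas ! i) z = 0"
      proof
        fix c assume c: "c \<in> {c. jet_order c \<le> 3} - {solved ! i}"
        then consider "u c = 0" | "c \<in> set others" | j where "j < 11" "c = solved ! j" "j \<noteq> i"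
          using known[of c] by (auto simp: in_set_conv_nth)
        then show "u c * pd c (betas ! i) z = 0"
        proof cases
          case 3
          then show ?thesis using less.IH[of j] pd_bet_less[of i j] by (cases "j < i") auto
        qed (simp_all add: pd_bet_others[OF b])
      qed
    qed (use o in simp)
    also have "\<dots> = u (solved ! i) * (pivots ! i) z" using pd_bet_same[OF z less.prems] by simp
    finally show ?case using pivots_nonzero[OF z less.prems] by simp
  qed
  have S: "c \<in> set solved \<Longrightarrow> u c = 0" for c using S by (auto simp: in_set_conv_nth)
  have S': "u (cd [3,3,4]) = 0" "u (cd [2,4,4]) = 0" "u (cd [2,3,4]) = 0" "u (cd [2,2,4]) = 0" "u (cd [1,4]) = 0"
    "u (cd [1,4,4]) = 0" "u (cd [1,3,4]) = 0" "u (cd [1,3,3]) = 0" "u (cd [1,2,4]) = 0" "u (cd [1,2,3]) = 0"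
    "u (cd [1,1,4]) = 0" by (rule S; simp add: solved_def)+
  note simps = lie_Ddot tame_UNIV_simps lie_simps B F F' F'' S' fd_sort cd_sort Dtot_Ddot_UNIV
  \<comment> \<open>The total derivatives used from here on contain solved coordinates as well, such
    as f_224 in the one of f_22, so they become usable only now.\<close>
  have O1: "u (cd [1,2,2]) = 0" "u (cd [1,1]) = 0" using D(4,5) by (simp_all add: simps)
  have O2: "u (cd [1,1,2]) = 0" "u (cd [1,1,3]) = 0" using D(6,7) by (simp_all add: simps O1)
  have "u (cd [1,1,1]) = 0" using D(8) by (simp add: simps O1 O2 Dtot_UNIV)
  then show ?thesis using known[OF c] S O1 O2 by (auto simp: others_def)
qed

text \<open>Choose a generator that acts on \<open>kept\<close> at \<open>z\<close> as
  \<open>v\<close> does. Its difference \<open>u\<close> from \<open>v\<close> also kills the betas,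
  hence vanishes on all coordinates of order at most 3, so \<open>v\<close> acts on \<open>J\<close>
  as the generator does, namely by 0.\<close>

lemma invariant_tangent:
  assumes U: "U \<subseteq> Omega" and J: "differential_invariant 3 U J" and z: "z \<in> U"
    and v: "\<And>\<beta>. \<beta> \<in> set betas \<Longrightarrow> lie v \<beta> z = 0"
  shows "lie v J z = 0"
proof -
  have zO: "z \<in> Omega" using U z by blast
  have sJ: "smooth_on U J" "order_le 3 U J" using J by (simp_all add: differential_invariant_def)
  have tJ: "tame U J" by (rule order_le_tame[OF sJ])
  obtain \<xi> \<eta> where gen: "generator \<xi> \<eta>"
    and Yk: "\<And>n. n < length kept \<Longrightarrow> fiber_generator.Y \<xi> \<eta> (kept ! n) z = lie v (kept ! n) z"
    using ex_generator_kept[OF zO, of "\<lambda>n. lie v (kept ! n) z"] by blast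
  interpret fiber_generator \<xi> \<eta> by unfold_locales (rule gen)
  have Y: "Y J z = 0"
    using J gen z Yprol_eq[OF tJ sJ(2) z] by (simp add: differential_invariant_def)
  define u where "u c = v c - W z c" for c
  have lu: "lie u K z = lie v K z - Y K z" for K
    using lie_linear[of 1 v "- 1" "W z" K z] by (simp add: u_def[abs_def] Y_def)
  have u: "u c = 0" if "jet_order c \<le> 3" for c
    using zO _ _ that
  proof (rule kept_betas_coordinates)
    show "lie u g z = 0" if "g \<in> set kept" for g
      using that Yk unfolding lu by (auto simp: in_set_conv_nth)
    show "lie u \<beta> z = 0" if "\<beta> \<in> set betas" for \<beta>
      unfolding lu using v[OF that] Y_bet[OF zO that] by simp
  qed
  have dep: "dep {c. jet_order c \<le> 3} U J" using sJ(2) by (simp add: order_le_iff_dep)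
  have "lie u J z = (\<Sum>c | jet_order c \<le> 3. u c * pd c J z)"
    by (rule lie_eq_sum[OF finite_jet_order_le dep_pd_zero[OF dep z]])
  then have "lie u J z = 0" using u by simp
  then show ?thesis unfolding lu using Y by simp
qed

subsection \<open>Solving for the coordinates on which the invariants depend triangularly\<close>

text \<open>One sweep of forward substitution. Each step is exact because the beta is affine in its
  coordinate, and later steps leave it alone by triangularity. The pivot may be taken at
  \<open>z\<close> instead of \<open>w\<close> by \<open>solve_pivots\<close>.\<close>

primrec solve :: "nat \<Rightarrow> (nat \<Rightarrow> real) \<Rightarrow> jet \<Rightarrow> jet" where
  "solve 0 b z = z"
| "solve (Suc n) b z = (let w = solve n b z in
    w(solved ! n := w (solved ! n) + (b n - (betas ! n) w) / (pivots ! n) z))"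

lemma solve_Omega: "z \<in> Omega \<Longrightarrow> n \<le> 11 \<Longrightarrow> solve n b z \<in> Omega"
  by (induction n) (auto simp: Let_def intro!: Omega_solved_upd)

lemma solve_pivots: "g \<in> set pivots \<Longrightarrow> n \<le> 11 \<Longrightarrow> g (solve n b z) = g z"
  by (induction n) (auto simp: Let_def pivots_solved_upd)

lemma betas_solve:
  assumes "z \<in> Omega" "n \<le> 11" "i < n" shows "(betas ! i) (solve n b z) = b i"
  using assms(2,3)
proof (induction n)
  case (Suc n)
  have O: "solve n b z \<in> Omega" using Suc.prems assms(1) by (intro solve_Omega) auto
  have p: "(pivots ! n) (solve n b z) = (pivots ! n) z" using Suc.prems by (intro solve_pivots) auto
  show ?case
  proof (cases "i = n")
    case True
    have n: "n < 11" using Suc.prems by simp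
    show ?thesis
      unfolding True solve.simps Let_def bet_upd_same[OF O n] using p pivots_nonzero[OF assms(1) n] by simp
  next
    case False
    then have "i < n" "n < 11" using Suc.prems by simp_all
    then show ?thesis unfolding solve.simps Let_def bet_upd_greater[OF \<open>i < n\<close> \<open>n < 11\<close>] by (intro Suc.IH) simp_all
  qed
qed simp

text \<open>With a point's own beta values every correction is 0, so the section passes through that
  point.\<close>

lemma solve_id: "(\<And>i. i < n \<Longrightarrow> (betas ! i) z = b i) \<Longrightarrow> solve n b z = z"
  by (induction n) (auto simp: Let_def)

text \<open>Smoothness in the beta values at a fixed base point makes the representing function
  \<open>F\<close> smooth.\<close>

lemma solve_tame_comp:
  assumes z: "z \<in> Omega" and "n \<le> 11"
  shows "smooth_on UNIV (\<lambda>b. solve n b z c)"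
  using assms(2)
proof (induction n arbitrary: c)
  case 0 show ?case by (simp add: smooth_on_const)
next
  case (Suc n)
  have b: "tame Omega (betas ! n)" using Suc.prems by (intro bet_tame) simp
  have sb: "smooth_on UNIV (\<lambda>b. (betas ! n) (solve n b z))"
    using Suc by (intro smooth_on_compose[OF b]) (auto intro: solve_Omega[OF z])
  show ?case
  proof (cases "c = solved ! n")
    case True
    have "smooth_on UNIV (\<lambda>b. solve n b z c + (b n + (- 1) * (betas ! n) (solve n b z)) * inverse ((pivots ! n) z))"
      using Suc sb by (intro smooth_on_add smooth_on_mult smooth_on_const smooth_on_coord) auto
    then show ?thesis using True by (simp add: Let_def divide_inverse)
  next
    case False then show ?thesis using Suc by (simp add: Let_def)
  qed
qed

lemma pivots_tame: "g \<in> set pivots \<Longrightarrow> tame Omega g"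
  using Omega_lam unfolding pivots_def
  by (auto intro!: tame_divide tame_mult tame_power tame_minus tame_const tame_set_Omega tame_Omega_lam)

text \<open>Joint continuity yields one neighbourhood of base points and of beta values for which
  the solved points remain in \<open>U\<close>.\<close>

lemma continuous_on_solve:
  "n \<le> 11 \<Longrightarrow> continuous_on (UNIV \<times> Omega) (\<lambda>p. solve n (fst p) (snd p))"
proof (induction n)
  case 0
  show ?case by (simp add: continuous_on_snd)
next
  case (Suc n)
  then have IH: "continuous_on (UNIV \<times> Omega) (\<lambda>p. solve n (fst p) (snd p))" by simp
  have coord: "continuous_on (UNIV \<times> Omega) (\<lambda>p. solve n (fst p) (snd p) c)" for c
    by (rule continuous_on_product_then_coordinatewise[OF IH])
  have b: "tame Omega (betas ! n)" using Suc.prems by (intro bet_tame) simp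
  have bet: "continuous_on (UNIV \<times> Omega) (\<lambda>p. (betas ! n) (solve n (fst p) (snd p)))"
    by (rule continuous_on_compose2[OF smooth_onD(2)[OF tame_smooth[OF b]] IH])
      (use Suc.prems solve_Omega in auto)
  have "continuous_on Omega (pivots ! n)"
    using Suc.prems by (intro smooth_onD(2) tame_smooth pivots_tame) simp
  then have piv: "continuous_on (UNIV \<times> Omega) (\<lambda>p. (pivots ! n) (snd p))"
    by (rule continuous_on_compose2[OF _ continuous_on_snd[OF continuous_on_id]]) auto
  have bn: "continuous_on (UNIV \<times> Omega) (\<lambda>p. fst p n)"
    by (rule continuous_on_product_then_coordinatewise[OF continuous_on_fst[OF continuous_on_id]])
  have nz: "\<forall>p\<in>UNIV \<times> Omega. (pivots ! n) (snd p) \<noteq> 0" using pivots_nonzero Suc.prems by auto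
  show ?case
  proof (rule continuous_on_coordinatewise_then_product)
    fix c
    show "continuous_on (UNIV \<times> Omega) (\<lambda>p. solve (Suc n) (fst p) (snd p) c)"
      using coord bet piv bn nz by (cases "c = solved ! n") (auto simp: Let_def intro!: continuous_intros)
  qed
qed

text \<open>With the beta values \<open>b\<close> held fixed, \<open>solve\<close> projects a path
  of base points to a path inside one level set; this is the regularity needed to differentiate an
  invariant along it.\<close>

lemma solve_path_differentiable:
  fixes \<gamma> :: "real \<Rightarrow> jet"
  assumes "n \<le> 11" "\<gamma> t \<in> Omega" "\<And>c. (\<lambda>s. \<gamma> s c) differentiable (at t)"
    and piv: "\<And>s g. g \<in> set pivots \<Longrightarrow> (\<lambda>s. g (\<gamma> s)) differentiable (at t)"
  shows "(\<lambda>s. solve n b (\<gamma> s) c) differentiable (at t)"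
  using assms(1)
proof (induction n arbitrary: c)
  case 0 show ?case by (simp add: assms(3))
next
  case (Suc n)
  have IH: "(\<lambda>s. solve n b (\<gamma> s) c) differentiable (at t)" for c using Suc by simp
  have b: "tame Omega (betas ! n)" using Suc.prems by (intro bet_tame) simp
  obtain C where C: "finite C" "dep C Omega (betas ! n)" "smooth_on Omega (betas ! n)" using b by (elim tameE)
  have "((\<lambda>s. (betas ! n) (solve n b (\<gamma> s))) has_real_derivative
      (\<Sum>c\<in>C. deriv (\<lambda>s. solve n b (\<gamma> s) c) t * pd c (betas ! n) (solve n b (\<gamma> t)))) (at t)"
    using IH Suc.prems by (intro chain_rule[OF C(3,1,2)] solve_Omega assms(2))
      (auto simp: DERIV_deriv_iff_real_differentiable)
  then have bet: "(\<lambda>s. (betas ! n) (solve n b (\<gamma> s))) differentiable (at t)"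
    using real_differentiable_def by blast
  have p: "(\<lambda>s. (pivots ! n) (\<gamma> s)) differentiable (at t)" "(pivots ! n) (\<gamma> t) \<noteq> 0"
    using Suc.prems piv pivots_nonzero[OF assms(2)] by auto
  show ?case
  proof (cases "c = solved ! n")
    case True
    have "(\<lambda>s. solve n b (\<gamma> s) c + (b n - (betas ! n) (solve n b (\<gamma> s))) / (pivots ! n) (\<gamma> s)) differentiable (at t)"
      using IH bet p by (intro differentiable_add differentiable_divide differentiable_diff differentiable_const) auto
    then show ?thesis using True by (simp add: Let_def)
  next
    case False then show ?thesis using IH by (simp add: Let_def)
  qed
qed

section \<open>Invariants as functions of the betas\<close>

text \<open>Shrink the proper factors of a basic open set to intervals around the coordinates of
  \<open>z0\<close>. The other factors remain full, which preserves openness in the product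
  topology.\<close>

lemma star_box:
  assumes "open B" "z0 \<in> (B :: jet set)"
  obtains N where "open N" "z0 \<in> N" "N \<subseteq> B"
    "\<And>w t. w \<in> N \<Longrightarrow> 0 \<le> t \<Longrightarrow> t \<le> 1 \<Longrightarrow> (\<lambda>c. (1 - t) * z0 c + t * w c) \<in> N"
proof -
  have "openin (product_topology (\<lambda>c::coord. euclidean :: real topology) UNIV) B"
    using assms(1) by (simp add: euclidean_product_topology)
  from product_topology_open_contains_basis[OF this assms(2)]
  obtain X where X: "z0 \<in> Pi\<^sub>E UNIV X" "\<And>c. open (X c)" "finite {c. X c \<noteq> UNIV}" "Pi\<^sub>E UNIV X \<subseteq> B"
    by auto
  have "z0 c \<in> X c" for c using X(1) by (auto simp: PiE_iff)
  then have "\<exists>e>0. ball (z0 c) e \<subseteq> X c" for c using X(2)[of c] open_contains_ball by blast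
  then obtain e where e: "\<And>c. e c > 0 \<and> ball (z0 c) (e c) \<subseteq> X c" by metis
  define Z where "Z c = (if X c = UNIV then UNIV else ball (z0 c) (e c))" for c
  have conv: "convex (Z c)" for c by (simp add: Z_def)
  have z0: "z0 c \<in> Z c" for c using e[of c] by (simp add: Z_def)
  show ?thesis
  proof (rule that[of "Pi\<^sub>E UNIV Z"])
    have "{c. Z c \<noteq> UNIV} \<subseteq> {c. X c \<noteq> UNIV}" by (auto simp: Z_def)
    then have "finite {c. Z c \<noteq> UNIV}" using X(3) by (rule finite_subset)
    moreover have "open (Z c)" for c by (simp add: Z_def)
    ultimately show "open (Pi\<^sub>E UNIV Z)" by (intro open_PiE)
    show "z0 \<in> Pi\<^sub>E UNIV Z" using z0 by auto
    have "Z c \<subseteq> X c" for c using e[of c] by (auto simp: Z_def)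
    then show "Pi\<^sub>E UNIV Z \<subseteq> B" using X(4) by (auto simp: PiE_iff subset_iff)
    fix w t assume w: "w \<in> Pi\<^sub>E UNIV Z" and t: "0 \<le> t" "t \<le> (1::real)"
    have "(1 - t) * z0 c + t * w c \<in> Z c" for c
    proof -
      have "w c \<in> Z c" using w by (auto simp: PiE_iff)
      then show ?thesis using convexD[OF conv z0, of "w c" c "1 - t" t] t by simp
    qed
    then show "(\<lambda>c. (1 - t) * z0 c + t * w c) \<in> Pi\<^sub>E UNIV Z" by (simp add: PiE_iff)
  qed
qed

lemma chain_rule_lie:
  assumes J: "tame U J" and "\<gamma> t \<in> U" and "\<And>c. ((\<lambda>s. \<gamma> s c) has_real_derivative v c) (at t)"
  shows "((\<lambda>s. J (\<gamma> s)) has_real_derivative lie v J (\<gamma> t)) (at t)"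
proof -
  obtain C where C: "finite C" "dep C U J" "smooth_on U J" using J by (elim tameE)
  have "lie v J (\<gamma> t) = (\<Sum>c\<in>C. v c * pd c J (\<gamma> t))"
    by (rule lie_eq_sum[OF C(1) dep_pd_zero[OF C(2) assms(2)]])
  then show ?thesis using chain_rule[OF C(3,1,2) assms(2,3)] by simp
qed

text \<open>Near \<open>z\<^sub>0\<close>, a point \<open>w\<close> is joined to \<open>solve 11 (\<beta> w) z\<^sub>0\<close> by a path on which the values of the
  \<open>\<beta>\<^sub>i\<close> are constant.  Since the generators span the common kernel of the \<open>d\<beta>\<^sub>i\<close>, an invariant is
  constant along this path.\<close>

lemma invariant_locally_function_of_betas:
  assumes U: "U \<subseteq> Omega" and J: "differential_invariant 3 U J"
  shows "locally_function_of U betas J"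
  unfolding locally_function_of_def
proof
  fix z0 assume z0: "z0 \<in> U"
  have sJ: "smooth_on U J" "order_le 3 U J" using J by (simp_all add: differential_invariant_def)
  have tJ: "tame U J" by (rule order_le_tame[OF sJ])
  have oU: "open U" by (rule tame_open[OF tJ])
  have oO: "open Omega" using tame_set_Omega unfolding tame_set_def by (rule tame_open)
  have z0O: "z0 \<in> Omega" using z0 U by blast
  have vals: "vals betas w i = (betas ! i) w" if "i < 11" for w i using that by (simp add: vals_def)
  have solve_vals: "solve 11 (vals betas w) w = w" for w by (rule solve_id) (simp add: vals)
  \<comment> \<open>A product neighbourhood inside \<open>S\<close> keeps the whole projected path
    in \<open>U\<close>: its beta values stay in \<open>A\<close> and its base points in
    \<open>B\<close>.\<close>
  define S where "S = (UNIV \<times> Omega) \<inter> (\<lambda>p. solve 11 (fst p) (snd p)) -` U"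
  have "open S" unfolding S_def
    by (rule continuous_open_preimage[OF continuous_on_solve _ oU]) (auto intro: open_Times oO)
  moreover have "(vals betas z0, z0) \<in> S" using z0 z0O solve_vals by (simp add: S_def)
  ultimately obtain A B where AB: "open A" "open B" "vals betas z0 \<in> A" "z0 \<in> B" "A \<times> B \<subseteq> S"
    by (auto elim!: open_prod_elim)
  obtain N where N: "open N" "z0 \<in> N" "N \<subseteq> B"
    "\<And>w t. w \<in> N \<Longrightarrow> 0 \<le> t \<Longrightarrow> t \<le> 1 \<Longrightarrow> (\<lambda>c. (1 - t) * z0 c + t * w c) \<in> N"
    using star_box[OF AB(2,4)] by metis
  define V where "V = {b. solve 11 b z0 \<in> U}"
  have sm: "smooth_on UNIV (\<lambda>b. solve 11 b z0 c)" for c by (rule solve_tame_comp[OF z0O]) simp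
  have "continuous_on UNIV (\<lambda>b. solve 11 b z0)"
    by (intro continuous_on_coordinatewise_then_product smooth_onD(2)[OF sm])
  from open_vimage[OF oU this] have oV: "open V" by (simp add: V_def vimage_def)
  have sF: "smooth_on V (\<lambda>b. J (solve 11 b z0))"
    by (rule smooth_on_compose[OF tJ oV smooth_on_subset[OF sm oV]]) (auto simp: V_def)
  define W where "W = (N \<inter> U) \<inter> (Omega \<inter> vals betas -` A)"
  have "continuous_on Omega (vals betas)"
  proof (rule continuous_on_coordinatewise_then_product)
    fix i
    have "continuous_on Omega (betas ! i)" if "i < 11"
      using that by (intro smooth_onD(2) tame_smooth bet_tame) simp
    then show "continuous_on Omega (\<lambda>w. vals betas w i)" by (cases "i < 11") (simp_all add: vals_def)
  qed
  then have "open W" unfolding W_def using N(1) oU AB(1) oO by (intro open_Int continuous_open_preimage)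
  moreover have "z0 \<in> W" using N(2) z0 z0O AB(3) by (simp add: W_def)
  moreover have "vals betas w \<in> V \<and> J w = J (solve 11 (vals betas w) z0)" if w: "w \<in> W" for w
  proof -
    define b where "b = vals betas w"
    have bA: "b \<in> A" using w by (simp add: W_def b_def)
    have "(b, z0) \<in> S" using bA AB(4,5) by blast
    then have bV: "b \<in> V" by (simp add: S_def V_def)
    \<comment> \<open>The straight segment from \<open>z0\<close> to \<open>w\<close> changes the
      betas; applying \<open>solve 11 b\<close> in \<open>\<delta>\<close> pushes it into the level
      set with values \<open>b\<close>.\<close>
    define \<gamma> where "\<gamma> t = (\<lambda>c. (1 - t) * z0 c + t * w c)" for t
    define \<delta> where "\<delta> t = solve 11 b (\<gamma> t)" for t
    have \<gamma>\<delta>: "\<gamma> t \<in> Omega" "\<delta> t \<in> U" if "t \<in> {0..1}" for t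
    proof -
      have "\<gamma> t \<in> N" unfolding \<gamma>_def using that w by (intro N(4)) (auto simp: W_def)
      then have "(b, \<gamma> t) \<in> S" using bA AB(5) N(3) by blast
      then show "\<gamma> t \<in> Omega" "\<delta> t \<in> U" by (simp_all add: S_def \<delta>_def)
    qed
    have \<gamma>_der: "((\<lambda>s. \<gamma> s c) has_real_derivative w c - z0 c) (at t)" for c t
      unfolding \<gamma>_def by (auto intro!: derivative_eq_intros)
    have "continuous_on UNIV \<gamma>"
      unfolding \<gamma>_def by (intro continuous_on_coordinatewise_then_product continuous_intros)
    from open_vimage[OF oO this] have o\<gamma>: "open {s. \<gamma> s \<in> Omega}" by (simp add: vimage_def)
    have "((\<lambda>s. J (\<delta> s)) has_real_derivative 0) (at t)" if t: "t \<in> {0..1}" for t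
    proof -
      have "(\<lambda>s. g (\<gamma> s)) differentiable (at t)" if "g \<in> set pivots" for g
        using chain_rule_lie[OF pivots_tame[OF that] \<gamma>\<delta>(1)[OF t] \<gamma>_der] real_differentiable_def by blast
      then have "(\<lambda>s. \<delta> s c) differentiable (at t)" for c
        unfolding \<delta>_def using \<gamma>\<delta>(1)[OF t] \<gamma>_der real_differentiable_def
        by (intro solve_path_differentiable) blast+
      then have v: "((\<lambda>s. \<delta> s c) has_real_derivative deriv (\<lambda>s. \<delta> s c) t) (at t)" for c
        by (simp add: DERIV_deriv_iff_real_differentiable)
      let ?v = "\<lambda>c. deriv (\<lambda>s. \<delta> s c) t"
      have \<delta>O: "\<delta> t \<in> Omega" using \<gamma>\<delta>(2)[OF t] U by blast
      have "lie ?v \<beta> (\<delta> t) = 0" if \<beta>: "\<beta> \<in> set betas" for \<beta>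
      proof -
        obtain i where i: "i < 11" "\<beta> = betas ! i" using \<beta> by (auto simp: in_set_conv_nth)
        have "\<forall>\<^sub>F s in nhds t. \<gamma> s \<in> Omega"
          using o\<gamma> \<gamma>\<delta>(1)[OF t] by (auto simp: eventually_nhds)
        \<comment> \<open>The betas are constant along \<open>\<delta>\<close> also for parameters
          just outside the unit interval, so the derivative is two-sided at the end points.\<close>
        then have "\<forall>\<^sub>F s in nhds t. \<beta> (\<delta> s) = b i"
          by eventually_elim (simp add: \<delta>_def i betas_solve)
        then have "((\<lambda>s. \<beta> (\<delta> s)) has_real_derivative 0) (at t)"
          using DERIV_cong_ev[OF refl _ refl, of "\<lambda>s. \<beta> (\<delta> s)" "\<lambda>s. b i" t 0] by simp
        then show ?thesis
          using DERIV_unique chain_rule_lie[OF bet_tame[OF \<beta>] \<delta>O v] by blast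
      qed
      then show ?thesis
        using chain_rule_lie[OF tJ \<gamma>\<delta>(2)[OF t] v] invariant_tangent[OF U J \<gamma>\<delta>(2)[OF t]] by simp
    qed
    \<comment> \<open>A vanishing derivative makes \<open>J\<close> equal at the two ends of
      \<open>\<delta>\<close>, which are \<open>w\<close> and the section point over
      \<open>b\<close>.\<close>
    then have "\<exists>x\<in>closed_segment 0 (1::real). J (\<delta> 1) - J (\<delta> 0) = (1 - 0) * 0"
      by (intro MVT_segment[where f = "\<lambda>s. J (\<delta> s)" and f' = "\<lambda>_. 0"]) (auto simp: closed_segment_eq_real_ivl)
    moreover have "\<delta> 1 = w" using solve_vals by (simp add: \<delta>_def \<gamma>_def b_def)
    moreover have "\<delta> 0 = solve 11 b z0" by (simp add: \<delta>_def \<gamma>_def)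
    ultimately show ?thesis using bV by (simp add: b_def)
  qed
  moreover have "W \<subseteq> U" by (auto simp: W_def)
  ultimately show "\<exists>W V F. open W \<and> z0 \<in> W \<and> W \<subseteq> U \<and> smooth_on V F \<and>
      (\<forall>w\<in>W. vals betas w \<in> V \<and> J w = F (vals betas w))"
    using sF by (intro exI[of _ W] exI[of _ V] exI[of _ "\<lambda>b. J (solve 11 b z0)"]) blast
qed

theorem theorem3p2:
  shows "(\<forall>\<gamma>\<in>set gammas. relative_invariant 3 Omega \<gamma>) \<and>
    (\<forall>\<beta>\<in>set betas. differential_invariant 3 Omega \<beta>) \<and>
    functionally_independent Omega betas \<and>
    (\<forall>U J. U \<subseteq> Omega \<and> differential_invariant 3 U J \<longrightarrow> locally_function_of U betas J) \<and>
    (\<forall>K\<in>{op1, op2, op3, op4}. invariant_operator 3 Omega K) \<and>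
    independent_operators Omega [op1, op2, op3, op4]"
proof (intro conjI)
  show "\<forall>\<gamma>\<in>set gammas. relative_invariant 3 Omega \<gamma>" using gam_relative_invariant by blast
  show "\<forall>\<beta>\<in>set betas. differential_invariant 3 Omega \<beta>" using bet_differential_invariant by blast
  show "functionally_independent Omega betas" by (rule betas_independent)
  show "\<forall>U J. U \<subseteq> Omega \<and> differential_invariant 3 U J \<longrightarrow> locally_function_of U betas J"
    using invariant_locally_function_of_betas by blast
  show "\<forall>K\<in>{op1, op2, op3, op4}. invariant_operator 3 Omega K" using op_invariant_operator by blast
  show "independent_operators Omega [op1, op2, op3, op4]" by (rule independent_ops)
qed

end
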